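(* Let $G$ be a finite simple graph. If $G$ contains $K_{3,4}$ as an induced minor, then $G$ contains a 3-path configuration as an induced subgraph.
   Context: $K_{a,b}$ is the complete bipartite graph with sides of sizes $a$ and $b$. A graph $H$ is an induced minor of $G$ if $H$ can be obtained from $G$ by repeatedly deleting vertices and contracting edges. Lengths of paths are numbers of edges; all paths are chordless (induced). A theta is a graph made of three internally vertex-disjoint chordless paths $P_1=a\dots b$, $P_2=a\dots b$, $P_3=a\dots b$, each of length at least two, with no edges between the paths except the three edges incident to $a$ and the three edges incident to $b$. A prism is a graph made of three vertex-disjoint chordless paths $P_1=a_1\dots b_1$, $P_2=a_2\dots b_2$, $P_3=a_3\dots b_3$ such that $\{a_1,a_2,a_3\}$ and $\{b_1,b_2,b_3\}$ are triangles, no edges exist between the paths except those of the two triangles, and either all three paths have length at least $1$, or one of them has length $0$ and each of the other two has length at least $2$. A pyramid is a graph made of three chordless paths $P_1=a\dots b_1$, $P_2=a\dots b_2$, $P_3=a\dots b_3$, each of length at least one and two of them of length at least two, vertex-disjoint except at $a$, such that $\{b_1,b_2,b_3\}$ is a triangle and no edges exist between the paths except those of the triangle and the three edges incident to $a$. A 3-path configuration (3PC) is a graph that is a theta, a prism or a pyramid. *)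

theory Defs
  imports "Graph_Theory.Graph_Theory"
begin

text \<open>
  A finite simple graph is a \<^locale>\<open>pair_graph\<close>: a finite loopless digraph whose arc relation is
  symmetric, so that an edge between \<open>u\<close> and \<open>v\<close> is the pair of arcs \<open>(u, v)\<close>, \<open>(v, u)\<close>.
\<close>

section \<open>Induced minors\<close>

text \<open>
  Contracting the edge between \<open>u\<close> and \<open>v\<close>: \<open>v\<close> is merged into \<open>u\<close>, which keeps its name. The loop
  coming from the contracted edge is dropped, and parallel edges collapse since arcs form a set.
\<close>

definition contract_edge :: "'a pair_pre_digraph \<Rightarrow> 'a \<Rightarrow> 'a \<Rightarrow> 'a pair_pre_digraph" where
  "contract_edge G u v =
    (let f = (\<lambda>x. if x = v then u else x) in
      \<lparr> pverts = f ` pverts G,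
        parcs = {(f x, f y) | x y. (x, y) \<in> parcs G \<and> f x \<noteq> f y} \<rparr>)"

inductive induced_minor_step :: "'a pair_pre_digraph \<Rightarrow> 'a pair_pre_digraph \<Rightarrow> bool" where
  delete: "v \<in> pverts G \<Longrightarrow> with_proj G' = pre_digraph.del_vert (with_proj G) v
    \<Longrightarrow> induced_minor_step G G'"
| contract: "(u, v) \<in> parcs G \<Longrightarrow> induced_minor_step G (contract_edge G u v)"

text \<open>\<open>induced_minor H G\<close>: up to isomorphism, \<open>H\<close> is obtained from \<open>G\<close> by such operations.\<close>

definition induced_minor :: "'b pair_pre_digraph \<Rightarrow> 'a pair_pre_digraph \<Rightarrow> bool" where
  "induced_minor H G \<longleftrightarrow>
    (\<exists>G'. induced_minor_step\<^sup>*\<^sup>* G G' \<and> digraph_iso (with_proj G') (with_proj H))"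

section \<open>3-path configurations\<close>

definition path_edges :: "'a vwalk \<Rightarrow> 'a rel" where
  "path_edges p = set (vwalk_arcs p) \<union> (set (vwalk_arcs p))\<inverse>"

definition chordless_path :: "'a pair_pre_digraph \<Rightarrow> 'a \<Rightarrow> 'a vwalk \<Rightarrow> 'a \<Rightarrow> bool" where
  "chordless_path G a p b \<longleftrightarrow>
    vpath p (with_proj G) \<and> hd p = a \<and> last p = b \<and>
    parcs G \<inter> (set p \<times> set p) = path_edges p"

definition triangle_edges :: "'a \<Rightarrow> 'a \<Rightarrow> 'a \<Rightarrow> 'a rel" where
  "triangle_edges x y z = {(u, v). u \<in> {x, y, z} \<and> v \<in> {x, y, z} \<and> u \<noteq> v}"

text \<open>
  In the next three definitions, the equation for \<open>parcs G\<close> says that the named triangles are present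
  and that there are no further edges between the paths. In a theta and a pyramid, the edges incident
  to the common ends of the paths are edges of the paths.
\<close>

definition theta :: "'a pair_pre_digraph \<Rightarrow> bool" where
  "theta G \<longleftrightarrow> pair_graph G \<and>
    (\<exists>a b P1 P2 P3.
      chordless_path G a P1 b \<and> chordless_path G a P2 b \<and> chordless_path G a P3 b \<and>
      vwalk_length P1 \<ge> 2 \<and> vwalk_length P2 \<ge> 2 \<and> vwalk_length P3 \<ge> 2 \<and>
      set P1 \<inter> set P2 = {a, b} \<and> set P1 \<inter> set P3 = {a, b} \<and> set P2 \<inter> set P3 = {a, b} \<and>
      pverts G = set P1 \<union> set P2 \<union> set P3 \<and>
      parcs G = path_edges P1 \<union> path_edges P2 \<union> path_edges P3)"

text \<open>If a path of a prism has length 0, its two ends coincide and the two triangles share a vertex.\<close>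

definition prism :: "'a pair_pre_digraph \<Rightarrow> bool" where
  "prism G \<longleftrightarrow> pair_graph G \<and>
    (\<exists>a1 a2 a3 b1 b2 b3 P1 P2 P3.
      chordless_path G a1 P1 b1 \<and> chordless_path G a2 P2 b2 \<and> chordless_path G a3 P3 b3 \<and>
      (vwalk_length P1 \<ge> 1 \<and> vwalk_length P2 \<ge> 1 \<and> vwalk_length P3 \<ge> 1 \<or>
       vwalk_length P1 = 0 \<and> vwalk_length P2 \<ge> 2 \<and> vwalk_length P3 \<ge> 2 \<or>
       vwalk_length P2 = 0 \<and> vwalk_length P1 \<ge> 2 \<and> vwalk_length P3 \<ge> 2 \<or>
       vwalk_length P3 = 0 \<and> vwalk_length P1 \<ge> 2 \<and> vwalk_length P2 \<ge> 2) \<and>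
      set P1 \<inter> set P2 = {} \<and> set P1 \<inter> set P3 = {} \<and> set P2 \<inter> set P3 = {} \<and>
      pverts G = set P1 \<union> set P2 \<union> set P3 \<and>
      parcs G = path_edges P1 \<union> path_edges P2 \<union> path_edges P3 \<union>
        triangle_edges a1 a2 a3 \<union> triangle_edges b1 b2 b3)"

definition pyramid :: "'a pair_pre_digraph \<Rightarrow> bool" where
  "pyramid G \<longleftrightarrow> pair_graph G \<and>
    (\<exists>a b1 b2 b3 P1 P2 P3.
      chordless_path G a P1 b1 \<and> chordless_path G a P2 b2 \<and> chordless_path G a P3 b3 \<and>
      vwalk_length P1 \<ge> 1 \<and> vwalk_length P2 \<ge> 1 \<and> vwalk_length P3 \<ge> 1 \<and>
      (vwalk_length P1 \<ge> 2 \<and> vwalk_length P2 \<ge> 2 \<or>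
       vwalk_length P1 \<ge> 2 \<and> vwalk_length P3 \<ge> 2 \<or>
       vwalk_length P2 \<ge> 2 \<and> vwalk_length P3 \<ge> 2) \<and>
      set P1 \<inter> set P2 = {a} \<and> set P1 \<inter> set P3 = {a} \<and> set P2 \<inter> set P3 = {a} \<and>
      pverts G = set P1 \<union> set P2 \<union> set P3 \<and>
      parcs G = path_edges P1 \<union> path_edges P2 \<union> path_edges P3 \<union> triangle_edges b1 b2 b3)"

definition three_path_configuration :: "'a pair_pre_digraph \<Rightarrow> bool" where
  "three_path_configuration G \<longleftrightarrow> theta G \<or> prism G \<or> pyramid G"

end

theory Submission
  imports Defs
begin

text \<open>
  Let the branch sets be \<open>A\<^sub>0, A\<^sub>1, A\<^sub>2\<close> and \<open>B\<^sub>0, \<dots>, B\<^sub>3\<close>. Everything rests on gluing two tripods (subdivided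
  claws, or triangles with three pendant paths) along their three ends: the result is a 3-path
  configuration unless the two centres coincide or are adjacent.

  Shrink every \<open>B\<^sub>j\<close> to a minimal connected set that still touches \<open>A\<^sub>0, A\<^sub>1, A\<^sub>2\<close>. It is then either skinny (a
  tripod whose ends may be chosen freely in the \<open>A\<^sub>i\<close>) or fat: a chordless path whose first vertex is the
  only one with neighbours in one \<open>A\<^sub>k\<close> and whose last vertex is the only one with neighbours in another \<open>A\<^sub>l\<close>,
  while the third set \<open>A\<^sub>m\<close>, its middle, is attached anywhere. Two skinny sets glue directly. If two fat sets have
  the same middle, then each of the other two \<open>B\<^sub>j\<close> has at most two vertices, and these are skinny. So three of
  the sets are fat with three different middles and the fourth is skinny. The paths of the three fat
  sets then close up, through the \<open>A\<^sub>i\<close>, to a hole without neighbours in the skinny set \<open>S\<close>, whereas each \<open>A\<^sub>i\<close>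
  contains a vertex with a neighbour in \<open>S\<close> and two nonadjacent neighbours on the fat path with middle
  \<open>A\<^sub>i\<close>. Two such vertices, joined through \<open>S\<close>, are the centres of a theta.
\<close>

text \<open>Gluing is always used contrapositively: without a 3-path configuration, two tripods with
  common ends have centres that coincide or touch, so the work lies in confining the two centres.
  This is why \<open>attach\<close> reports where the centre is and why \<open>skinny\<close> wants
  it inside \<open>S\<close>. Two fat sets with the same middle and a path through another
  \<open>B\<^sub>j\<close> give three parallel paths between two of the \<open>A\<^sub>i\<close>,
  with a tripod on either side. The fat paths are too long to bring the centres together, so the
  third path does it and has at most two vertices; the middle must touch it too, and minimality
  makes it the whole set. The number four comes from counting: at most one skinny set, and at most
  one fat set for each of the three middles. The last obstacle is that the connections closing the
  hole lie inside the \<open>A\<^sub>i\<close>, possibly two of them in the same one, and might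
  touch each other or the opposite fat path. Such a contact is a shortcut: it gives a smaller hole
  through only two of the fat paths, and the theta is already found there.\<close>

locale sgraph =
  fixes E :: "'a \<Rightarrow> 'a \<Rightarrow> bool"
  assumes E_sym: "E u v \<Longrightarrow> E v u"
    and E_irrefl: "\<not> E u u"
begin

lemma E_commute: "E u v \<longleftrightarrow> E v u"
  using E_sym by blast

lemma E_neq: "E u v \<Longrightarrow> u \<noteq> v"
  using E_irrefl by blast

subsection \<open>Chordless paths\<close>

text \<open>Each pair of vertices is inspected once, from the earlier one, and symmetry of
  \<open>E\<close> covers the other direction. On a one-vertex list the last conjunct is vacuous, so
  \<open>hd []\<close> never matters.\<close>

fun ipath :: "'a list \<Rightarrow> bool" where
  "ipath [] = True"
| "ipath (x # xs) = (x \<notin> set xs \<and> ipath xs \<and> (\<forall>y\<in>set xs. E x y \<longleftrightarrow> y = hd xs))"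

text \<open>All cutting and splicing of paths goes through this equivalence. If one part is empty,
  its \<open>last\<close> or \<open>hd\<close> is arbitrary but only occurs under an empty
  quantifier.\<close>

lemma ipath_append:
  "ipath (xs @ ys) \<longleftrightarrow> ipath xs \<and> ipath ys \<and> set xs \<inter> set ys = {} \<and>
    (\<forall>u\<in>set xs. \<forall>v\<in>set ys. E u v \<longleftrightarrow> u = last xs \<and> v = hd ys)"
proof (induction xs)
  case Nil
  then show ?case by simp
next
  case (Cons x xs)
  show ?case
  proof (cases "xs = []")
    case True
    then show ?thesis by auto
  next
    case False
    then have "last xs \<in> set xs" "hd xs \<in> set xs" by auto
    then have "hd xs \<notin> set ys" if "set xs \<inter> set ys = {}" using that by blast
    then show ?thesis using Cons False by (auto simp: hd_append)
  qed
qed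

lemma ipath_distinct: "ipath xs \<Longrightarrow> distinct xs"
  by (induction xs) auto

lemma ipath_rev [simp]: "ipath (rev xs) \<longleftrightarrow> ipath xs"
proof (induction xs)
  case Nil
  then show ?case by simp
next
  case (Cons x xs)
  then show ?case
    by (cases "xs = []") (auto simp: ipath_append last_rev E_commute[of _ x])
qed

lemma ipath_sub: "ipath (xs @ ys @ zs) \<Longrightarrow> ipath ys"
  by (simp add: ipath_append)

lemma ipath_nonadj_ends:
  assumes "ipath p" "length p \<ge> 3"
  shows "\<not> E (hd p) (last p)" "hd p \<noteq> last p"
proof -
  obtain x y z r where "p = x # y # z # r"
    using assms(2) by (metis (no_types) One_nat_def Suc_le_length_iff numeral_3_eq_3)
  with assms(1) show "\<not> E (hd p) (last p)" "hd p \<noteq> last p"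
    by (auto split: if_splits)
qed

lemma ipath_singleton_ends:
  assumes "ipath p" "p \<noteq> []" "hd p = last p"
  shows "p = [hd p]"
proof (cases p)
  case (Cons x xs)
  then show ?thesis using assms by (cases "xs = []") auto
qed (use assms in simp)

lemma ipath_adj_ends:
  assumes "ipath p" "p \<noteq> []" "E (hd p) (last p)"
  shows "p = [hd p, last p]"
proof (cases p)
  case (Cons x xs)
  show ?thesis
  proof (cases xs)
    case Nil
    then show ?thesis using Cons assms E_irrefl by auto
  next
    case (Cons y ys)
    then show ?thesis using \<open>p = x # xs\<close> assms
      by (cases "ys = []") auto
  qed
qed (use assms in simp)

definition meets :: "'a set \<Rightarrow> 'a set \<Rightarrow> bool" where
  "meets X Y \<longleftrightarrow> (\<exists>x\<in>X. \<exists>y\<in>Y. E x y)"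

text \<open>Connectedness asks for chordless paths, not walks, so that the paths it provides can
  serve directly as legs of tripods. The price is \<open>ipath_concat\<close>.\<close>

definition conn :: "'a set \<Rightarrow> bool" where
  "conn S \<longleftrightarrow> S \<noteq> {} \<and> (\<forall>x\<in>S. \<forall>y\<in>S. \<exists>p. ipath p \<and> p \<noteq> [] \<and> hd p = x \<and> last p = y \<and> set p \<subseteq> S)"

lemma conn_path:
  assumes "conn S" "x \<in> S" "y \<in> S"
  obtains p where "ipath p" "p \<noteq> []" "hd p = x" "last p = y" "set p \<subseteq> S"
  using assms unfolding conn_def by blast

text \<open>Cut \<open>p\<close> at its first neighbour of \<open>z\<close>: nothing before the cut
  is adjacent to \<open>z\<close>, so appending \<open>z\<close> there creates no chord.\<close>

lemma ipath_extend:
  assumes "ipath p" "p \<noteq> []" "E (last p) z" "z \<notin> set p"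
  shows "\<exists>q. ipath q \<and> q \<noteq> [] \<and> hd q = hd p \<and> last q = z \<and> set q \<subseteq> insert z (set p)"
proof -
  have "\<exists>x\<in>set p. E x z" using assms by (meson last_in_set)
  from split_list_first_prop[OF this] obtain ys x zs where
    p: "p = ys @ x # zs" "E x z" "\<forall>y\<in>set ys. \<not> E y z" by blast
  have "ipath ((ys @ [x]) @ [z])"
    using assms(1,4) p by (subst ipath_append) (auto simp: ipath_append)
  moreover have "hd (ys @ [x,z]) = hd p" using p by (cases ys) auto
  ultimately show ?thesis using p
    by (intro exI[of _ "ys @ [x, z]"]) auto
qed

text \<open>The vertices of \<open>q\<close> are appended one at a time. A vertex that is already on
  the path truncates it there; a new one is added by \<open>ipath_extend\<close>.\<close>

lemma ipath_concat:
  assumes "ipath p" "p \<noteq> []" "ipath q" "q \<noteq> []" "last p = hd q \<or> E (last p) (hd q)"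
  shows "\<exists>r. ipath r \<and> r \<noteq> [] \<and> hd r = hd p \<and> last r = last q \<and> set r \<subseteq> set p \<union> set q"
  using assms
proof (induction q arbitrary: p)
  case Nil
  then show ?case by simp
next
  case (Cons z q)
  have "\<exists>r. ipath r \<and> r \<noteq> [] \<and> hd r = hd p \<and> last r = z \<and> set r \<subseteq> insert z (set p)"
  proof (cases "z \<in> set p")
    case True
    then obtain ys zs where p: "p = ys @ z # zs" by (meson split_list)
    then have "ipath (ys @ [z])" using Cons.prems(1) by (auto simp: ipath_append)
    moreover have "hd (ys @ [z]) = hd p" using p by (cases ys) auto
    ultimately show ?thesis using p by (intro exI[of _ "ys @ [z]"]) auto
  next
    case False
    then show ?thesis using Cons.prems ipath_extend[of p z] by auto
  qed
  then obtain r where r: "ipath r" "r \<noteq> []" "hd r = hd p" "last r = z" "set r \<subseteq> insert z (set p)"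
    by blast
  show ?case
  proof (cases "q = []")
    case True
    then show ?thesis using r by auto
  next
    case False
    have "\<exists>r'. ipath r' \<and> r' \<noteq> [] \<and> hd r' = hd r \<and> last r' = last q \<and> set r' \<subseteq> set r \<union> set q"
      using Cons.IH[of r] r Cons.prems False by auto
    then show ?thesis using r False by fastforce
  qed
qed

lemma conn_union:
  assumes "conn S" "conn T" "S \<inter> T \<noteq> {} \<or> meets S T"
  shows "conn (S \<union> T)"
proof -
  obtain s t where st: "s \<in> S" "t \<in> T" "s = t \<or> E s t"
    using assms(3) unfolding meets_def by blast
  have *: "\<exists>p. ipath p \<and> p \<noteq> [] \<and> hd p = x \<and> last p = y \<and> set p \<subseteq> S \<union> T"
    if "x \<in> S" "y \<in> T" for x y
  proof -
    obtain p where p: "ipath p" "p \<noteq> []" "hd p = x" "last p = s" "set p \<subseteq> S"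
      using conn_path[OF assms(1) \<open>x \<in> S\<close> st(1)] .
    obtain q where q: "ipath q" "q \<noteq> []" "hd q = t" "last q = y" "set q \<subseteq> T"
      using conn_path[OF assms(2) st(2) \<open>y \<in> T\<close>] .
    have "last p = hd q \<or> E (last p) (hd q)" using p q st(3) by simp
    from ipath_concat[OF p(1,2) q(1,2) this] show ?thesis using p q by blast
  qed
  have sym: "\<exists>p. ipath p \<and> p \<noteq> [] \<and> hd p = y \<and> last p = x \<and> set p \<subseteq> S \<union> T"
    if "x \<in> S" "y \<in> T" for x y
  proof -
    from *[OF that] obtain p where "ipath p \<and> p \<noteq> [] \<and> hd p = x \<and> last p = y \<and> set p \<subseteq> S \<union> T"
      by blast
    then show ?thesis by (intro exI[of _ "rev p"]) (auto simp: hd_rev last_rev)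
  qed
  show ?thesis
    unfolding conn_def
  proof (intro conjI ballI)
    show "S \<union> T \<noteq> {}" using st by blast
    fix x y assume "x \<in> S \<union> T" "y \<in> S \<union> T"
    then consider "x \<in> S" "y \<in> S" | "x \<in> S" "y \<in> T" | "x \<in> T" "y \<in> S" | "x \<in> T" "y \<in> T" by blast
    then show "\<exists>p. ipath p \<and> p \<noteq> [] \<and> hd p = x \<and> last p = y \<and> set p \<subseteq> S \<union> T"
    proof cases
      case 1
      then show ?thesis using assms(1) unfolding conn_def by (meson sup.coboundedI1)
    next
      case 2
      then show ?thesis using * by blast
    next
      case 3
      then show ?thesis using sym by blast
    next
      case 4
      then show ?thesis using assms(2) unfolding conn_def by (meson sup.coboundedI2)
    qed
  qed
qed

lemma conn_singleton [simp]: "conn {x}"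
  unfolding conn_def by (auto intro!: exI[of _ "[x]"])

lemma conn_insert: "conn S \<Longrightarrow> x \<in> S \<or> (\<exists>s\<in>S. E x s) \<Longrightarrow> conn (insert x S)"
  using conn_union[of "{x}" S] unfolding meets_def by auto

lemma conn_ipath: "ipath p \<Longrightarrow> p \<noteq> [] \<Longrightarrow> conn (set p)"
proof (induction p)
  case (Cons x p)
  then show ?case by (cases "p = []") (auto intro!: conn_insert)
qed simp

lemma conn_path_first:
  assumes "conn S" "x \<in> S" "y \<in> S" "Q y"
  obtains p z where "ipath (p @ [z])" "hd (p @ [z]) = x" "set (p @ [z]) \<subseteq> S" "Q z" "\<forall>u\<in>set p. \<not> Q u"
proof -
  obtain p where p: "ipath p" "p \<noteq> []" "hd p = x" "last p = y" "set p \<subseteq> S"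
    using conn_path[OF assms(1,2,3)] .
  then have "\<exists>u\<in>set p. Q u" using assms(4) last_in_set by blast
  from split_list_first_prop[OF this] obtain ys z zs where
    yz: "p = ys @ z # zs" "Q z" "\<forall>u\<in>set ys. \<not> Q u" by blast
  have "ipath (ys @ [z])" using p(1) yz(1) by (auto simp: ipath_append)
  moreover have "hd (ys @ [z]) = x" using p(3) yz(1) by (cases ys) auto
  ultimately show ?thesis using that[of ys z] yz p by auto
qed

text \<open>Stop at the first vertex with \<open>Q\<close>, then discard everything before the last
  vertex with \<open>P\<close>. Each property is left at one end only.\<close>

lemma conn_path_between:
  assumes "conn S" "x \<in> S" "P x" "y \<in> S" "Q y"
  obtains p where "ipath p" "p \<noteq> []" "set p \<subseteq> S" "P (hd p)" "Q (last p)"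
    "\<forall>u\<in>set p. P u \<longrightarrow> u = hd p" "\<forall>u\<in>set p. Q u \<longrightarrow> u = last p"
proof -
  obtain p z where p: "ipath (p @ [z])" "hd (p @ [z]) = x" "set (p @ [z]) \<subseteq> S" "Q z"
      "\<forall>u\<in>set p. \<not> Q u"
    using conn_path_first[OF assms(1,2,4), of Q] assms(5) by blast
  have "\<exists>u\<in>set (p @ [z]). P u" using p(2) assms(3) by (metis hd_in_set snoc_eq_iff_butlast)
  from split_list_last_prop[OF this] obtain ys w zs where
    w: "p @ [z] = ys @ w # zs" "P w" "\<forall>u\<in>set zs. \<not> P u" by blast
  have "ipath (w # zs)" using p(1) w(1) ipath_sub[of ys "w # zs" "[]"] by simp
  moreover have "last (w # zs) = z" using w(1) by (metis last_appendR last_snoc list.distinct(1))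
  moreover have "\<forall>u\<in>set (w # zs). Q u \<longrightarrow> u = z"
    using p(5) w(1) by (metis Un_iff set_ConsD set_append append_Nil2 list.set_intros(1) list.set(2) insertE empty_iff list.set(1))
  ultimately show ?thesis using that[of "w # zs"] w p by auto
qed


subsection \<open>Tripods\<close>

text \<open>A leg may be just \<open>[c]\<close>, so a claw can have its centre at one of its ends;
  most side conditions below come from this case. Claws and nets are defined by pairs of legs so
  that a fact about two legs yields the rest by permutation.\<close>

definition arm :: "'a \<Rightarrow> 'a list \<Rightarrow> 'a list \<Rightarrow> bool" where
  "arm c P Q \<longleftrightarrow> ipath P \<and> ipath Q \<and> P \<noteq> [] \<and> Q \<noteq> [] \<and> hd P = c \<and> hd Q = c \<and>
    set P \<inter> set Q = {c} \<and> (\<forall>u\<in>set P. \<forall>v\<in>set Q. E u v \<longrightarrow> u = c \<or> v = c)"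

definition corner :: "'a list \<Rightarrow> 'a list \<Rightarrow> bool" where
  "corner P Q \<longleftrightarrow> ipath P \<and> ipath Q \<and> P \<noteq> [] \<and> Q \<noteq> [] \<and>
    set P \<inter> set Q = {} \<and> (\<forall>u\<in>set P. \<forall>v\<in>set Q. E u v \<longleftrightarrow> u = hd P \<and> v = hd Q)"

definition claw :: "'a \<Rightarrow> 'a list \<Rightarrow> 'a list \<Rightarrow> 'a list \<Rightarrow> bool" where
  "claw c P Q R \<longleftrightarrow> arm c P Q \<and> arm c P R \<and> arm c Q R"

definition net :: "'a list \<Rightarrow> 'a list \<Rightarrow> 'a list \<Rightarrow> bool" where
  "net P Q R \<longleftrightarrow> corner P Q \<and> corner P R \<and> corner Q R"

text \<open>The option keeps the centre accessible: \<open>Some c\<close> for a subdivided claw,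
  \<open>None\<close> when the centre is a triangle. Later lemmas then speak about the position of
  the centre for both kinds at once.\<close>

fun tripod :: "'a option \<Rightarrow> 'a list \<Rightarrow> 'a list \<Rightarrow> 'a list \<Rightarrow> bool" where
  "tripod (Some c) P Q R = claw c P Q R"
| "tripod None P Q R = net P Q R"

lemma arm_commute: "arm c P Q \<longleftrightarrow> arm c Q P"
  unfolding arm_def using E_sym by (auto simp: Int_commute)

lemma corner_sym: "corner P Q \<Longrightarrow> corner Q P"
  unfolding corner_def using E_commute by (metis Int_commute)

lemma corner_commute: "corner P Q \<longleftrightarrow> corner Q P"
  using corner_sym by blast

lemma claw_perm: "claw c P Q R \<longleftrightarrow> claw c Q P R" "claw c P Q R \<longleftrightarrow> claw c P R Q"
  unfolding claw_def using arm_commute by blast+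

lemma net_perm: "net P Q R \<longleftrightarrow> net Q P R" "net P Q R \<longleftrightarrow> net P R Q"
  unfolding net_def using corner_commute by blast+

lemma tripod_perm: "tripod k P Q R \<longleftrightarrow> tripod k Q P R" "tripod k P Q R \<longleftrightarrow> tripod k P R Q"
  by (cases k; simp add: claw_perm net_perm)+

lemma arm_edge: "arm c P Q \<Longrightarrow> u \<in> set P \<Longrightarrow> v \<in> set Q \<Longrightarrow> E u v \<Longrightarrow> u = c \<or> v = c"
  unfolding arm_def by blast

lemma corner_edge: "corner P Q \<Longrightarrow> u \<in> set P \<Longrightarrow> v \<in> set Q \<Longrightarrow> E u v \<longleftrightarrow> u = hd P \<and> v = hd Q"
  unfolding corner_def by blast

lemma claw_edge:
  "claw c P Q R \<Longrightarrow> u \<in> set P \<Longrightarrow> v \<in> set Q \<or> v \<in> set R \<Longrightarrow> E u v \<Longrightarrow> u = c \<or> v = c"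
  unfolding claw_def using arm_edge by blast

lemma net_edge:
  "net P Q R \<Longrightarrow> u \<in> set P \<Longrightarrow> v \<in> set Q \<or> v \<in> set R \<Longrightarrow> E u v \<Longrightarrow> u = hd P \<and> (v = hd Q \<or> v = hd R)"
  unfolding net_def using corner_edge by blast

lemma tripod_nonempty: "tripod k P Q R \<Longrightarrow> P \<noteq> [] \<and> Q \<noteq> [] \<and> R \<noteq> []"
  by (cases k) (auto simp: claw_def net_def arm_def corner_def)

text \<open>With the first leg reversed, two legs are a single path through \<open>c\<close>. A claw
  thus amounts to three \<open>ipath\<close> facts.\<close>

lemma armI:
  assumes "ipath (rev A @ c # B)"
  shows "arm c (c # A) (c # B)"
proof -
  have 1: "ipath (rev (c # A))" using assms by (auto simp: ipath_append)
  have 2: "ipath (c # B)" using assms ipath_append by blast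
  have "\<not> E u v" if "u \<in> set A" "v \<in> set B" for u v
  proof -
    have "v \<noteq> c" using 2 that by auto
    then show ?thesis using assms that by (auto simp: ipath_append)
  qed
  moreover have "set A \<inter> set (c # B) = {}" using assms by (auto simp: ipath_append)
  moreover have "c \<notin> set B" using 2 by auto
  ultimately show ?thesis using 1 2 unfolding arm_def by (auto simp del: rev.simps(2) simp: ipath_rev)
qed

lemma cornerI:
  assumes "ipath (rev A @ B)" "A \<noteq> []" "B \<noteq> []"
  shows "corner A B"
  using assms unfolding corner_def by (auto simp: ipath_append last_rev)

text \<open>The three common ends lie on both tripods, so an edge at an end is often internal to one
  tripod and controlled there; only the other cross edges have to be excluded here.\<close>

definition glued ::
  "'a list \<Rightarrow> 'a list \<Rightarrow> 'a list \<Rightarrow> 'a list \<Rightarrow> 'a list \<Rightarrow> 'a list \<Rightarrow> bool" where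
  "glued P Q R P' Q' R' \<longleftrightarrow>
    last P = last P' \<and> last Q = last Q' \<and> last R = last R' \<and>
    last P \<noteq> last Q \<and> last P \<noteq> last R \<and> last Q \<noteq> last R \<and>
    \<not> E (last P) (last Q) \<and> \<not> E (last P) (last R) \<and> \<not> E (last Q) (last R) \<and>
    (set P \<union> set Q \<union> set R) \<inter> (set P' \<union> set Q' \<union> set R') \<subseteq> {last P, last Q, last R} \<and>
    (\<forall>u\<in>set P \<union> set Q \<union> set R. \<forall>v\<in>set P' \<union> set Q' \<union> set R'. E u v \<longrightarrow>
      u \<in> {last P, last Q, last R} \<or> v \<in> {last P, last Q, last R})"

lemma glued_perm:
  assumes "glued P Q R P' Q' R'"
  shows "glued Q P R Q' P' R'" "glued P R Q P' R' Q'" "glued P' Q' R' P Q R"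
proof -
  show "glued Q P R Q' P' R'" "glued P R Q P' R' Q'"
    using assms unfolding glued_def by (auto simp: Un_ac insert_commute E_commute)
  have "\<forall>u\<in>set P' \<union> set Q' \<union> set R'. \<forall>v\<in>set P \<union> set Q \<union> set R. E u v \<longrightarrow>
      u \<in> {last P, last Q, last R} \<or> v \<in> {last P, last Q, last R}"
    using assms E_sym unfolding glued_def by blast
  then show "glued P' Q' R' P Q R"
    using assms unfolding glued_def by (auto simp: Un_ac)
qed

text \<open>\<open>tl\<close> removes the second copy of the shared end.\<close>

abbreviation join :: "'a list \<Rightarrow> 'a list \<Rightarrow> 'a list" where
  "join P P' \<equiv> P @ tl (rev P')"

lemma join_props:
  assumes "P \<noteq> []" "P' \<noteq> []" "last P = last P'"
  shows "set (join P P') = set P \<union> set P'" "hd (join P P') = hd P" "last (join P P') = hd P'"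
    "length (join P P') = length P + length P' - 1" "join P P' \<noteq> []"
proof -
  obtain ys y where y: "P' = ys @ [y]" using assms(2) by (metis rev_exhaust)
  show "set (join P P') = set P \<union> set P'" using assms y last_in_set[of P] by auto
  show "hd (join P P') = hd P" using assms by simp
  show "last (join P P') = hd P'" using assms y by (cases ys) (auto simp: last_rev)
  show "length (join P P') = length P + length P' - 1" "join P P' \<noteq> []" using assms y by auto
qed

lemma ipath_join:
  assumes "ipath P" "ipath P'" "P \<noteq> []" "P' \<noteq> []" "last P = last P'"
    and "set P \<inter> set P' \<subseteq> {last P}"
    and "\<And>u v. u \<in> set P \<Longrightarrow> v \<in> set P' \<Longrightarrow> E u v \<Longrightarrow> u = last P \<or> v = last P"
  shows "ipath (join P P')"
proof -
  obtain ys y where y: "P' = ys @ [y]" using assms(4) by (metis rev_exhaust)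
  have ly: "last P = y" using assms(5) y by simp
  have *: "ipath ys" "y \<notin> set ys" "\<And>v. v \<in> set ys \<Longrightarrow> E v y \<longleftrightarrow> v = last ys"
    using assms(2) y by (auto simp: ipath_append)
  have "E u v \<longleftrightarrow> u = last P \<and> v = last ys" if "u \<in> set P" "v \<in> set ys" for u v
    using assms(7)[of u v] that * ly y E_commute[of u v] by auto
  moreover have "set P \<inter> set ys = {}" using assms(6) * ly y by auto
  ultimately show ?thesis
    using assms(1) * y by (auto simp: ipath_append hd_rev)
qed

lemma glued_mem:
  assumes "tripod k P Q R" "tripod k' P' Q' R'" "glued P Q R P' Q' R'"
  shows "last P \<in> set P" "last Q \<in> set Q" "last R \<in> set R"
    "last P \<in> set P'" "last Q \<in> set Q'" "last R \<in> set R'"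
    "hd P \<in> set P" "hd Q \<in> set Q" "hd R \<in> set R"
    "hd P' \<in> set P'" "hd Q' \<in> set Q'" "hd R' \<in> set R'"
proof -
  have ne: "P \<noteq> []" "Q \<noteq> []" "R \<noteq> []" "P' \<noteq> []" "Q' \<noteq> []" "R' \<noteq> []"
    using tripod_nonempty[OF assms(1)] tripod_nonempty[OF assms(2)] by auto
  then show "last P \<in> set P" "last Q \<in> set Q" "last R \<in> set R"
    "hd P \<in> set P" "hd Q \<in> set Q" "hd R \<in> set R"
    "hd P' \<in> set P'" "hd Q' \<in> set Q'" "hd R' \<in> set R'" by simp_all
  have "last P = last P'" "last Q = last Q'" "last R = last R'" using assms(3) by (auto simp: glued_def)
  then show "last P \<in> set P'" "last Q \<in> set Q'" "last R \<in> set R'"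
    using ne(4-6)[THEN last_in_set] by metis+
qed

text \<open>The end of another leg lies on \<open>P\<close> only if it is the common vertex
  \<open>c\<close>, that is, if the other leg is trivial.\<close>

lemma claw_hit: "claw c P Q R \<Longrightarrow> x \<in> set P \<Longrightarrow> x \<in> {last P, last Q, last R} \<Longrightarrow> x = last P \<or> x = c"
  unfolding claw_def arm_def using last_in_set[of Q] last_in_set[of R] by blast

lemma net_hit: "net P Q R \<Longrightarrow> x \<in> set P \<Longrightarrow> x \<in> {last P, last Q, last R} \<Longrightarrow> x = last P"
  unfolding net_def corner_def using last_in_set[of Q] last_in_set[of R] by blast

lemma glued_claw_hit:
  "claw c P' Q' R' \<Longrightarrow> glued P Q R P' Q' R' \<Longrightarrow> x \<in> set P' \<Longrightarrow>
    x \<in> {last P, last Q, last R} \<Longrightarrow> x = last P \<or> x = c"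
  using claw_hit[of c P' Q' R' x] by (simp add: glued_def)

lemma glued_net_hit:
  "net P' Q' R' \<Longrightarrow> glued P Q R P' Q' R' \<Longrightarrow> x \<in> set P' \<Longrightarrow>
    x \<in> {last P, last Q, last R} \<Longrightarrow> x = last P"
  using net_hit[of P' Q' R' x] by (simp add: glued_def)

subsection \<open>Three-path configurations as path systems\<close>

text \<open>This and the next two definitions say how two paths of a configuration relate to each
  other. One gluing lemma about two pairs of legs, applied to permutations, then gives the whole
  configuration.\<close>

definition theta_pair :: "'a \<Rightarrow> 'a \<Rightarrow> 'a list \<Rightarrow> 'a list \<Rightarrow> bool" where
  "theta_pair c c' P Q \<longleftrightarrow> ipath P \<and> ipath Q \<and> P \<noteq> [] \<and> Q \<noteq> [] \<and> hd P = c \<and> hd Q = c \<and>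
    last P = c' \<and> last Q = c' \<and> set P \<inter> set Q = {c, c'} \<and>
    (\<forall>u\<in>set P. \<forall>v\<in>set Q. E u v \<longrightarrow> u \<in> {c, c'} \<or> v \<in> {c, c'})"

definition pyramid_pair :: "'a \<Rightarrow> 'a list \<Rightarrow> 'a list \<Rightarrow> bool" where
  "pyramid_pair c P Q \<longleftrightarrow> ipath P \<and> ipath Q \<and> P \<noteq> [] \<and> Q \<noteq> [] \<and> hd P = c \<and> hd Q = c \<and>
    set P \<inter> set Q = {c} \<and>
    (\<forall>u\<in>set P - {c}. \<forall>v\<in>set Q - {c}. E u v \<longleftrightarrow> u = last P \<and> v = last Q)"

definition prism_pair :: "'a list \<Rightarrow> 'a list \<Rightarrow> bool" where
  "prism_pair P Q \<longleftrightarrow> ipath P \<and> ipath Q \<and> P \<noteq> [] \<and> Q \<noteq> [] \<and> set P \<inter> set Q = {} \<and>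
    (\<forall>u\<in>set P. \<forall>v\<in>set Q. E u v \<longleftrightarrow> (u = hd P \<and> v = hd Q) \<or> (u = last P \<and> v = last Q))"

text \<open>Lengths need not be mentioned: distinct nonadjacent ends force at least two edges on
  each path.\<close>

definition has_theta :: bool where
  "has_theta \<longleftrightarrow> (\<exists>c c' P Q R. c \<noteq> c' \<and> \<not> E c c' \<and>
    theta_pair c c' P Q \<and> theta_pair c c' P R \<and> theta_pair c c' Q R)"

text \<open>\<open>length\<close> counts vertices, so the bounds 2 and 3 mean one and two edges. The
  same holds for \<open>has_prism\<close>, where \<open>length\<close> 1 is a path of length
  0.\<close>

definition has_pyramid :: bool where
  "has_pyramid \<longleftrightarrow> (\<exists>c P Q R. pyramid_pair c P Q \<and> pyramid_pair c P R \<and> pyramid_pair c Q R \<and>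
    length P \<ge> 2 \<and> length Q \<ge> 2 \<and> length R \<ge> 2 \<and>
    (length P \<ge> 3 \<and> length Q \<ge> 3 \<or> length P \<ge> 3 \<and> length R \<ge> 3 \<or> length Q \<ge> 3 \<and> length R \<ge> 3))"

definition has_prism :: bool where
  "has_prism \<longleftrightarrow> (\<exists>P Q R. prism_pair P Q \<and> prism_pair P R \<and> prism_pair Q R \<and>
    (length P \<ge> 2 \<and> length Q \<ge> 2 \<and> length R \<ge> 2 \<or>
     length P = 1 \<and> length Q \<ge> 3 \<and> length R \<ge> 3 \<or>
     length Q = 1 \<and> length P \<ge> 3 \<and> length R \<ge> 3 \<or>
     length R = 1 \<and> length P \<ge> 3 \<and> length Q \<ge> 3))"

definition has_3pc :: bool where
  "has_3pc \<longleftrightarrow> has_theta \<or> has_pyramid \<or> has_prism"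

section \<open>Gluing two tripods along their three ends\<close>

lemma glue_claw_claw_path:
  assumes "claw c P Q R" "claw c' P' Q' R'" "glued P Q R P' Q' R'" "c \<noteq> c'" "\<not> E c c'"
  shows "ipath (join P P')"
    "u \<in> set P \<Longrightarrow> v \<in> set P' \<Longrightarrow> E u v \<Longrightarrow> u = last P \<or> v = last P"
proof -
  note a = assms(1,2)[unfolded claw_def arm_def] and g = assms(3)[unfolded glued_def]
  have hit: "\<And>x. x \<in> set P \<Longrightarrow> x \<in> {last P, last Q, last R} \<Longrightarrow> x = last P \<or> x = c"
    "\<And>x. x \<in> set P' \<Longrightarrow> x \<in> {last P, last Q, last R} \<Longrightarrow> x = last P \<or> x = c'"
    using claw_hit[OF assms(1)] glued_claw_hit[OF assms(2,3)] by blast+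
  note mem = glued_mem[of "Some c" P Q R "Some c'" P' Q' R', simplified, OF assms(1-3)]
  \<comment> \<open>A cross edge that avoids the shared end of the two legs uses another end. That
    end lies on its leg only as the centre of the claw, and it also lies on the other claw. There
    the edge joins two different legs, so it contains the other centre: the centres would coincide
    or be adjacent.\<close>
  have edge: "u = last P \<or> v = last P" if "u \<in> set P" "v \<in> set P'" "E u v" for u v
  proof (rule ccontr)
    assume n: "\<not> (u = last P \<or> v = last P)"
    have "u \<in> {last P, last Q, last R} \<or> v \<in> {last P, last Q, last R}" using g that by blast
    then show False
    proof
      assume "u \<in> {last P, last Q, last R}"
      then have "u = c" "u = last Q \<or> u = last R" using hit(1)[of u] n that by auto
      then have "u \<in> set Q' \<or> u \<in> set R'" using mem(5,6) by metis
      then have "u = c' \<or> v = c'" using claw_edge[OF assms(2), of v u] that E_sym by blast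
      then show False using \<open>u = c\<close> that assms(4,5) by auto
    next
      assume "v \<in> {last P, last Q, last R}"
      then have "v = c'" "v = last Q \<or> v = last R" using hit(2)[of v] n that by auto
      then have "v \<in> set Q \<or> v \<in> set R" using mem(2,3) by metis
      then have "u = c \<or> v = c" using claw_edge[OF assms(1), of u v] that by blast
      then show False using \<open>v = c'\<close> that assms(4,5) by auto
    qed
  qed
  then show "u \<in> set P \<Longrightarrow> v \<in> set P' \<Longrightarrow> E u v \<Longrightarrow> u = last P \<or> v = last P" .
  have int: "set P \<inter> set P' \<subseteq> {last P}"
    using hit g assms(4) by blast
  show "ipath (join P P')" using a g edge int by (intro ipath_join) auto
qed

lemma glue_claw_claw_pair:
  assumes "claw c P Q R" "claw c' P' Q' R'" "glued P Q R P' Q' R'" "c \<noteq> c'" "\<not> E c c'"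
  shows "theta_pair c c' (join P P') (join Q Q')"
proof -
  note a = assms(1,2)[unfolded claw_def arm_def] and g = assms(3)[unfolded glued_def]
  note J = glue_claw_claw_path[OF assms]
    and K = glue_claw_claw_path[OF assms(1,2)[THEN claw_perm(1)[THEN iffD1]] glued_perm(1)[OF assms(3)] assms(4,5)]
  have hit: "\<And>x. x \<in> set P \<Longrightarrow> x \<in> {last P, last Q, last R} \<Longrightarrow> x = last P \<or> x = c"
    "\<And>x. x \<in> set P' \<Longrightarrow> x \<in> {last P, last Q, last R} \<Longrightarrow> x = last P \<or> x = c'"
    "\<And>x. x \<in> set Q \<Longrightarrow> x \<in> {last P, last Q, last R} \<Longrightarrow> x = last Q \<or> x = c"
    "\<And>x. x \<in> set Q' \<Longrightarrow> x \<in> {last P, last Q, last R} \<Longrightarrow> x = last Q \<or> x = c'"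
    using claw_hit[OF assms(1)] glued_claw_hit[OF assms(2,3)]
      claw_hit[OF assms(1)[THEN claw_perm(1)[THEN iffD1]]]
      glued_claw_hit[OF assms(2)[THEN claw_perm(1)[THEN iffD1]] glued_perm(1)[OF assms(3)]] by blast+
  have mem: "last P \<in> set P" "last Q \<in> set Q" "last P \<in> set P'" "last Q \<in> set Q'" "c \<in> set P" "c \<in> set Q"
     "c' \<in> set P'" "c' \<in> set Q'"
    using glued_mem[of "Some c" P Q R "Some c'" P' Q' R', simplified, OF assms(1-3)] a by auto
  have pq: "set P \<inter> set Q = {c}" "set P' \<inter> set Q' = {c'}" using a by auto
  have com: "x \<in> {last P, last Q, last R}" if "x \<in> set P \<union> set Q" "x \<in> set P' \<union> set Q'" for x
    using g that by blast
  have i1: "set P \<inter> set Q' \<subseteq> {c, c'}" "set P' \<inter> set Q \<subseteq> {c, c'}"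
  proof (safe, goal_cases)
    case (1 x)
    then show ?case using hit(1,4)[of x] com[of x] mem pq by auto
  next
    case (2 x)
    then show ?case using hit(2,3)[of x] com[of x] mem pq by auto
  qed
  \<comment> \<open>The end that the edge uses lies on both tripods, so the edge lies inside one
    claw and joins two of its legs.\<close>
  have e1: "u \<in> {c, c'} \<or> v \<in> {c, c'}" if uv: "u \<in> set P" "v \<in> set Q'" "E u v" for u v
  proof -
    have "u \<in> {last P, last Q, last R} \<or> v \<in> {last P, last Q, last R}" using g uv by blast
    then show ?thesis
    proof
      assume "u \<in> {last P, last Q, last R}"
      then have "u = last P \<or> u = c" using hit(1) uv by blast
      then show ?thesis using claw_edge[OF assms(2), of u v] mem uv by blast
    next
      assume "v \<in> {last P, last Q, last R}"
      then have "v = last Q \<or> v = c'" using hit(4) uv by blast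
      then show ?thesis using claw_edge[OF assms(1), of u v] mem uv by blast
    qed
  qed
  have e2: "u \<in> {c, c'} \<or> v \<in> {c, c'}" if uv: "u \<in> set P'" "v \<in> set Q" "E u v" for u v
  proof -
    have "v \<in> {last P, last Q, last R} \<or> u \<in> {last P, last Q, last R}" using g uv E_sym by blast
    then show ?thesis
    proof
      assume "v \<in> {last P, last Q, last R}"
      then have "v = last Q \<or> v = c" using hit(3) uv by blast
      then show ?thesis using claw_edge[OF assms(2), of u v] mem uv by blast
    next
      assume "u \<in> {last P, last Q, last R}"
      then have "u = last P \<or> u = c'" using hit(2) uv by blast
      then show ?thesis using claw_edge[OF assms(1), of u v] mem uv by blast
    qed
  qed
  have PN: "P \<noteq> []" "P' \<noteq> []" "last P = last P'" "Q \<noteq> []" "Q' \<noteq> []" "last Q = last Q'"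
    using a g by auto
  note jp = join_props[OF PN(1-3)] and jq = join_props[OF PN(4-6)]
  have "set (join P P') \<inter> set (join Q Q') = {c, c'}"
    unfolding jp jq using pq i1 mem by blast
  moreover have "\<forall>u\<in>set (join P P'). \<forall>v\<in>set (join Q Q'). E u v \<longrightarrow> u \<in> {c, c'} \<or> v \<in> {c, c'}"
    unfolding jp jq using arm_edge[of c P Q] arm_edge[of c' P' Q'] assms(1,2) e1 e2
    unfolding claw_def by blast
  ultimately show ?thesis
    unfolding theta_pair_def using J(1) K(1) jp jq a by simp
qed

lemma glue_claw_claw:
  assumes "claw c P Q R" "claw c' P' Q' R'" "glued P Q R P' Q' R'" "c \<noteq> c'" "\<not> E c c'"
  shows has_theta
proof -
  have "theta_pair c c' (join P P') (join R R')"
    using glue_claw_claw_pair[OF assms(1,2)[THEN claw_perm(2)[THEN iffD1]] glued_perm(2)[OF assms(3)] assms(4,5)] .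
  moreover have "theta_pair c c' (join Q Q') (join R R')"
    using glue_claw_claw_pair[of c Q R P c' Q' R' P'] assms claw_perm glued_perm by metis
  ultimately show ?thesis
    unfolding has_theta_def using glue_claw_claw_pair[OF assms] assms(4,5) by blast
qed

lemma glue_claw_net_pair:
  assumes "claw c P Q R" "net P' Q' R'" "glued P Q R P' Q' R'" "c \<notin> {hd P', hd Q', hd R'}"
  shows "ipath (join P P')" "pyramid_pair c (join P P') (join Q Q')"
proof -
  \<comment> \<open>Proved for arbitrary legs, since it is needed for \<open>Q\<close> and
    \<open>Q'\<close> as well.\<close>
  have path: "ipath (join P P')"
    if hyp: "claw c P Q R" "net P' Q' R'" "glued P Q R P' Q' R'" "c \<notin> {hd P', hd Q', hd R'}" for P Q R P' Q' R'
  proof -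
    note a = hyp(1,2)[unfolded claw_def arm_def net_def corner_def] and g = hyp(3)[unfolded glued_def]
    have hit: "\<And>x. x \<in> set P \<Longrightarrow> x \<in> {last P, last Q, last R} \<Longrightarrow> x = last P \<or> x = c"
      "\<And>x. x \<in> set P' \<Longrightarrow> x \<in> {last P, last Q, last R} \<Longrightarrow> x = last P"
      using claw_hit[OF hyp(1)] glued_net_hit[OF hyp(2,3)] by blast+
    note mem = glued_mem[of "Some c" P Q R None P' Q' R', simplified, OF hyp(1-3)]
    have edge: "u = last P \<or> v = last P" if uv: "u \<in> set P" "v \<in> set P'" "E u v" for u v
    proof (rule ccontr)
      assume n: "\<not> (u = last P \<or> v = last P)"
      have "u \<in> {last P, last Q, last R}" using g uv n hit(2) by blast
      then have "u = c" "u = last Q \<or> u = last R" using hit(1)[of u] n uv by auto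
      then have "u \<in> set Q' \<or> u \<in> set R'" using mem(5,6) by metis
      then have "u = hd Q' \<or> u = hd R'" using net_edge[OF hyp(2), of v u] uv E_sym by blast
      then show False using \<open>u = c\<close> hyp(4) by auto
    qed
    have int: "set P \<inter> set P' \<subseteq> {last P}" using hit g by blast
    show "ipath (join P P')" using a g edge int by (intro ipath_join) auto
  qed
  then show J: "ipath (join P P')" using assms .
  have K: "ipath (join Q Q')"
    using path[of Q P R Q' P' R'] claw_perm(1) net_perm(1) glued_perm(1) assms
    by (metis insert_commute)
  note a = assms(1,2)[unfolded claw_def arm_def net_def corner_def] and g = assms(3)[unfolded glued_def]
  have hit: "\<And>x. x \<in> set P \<Longrightarrow> x \<in> {last P, last Q, last R} \<Longrightarrow> x = last P \<or> x = c"
    "\<And>x. x \<in> set P' \<Longrightarrow> x \<in> {last P, last Q, last R} \<Longrightarrow> x = last P"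
    "\<And>x. x \<in> set Q \<Longrightarrow> x \<in> {last P, last Q, last R} \<Longrightarrow> x = last Q \<or> x = c"
    "\<And>x. x \<in> set Q' \<Longrightarrow> x \<in> {last P, last Q, last R} \<Longrightarrow> x = last Q"
    using claw_hit[OF assms(1)] glued_net_hit[OF assms(2,3)]
      claw_hit[OF assms(1)[THEN claw_perm(1)[THEN iffD1]]]
      glued_net_hit[OF assms(2)[THEN net_perm(1)[THEN iffD1]] glued_perm(1)[OF assms(3)]] by blast+
  have mem: "last P \<in> set P" "last Q \<in> set Q" "last P \<in> set P'" "last Q \<in> set Q'" "c \<in> set P" "c \<in> set Q"
     "hd P' \<in> set P'" "hd Q' \<in> set Q'"
    using glued_mem[of "Some c" P Q R None P' Q' R', simplified, OF assms(1-3)] a by auto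
  have pq: "set P \<inter> set Q = {c}" "set P' \<inter> set Q' = {}" using a by auto
  have com: "x \<in> {last P, last Q, last R}" if "x \<in> set P \<union> set Q" "x \<in> set P' \<union> set Q'" for x
    using g that by blast
  have i1: "set P \<inter> set Q' \<subseteq> {c}" "set P' \<inter> set Q \<subseteq> {c}"
  proof -
    show "set P \<inter> set Q' \<subseteq> {c}"
    proof
      fix x assume x: "x \<in> set P \<inter> set Q'"
      then have m: "x \<in> {last P, last Q, last R}" by (intro com) auto
      have "x = last P \<or> x = c" using hit(1)[OF _ m] x by blast
      moreover have "x = last Q" using hit(4)[OF _ m] x by blast
      ultimately have "x \<in> set P \<inter> set Q" using mem(2) x by auto
      then show "x \<in> {c}" by (simp only: pq)
    qed
    show "set P' \<inter> set Q \<subseteq> {c}"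
    proof
      fix x assume x: "x \<in> set P' \<inter> set Q"
      then have m: "x \<in> {last P, last Q, last R}" by (intro com) auto
      have "x = last P" using hit(2)[OF _ m] x by blast
      moreover have "x = last Q \<or> x = c" using hit(3)[OF _ m] x by blast
      ultimately have "x \<in> set P \<inter> set Q" using mem(1,6) x by auto
      then show "x \<in> {c}" by (simp only: pq)
    qed
  qed
  have cc: "\<And>u v. u \<in> set P \<Longrightarrow> v \<in> set Q \<Longrightarrow> E u v \<Longrightarrow> u = c \<or> v = c"
    "\<And>u v. u \<in> set P' \<Longrightarrow> v \<in> set Q' \<Longrightarrow> E u v \<longleftrightarrow> u = hd P' \<and> v = hd Q'"
    using arm_edge[of c P Q] corner_edge[of P' Q'] assms(1,2) unfolding claw_def net_def by metis+
  have e0: "E (hd P') (hd Q')" using cc(2) mem by blast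
  \<comment> \<open>Corners of the net that lie on the claw are common vertices, hence ends; but the
    corners are adjacent and the ends are not.\<close>
  have e3: "\<not> (u = hd P' \<and> v = hd Q')" if "u \<in> set P" "v \<in> set Q" for u v
  proof
    assume "u = hd P' \<and> v = hd Q'"
    then have "u = last P" "v = last Q"
      using that com[of u] com[of v] hit(2)[of u] hit(4)[of v] mem(7,8) by (metis UnI1 UnI2)+
    then show False using e0 \<open>u = hd P' \<and> v = hd Q'\<close> g by auto
  qed
  have e1: "u = hd P' \<and> v = hd Q'" if uv: "u \<in> set P" "v \<in> set Q'" "E u v" "u \<noteq> c" "v \<noteq> c" for u v
  proof -
    have "u \<in> {last P, last Q, last R} \<or> v \<in> {last P, last Q, last R}" using g uv by blast
    then show ?thesis
    proof
      assume "u \<in> {last P, last Q, last R}"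
      then have "u = last P" using hit(1) uv by blast
      then show ?thesis using cc(2)[of u v] mem(3) uv by metis
    next
      assume "v \<in> {last P, last Q, last R}"
      then have "v = last Q" using hit(4) uv by blast
      then show ?thesis using cc(1)[of u v] mem(2) uv by metis
    qed
  qed
  have e2: "u = hd P' \<and> v = hd Q'" if uv: "u \<in> set P'" "v \<in> set Q" "E u v" "u \<noteq> c" "v \<noteq> c" for u v
  proof -
    have "v \<in> {last P, last Q, last R} \<or> u \<in> {last P, last Q, last R}" using g uv E_sym by blast
    then show ?thesis
    proof
      assume "v \<in> {last P, last Q, last R}"
      then have "v = last Q" using hit(3) uv by blast
      then show ?thesis using cc(2)[of u v] mem(4) uv by metis
    next
      assume "u \<in> {last P, last Q, last R}"
      then have "u = last P" using hit(2) uv by blast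
      then show ?thesis using cc(1)[of u v] mem(1) uv by metis
    qed
  qed
  have PN: "P \<noteq> []" "P' \<noteq> []" "last P = last P'" "Q \<noteq> []" "Q' \<noteq> []" "last Q = last Q'"
    using a g by auto
  note jp = join_props[OF PN(1-3)] and jq = join_props[OF PN(4-6)]
  have "set (join P P') \<inter> set (join Q Q') = {c}"
    unfolding jp jq using pq i1 mem by blast
  moreover have "\<forall>u\<in>set (join P P') - {c}. \<forall>v\<in>set (join Q Q') - {c}.
      E u v \<longleftrightarrow> u = last (join P P') \<and> v = last (join Q Q')"
  proof (intro ballI)
    fix u v assume uv: "u \<in> set (join P P') - {c}" "v \<in> set (join Q Q') - {c}"
    then consider "u \<in> set P" "v \<in> set Q" | "u \<in> set P" "v \<in> set Q'" | "u \<in> set P'" "v \<in> set Q"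
      | "u \<in> set P'" "v \<in> set Q'" unfolding jp jq by blast
    then show "E u v \<longleftrightarrow> u = last (join P P') \<and> v = last (join Q Q')"
      unfolding jp jq
    proof cases
      case 1
      then show "E u v \<longleftrightarrow> u = hd P' \<and> v = hd Q'" using cc(1)[of u v] e3[of u v] uv by blast
    next
      case 2
      then show "E u v \<longleftrightarrow> u = hd P' \<and> v = hd Q'" using e1[of u v] e0 uv by blast
    next
      case 3
      then show "E u v \<longleftrightarrow> u = hd P' \<and> v = hd Q'" using e2[of u v] e0 uv by blast
    next
      case 4
      then show "E u v \<longleftrightarrow> u = hd P' \<and> v = hd Q'" using cc(2)[of u v] by blast
    qed
  qed
  ultimately show "pyramid_pair c (join P P') (join Q Q')"
    unfolding pyramid_pair_def using J K jp jq a by simp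
qed

text \<open>A one-vertex leg puts its end at the centre; the other end is different from it and
  nonadjacent to it, so it is at least two edges away.\<close>

lemma arm_length: 
  assumes "arm c P Q" "last P \<noteq> last Q" "\<not> E (last P) (last Q)" "length P = 1"
  shows "length Q \<ge> 3"
proof -
  have "P = [c]" using assms by (cases P) (auto simp: arm_def)
  then show ?thesis using assms unfolding arm_def
    by (cases Q; cases "tl Q"; cases "tl (tl Q)") auto
qed

text \<open>Two one-vertex legs would make two ends adjacent as corners of the triangle.\<close>

lemma corner_length:
  assumes "corner P Q" "\<not> E (last P) (last Q)"
  shows "length P \<ge> 2 \<or> length Q \<ge> 2"
proof (rule ccontr)
  assume s: "\<not> ?thesis"
  have ne: "P \<noteq> []" "Q \<noteq> []" using assms(1) unfolding corner_def by auto
  have "last P = hd P" using s ne by (cases P; cases "tl P") auto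
  moreover have "last Q = hd Q" using s ne by (cases Q; cases "tl Q") auto
  ultimately show False using assms ne unfolding corner_def by auto
qed

text \<open>The numbers are vertex counts of the legs, unprimed for the claw and primed for the net.
  The hypotheses after positivity say that no trivial claw leg meets a trivial net leg, and record
  \<open>arm_length\<close> and \<open>corner_length\<close>.\<close>

lemma pyramid_lengths:
  fixes a b c a' b' c' :: nat
  assumes "a \<ge> 1" "a' \<ge> 1" "b \<ge> 1" "b' \<ge> 1" "c \<ge> 1" "c' \<ge> 1"
    and "a \<noteq> 1 \<or> a' \<noteq> 1" "b \<noteq> 1 \<or> b' \<noteq> 1" "c \<noteq> 1 \<or> c' \<noteq> 1"
    and "a = 1 \<Longrightarrow> b \<ge> 3 \<and> c \<ge> 3" "b = 1 \<Longrightarrow> a \<ge> 3 \<and> c \<ge> 3" "c = 1 \<Longrightarrow> a \<ge> 3 \<and> b \<ge> 3"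
    and "a' \<ge> 2 \<or> b' \<ge> 2" "a' \<ge> 2 \<or> c' \<ge> 2" "b' \<ge> 2 \<or> c' \<ge> 2"
  shows "2 \<le> a + a' - 1 \<and> 2 \<le> b + b' - 1 \<and> 2 \<le> c + c' - 1 \<and>
    (3 \<le> a + a' - 1 \<and> 3 \<le> b + b' - 1 \<or> 3 \<le> a + a' - 1 \<and> 3 \<le> c + c' - 1 \<or>
     3 \<le> b + b' - 1 \<and> 3 \<le> c + c' - 1)"
proof -
  have "2 \<le> a + a' - 1" using assms(1,2,7) by auto
  moreover have "2 \<le> b + b' - 1" using assms(3,4,8) by auto
  moreover have "2 \<le> c + c' - 1" using assms(5,6,9) by auto
  moreover consider "a = 1" | "b = 1" | "c = 1" | "a \<ge> 2" "b \<ge> 2" "c \<ge> 2" using assms(1,3,5) by linarith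
  then have "3 \<le> a + a' - 1 \<and> 3 \<le> b + b' - 1 \<or> 3 \<le> a + a' - 1 \<and> 3 \<le> c + c' - 1 \<or>
     3 \<le> b + b' - 1 \<and> 3 \<le> c + c' - 1"
  proof cases
    case 4
    consider "a' \<ge> 2" "b' \<ge> 2" | "a' \<ge> 2" "c' \<ge> 2" | "b' \<ge> 2" "c' \<ge> 2" using assms(13-15) by blast
    then show ?thesis using 4 by cases auto
  next
    case 1
    then show ?thesis using assms(4,6,10) by auto
  next
    case 2
    then show ?thesis using assms(2,6,11) by auto
  next
    case 3
    then show ?thesis using assms(2,4,12) by auto
  qed
  ultimately show ?thesis by blast
qed

text \<open>Each triple counts the legs of a net, with at most one trivial leg per net. If the two
  trivial legs are joined to each other, the result is a path of length 0 and the triangles share a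
  vertex.\<close>

lemma prism_lengths:
  fixes a b c a' b' c' :: nat
  assumes "a \<ge> 1" "a' \<ge> 1" "b \<ge> 1" "b' \<ge> 1" "c \<ge> 1" "c' \<ge> 1"
    and "a \<ge> 2 \<or> b \<ge> 2" "a \<ge> 2 \<or> c \<ge> 2" "b \<ge> 2 \<or> c \<ge> 2"
    and "a' \<ge> 2 \<or> b' \<ge> 2" "a' \<ge> 2 \<or> c' \<ge> 2" "b' \<ge> 2 \<or> c' \<ge> 2"
  shows "2 \<le> a + a' - 1 \<and> 2 \<le> b + b' - 1 \<and> 2 \<le> c + c' - 1 \<or>
    a + a' - 1 = 1 \<and> 3 \<le> b + b' - 1 \<and> 3 \<le> c + c' - 1 \<or>
    b + b' - 1 = 1 \<and> 3 \<le> a + a' - 1 \<and> 3 \<le> c + c' - 1 \<or>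
    c + c' - 1 = 1 \<and> 3 \<le> a + a' - 1 \<and> 3 \<le> b + b' - 1"
proof -
  consider "a = 1" "a' = 1" | "b = 1" "b' = 1" | "c = 1" "c' = 1"
    | "a + a' \<ge> 3" "b + b' \<ge> 3" "c + c' \<ge> 3" using assms(1-6) by linarith
  then show ?thesis
  proof cases
    case 1
    then show ?thesis using assms(7,8,10,11) by auto
  next
    case 2
    then show ?thesis using assms(7,9,10,12) by auto
  next
    case 3
    then show ?thesis using assms(8,9,11,12) by auto
  qed auto
qed

lemma glue_claw_net:
  assumes "claw c P Q R" "net P' Q' R'" "glued P Q R P' Q' R'" "c \<notin> {hd P', hd Q', hd R'}"
  shows has_pyramid
proof -
  note a = assms(1,2)[unfolded claw_def net_def] and g = assms(3)[unfolded glued_def]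
  note a' = a[unfolded arm_def corner_def]
  have p1: "pyramid_pair c (join P P') (join Q Q')"
    using glue_claw_net_pair[OF assms] by blast
  have p2: "pyramid_pair c (join P P') (join R R')"
    using glue_claw_net_pair(2)[of c P R Q P' R' Q'] assms claw_perm(2) net_perm(2) glued_perm(2)
    by (metis insert_commute)
  have p3: "pyramid_pair c (join Q Q') (join R R')"
  proof (rule glue_claw_net_pair(2)[of c Q R P Q' R' P'])
    show "claw c Q R P" "net Q' R' P'" "glued Q R P Q' R' P'" "c \<notin> {hd Q', hd R', hd P'}"
      using assms claw_perm net_perm glued_perm by (metis, metis, metis, blast)
  qed
  have PN: "P \<noteq> []" "P' \<noteq> []" "last P = last P'" "Q \<noteq> []" "Q' \<noteq> []" "last Q = last Q'"
    "R \<noteq> []" "R' \<noteq> []" "last R = last R'"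
    using a' g by auto
  note jp = join_props[OF PN(1-3)] and jq = join_props[OF PN(4-6)] and jr = join_props[OF PN(7-9)]
  have len: "length P \<ge> 1" "length P' \<ge> 1" "length Q \<ge> 1" "length Q' \<ge> 1" "length R \<ge> 1" "length R' \<ge> 1"
    using PN by (auto simp: Suc_le_eq)
  \<comment> \<open>If both legs were trivial, the centre \<open>c\<close> would be a corner of the
    net.\<close>
  have one: "length X \<noteq> 1 \<or> length X' \<noteq> 1" if "X \<noteq> []" "X' \<noteq> []" "last X = last X'" "hd X = c" "hd X' \<noteq> c"
    for X X' :: "'a list" using that by (cases X; cases X'; force)
  have h: "hd P = c" "hd Q = c" "hd R = c" "hd P' \<noteq> c" "hd Q' \<noteq> c" "hd R' \<noteq> c" using a' assms(4) by auto
  have n: "length P \<noteq> 1 \<or> length P' \<noteq> 1" "length Q \<noteq> 1 \<or> length Q' \<noteq> 1" "length R \<noteq> 1 \<or> length R' \<noteq> 1"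
    using one[OF PN(1-3) h(1,4)] one[OF PN(4-6) h(2,5)] one[OF PN(7-9) h(3,6)] by blast+
  have l: "length P = 1 \<Longrightarrow> length Q \<ge> 3 \<and> length R \<ge> 3" "length Q = 1 \<Longrightarrow> length P \<ge> 3 \<and> length R \<ge> 3"
     "length R = 1 \<Longrightarrow> length P \<ge> 3 \<and> length Q \<ge> 3"
    using arm_length[of c P Q] arm_length[of c P R] arm_length[of c Q P] arm_length[of c Q R]
      arm_length[of c R P] arm_length[of c R Q] a g by (auto simp: arm_commute E_commute)
  have l': "length P' \<ge> 2 \<or> length Q' \<ge> 2" "length P' \<ge> 2 \<or> length R' \<ge> 2" "length Q' \<ge> 2 \<or> length R' \<ge> 2"
    using corner_length[of P' Q'] corner_length[of P' R'] corner_length[of Q' R'] a g by auto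
  show ?thesis
    unfolding has_pyramid_def
    apply (rule exI[of _ c], rule exI[of _ "join P P'"], rule exI[of _ "join Q Q'"], rule exI[of _ "join R R'"])
    apply (intro conjI p1 p2 p3)
    unfolding jp(4) jq(4) jr(4)
    using pyramid_lengths[OF len n l l'] by blast+
qed

lemma glue_net_net_pair:
  assumes "net P Q R" "net P' Q' R'" "glued P Q R P' Q' R'"
  shows "prism_pair (join P P') (join Q Q')"
proof -
  note a = assms(1,2)[unfolded net_def corner_def] and g = assms(3)[unfolded glued_def]
  have hit: "\<And>x. x \<in> set P \<Longrightarrow> x \<in> {last P, last Q, last R} \<Longrightarrow> x = last P"
    "\<And>x. x \<in> set P' \<Longrightarrow> x \<in> {last P, last Q, last R} \<Longrightarrow> x = last P"
    "\<And>x. x \<in> set Q \<Longrightarrow> x \<in> {last P, last Q, last R} \<Longrightarrow> x = last Q"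
    "\<And>x. x \<in> set Q' \<Longrightarrow> x \<in> {last P, last Q, last R} \<Longrightarrow> x = last Q"
    using net_hit[OF assms(1)] glued_net_hit[OF assms(2,3)]
      net_hit[OF assms(1)[THEN net_perm(1)[THEN iffD1]]]
      glued_net_hit[OF assms(2)[THEN net_perm(1)[THEN iffD1]] glued_perm(1)[OF assms(3)]] by blast+
  note mem = glued_mem[of None P Q R None P' Q' R', simplified, OF assms(1-3)]
  have pq: "set P \<inter> set Q = {}" "set P' \<inter> set Q' = {}" using a by auto
  have com: "x \<in> {last P, last Q, last R}" if "x \<in> set P \<union> set Q" "x \<in> set P' \<union> set Q'" for x
    using g that by blast
  have cr: "u \<in> {last P, last Q, last R} \<or> v \<in> {last P, last Q, last R}"
    if "u \<in> set P \<union> set Q" "v \<in> set P' \<union> set Q'" "E u v" for u v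
    using g that by blast
  have i1: "set P \<inter> set Q' \<subseteq> {}" "set P' \<inter> set Q \<subseteq> {}"
  proof (safe, goal_cases)
    case (1 x)
    then have "x = last P" "x = last Q" using hit(1,4)[of x] com[of x] by blast+
    then show ?case using g by auto
  next
    case (2 x)
    then have "x = last P" "x = last Q" using hit(2,3)[of x] com[of x] by blast+
    then show ?case using g by auto
  qed
  have i2: "set P \<inter> set P' \<subseteq> {last P}" "set Q \<inter> set Q' \<subseteq> {last Q}"
    using com hit by blast+
  have cc: "\<And>u v. u \<in> set P \<Longrightarrow> v \<in> set Q \<Longrightarrow> E u v \<longleftrightarrow> u = hd P \<and> v = hd Q"
    "\<And>u v. u \<in> set P' \<Longrightarrow> v \<in> set Q' \<Longrightarrow> E u v \<longleftrightarrow> u = hd P' \<and> v = hd Q'"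
    using corner_edge[of P Q] corner_edge[of P' Q'] assms(1,2) unfolding net_def by metis+
  have e0: "E (hd P') (hd Q')" "E (hd P) (hd Q)" using cc mem by blast+
  have ip: "ipath P" "ipath P'" "P \<noteq> []" "P' \<noteq> []" "ipath Q" "ipath Q'" "Q \<noteq> []" "Q' \<noteq> []"
    "last P = last P'" "last Q = last Q'"
    using a g by auto
  have J: "ipath (join P P')" "ipath (join Q Q')"
  proof -
    show "ipath (join P P')"
      by (rule ipath_join[OF ip(1-4,9) i2(1)]) (use cr hit(1,2) in blast)
    show "ipath (join Q Q')"
      by (rule ipath_join[OF ip(5-8,10) i2(2)]) (use cr hit(3,4) in blast)
  qed
  \<comment> \<open>Corners of one net that lie on the other are common vertices, hence ends.
    Together with \<open>nl\<close> this shows that the situation never arises, because the corners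
    are adjacent.\<close>
  have e3: "u = hd P' \<and> v = hd Q' \<Longrightarrow> u = last P \<and> v = last Q" if "u \<in> set P" "v \<in> set Q" for u v
    using that com[of u] com[of v] hit(2)[of u] hit(4)[of v] mem by (metis UnI1 UnI2)
  have e4: "u = hd P \<and> v = hd Q \<Longrightarrow> u = last P \<and> v = last Q" if "u \<in> set P'" "v \<in> set Q'" for u v
    using that com[of u] com[of v] hit(1)[of u] hit(3)[of v] mem by (metis UnI1 UnI2)
  have nl: "\<not> E (last P) (last Q)" using g by blast
  have e1: "(u = hd P' \<and> v = hd Q') \<or> (u = hd P \<and> v = hd Q)" if uv: "u \<in> set P" "v \<in> set Q'" "E u v" for u v
  proof -
    have "u = last P \<or> v = last Q" using cr[of u v] uv hit(1)[of u] hit(4)[of v] by blast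
    then show ?thesis
    proof
      assume "u = last P"
      then show ?thesis using cc(2)[of u v] uv mem by simp
    next
      assume "v = last Q"
      then show ?thesis using cc(1)[of u v] uv mem by simp
    qed
  qed
  have e2: "(u = hd P' \<and> v = hd Q') \<or> (u = hd P \<and> v = hd Q)" if uv: "u \<in> set P'" "v \<in> set Q" "E u v" for u v
  proof -
    have "E v u" using uv E_sym by blast
    then have "u = last P \<or> v = last Q" using cr[of v u] uv hit(2)[of u] hit(3)[of v] by blast
    then show ?thesis
    proof
      assume "u = last P"
      then show ?thesis using cc(1)[of u v] uv mem by simp
    next
      assume "v = last Q"
      then show ?thesis using cc(2)[of u v] uv mem by simp
    qed
  qed
  have PN: "P \<noteq> []" "P' \<noteq> []" "last P = last P'" "Q \<noteq> []" "Q' \<noteq> []" "last Q = last Q'"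
    using a g by auto
  note jp = join_props[OF PN(1-3)] and jq = join_props[OF PN(4-6)]
  have "set (join P P') \<inter> set (join Q Q') = {}"
    unfolding jp jq using pq i1 mem by blast
  moreover have "\<forall>u\<in>set (join P P'). \<forall>v\<in>set (join Q Q'). E u v \<longleftrightarrow>
      u = hd (join P P') \<and> v = hd (join Q Q') \<or> u = last (join P P') \<and> v = last (join Q Q')"
  proof (intro ballI)
    fix u v assume "u \<in> set (join P P')" "v \<in> set (join Q Q')"
    then consider "u \<in> set P" "v \<in> set Q" | "u \<in> set P" "v \<in> set Q'" | "u \<in> set P'" "v \<in> set Q"
      | "u \<in> set P'" "v \<in> set Q'" unfolding jp jq by blast
    then show "E u v \<longleftrightarrow> u = hd (join P P') \<and> v = hd (join Q Q') \<or>
        u = last (join P P') \<and> v = last (join Q Q')"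
      unfolding jp jq
    proof cases
      case 1
      then show "E u v \<longleftrightarrow> u = hd P \<and> v = hd Q \<or> u = hd P' \<and> v = hd Q'"
        using cc(1)[of u v] e3[of u v] e0 nl by metis
    next
      case 2
      then show "E u v \<longleftrightarrow> u = hd P \<and> v = hd Q \<or> u = hd P' \<and> v = hd Q'"
        using e1[of u v] e0 by metis
    next
      case 3
      then show "E u v \<longleftrightarrow> u = hd P \<and> v = hd Q \<or> u = hd P' \<and> v = hd Q'"
        using e2[of u v] e0 by metis
    next
      case 4
      then show "E u v \<longleftrightarrow> u = hd P \<and> v = hd Q \<or> u = hd P' \<and> v = hd Q'"
        using cc(2)[of u v] e4[of u v] e0 nl by metis
    qed
  qed
  ultimately show ?thesis
    unfolding prism_pair_def using J jp jq by simp
qed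

lemma glue_net_net:
  assumes "net P Q R" "net P' Q' R'" "glued P Q R P' Q' R'"
  shows has_prism
proof -
  note a = assms(1,2)[unfolded net_def] and g = assms(3)[unfolded glued_def]
  have p2: "prism_pair (join P P') (join R R')"
    using glue_net_net_pair[of P R Q P' R' Q'] assms net_perm(2) glued_perm(2) by metis
  have p3: "prism_pair (join Q Q') (join R R')"
    using glue_net_net_pair[of Q R P Q' R' P'] assms net_perm glued_perm by metis
  have PN: "P \<noteq> []" "P' \<noteq> []" "last P = last P'" "Q \<noteq> []" "Q' \<noteq> []" "last Q = last Q'"
    "R \<noteq> []" "R' \<noteq> []" "last R = last R'"
    using a g unfolding corner_def by auto
  note jp = join_props[OF PN(1-3)] and jq = join_props[OF PN(4-6)] and jr = join_props[OF PN(7-9)]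
  have len: "length P \<ge> 1" "length P' \<ge> 1" "length Q \<ge> 1" "length Q' \<ge> 1" "length R \<ge> 1" "length R' \<ge> 1"
    using PN by (auto simp: Suc_le_eq)
  have l: "length P \<ge> 2 \<or> length Q \<ge> 2" "length P \<ge> 2 \<or> length R \<ge> 2" "length Q \<ge> 2 \<or> length R \<ge> 2"
     "length P' \<ge> 2 \<or> length Q' \<ge> 2" "length P' \<ge> 2 \<or> length R' \<ge> 2" "length Q' \<ge> 2 \<or> length R' \<ge> 2"
    using corner_length[of P' Q'] corner_length[of P' R'] corner_length[of Q' R']
      corner_length[of P Q] corner_length[of P R] corner_length[of Q R] a g by auto
  show ?thesis
    unfolding has_prism_def
    apply (rule exI[of _ "join P P'"], rule exI[of _ "join Q Q'"], rule exI[of _ "join R R'"])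
    apply (intro conjI glue_net_net_pair[OF assms] p2 p3)
    unfolding jp(4) jq(4) jr(4)
    by (rule prism_lengths[OF len l])
qed

text \<open>Two triangles are never too close. A claw and a triangle are too close only if the
  centre is a corner. For two claws adjacency is forbidden too, since the ends of a theta are
  nonadjacent.\<close>

theorem glue:
  assumes "tripod k P Q R" "tripod k' P' Q' R'" "glued P Q R P' Q' R'"
    and "\<And>c c'. k = Some c \<Longrightarrow> k' = Some c' \<Longrightarrow> c \<noteq> c' \<and> \<not> E c c'"
    and "\<And>c. k = Some c \<Longrightarrow> k' = None \<Longrightarrow> c \<notin> {hd P', hd Q', hd R'}"
    and "\<And>c. k = None \<Longrightarrow> k' = Some c \<Longrightarrow> c \<notin> {hd P, hd Q, hd R}"
  shows has_3pc
proof (cases k)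
  case None
  show ?thesis
  proof (cases k')
    case None
    then show ?thesis using \<open>k = None\<close> assms glue_net_net unfolding has_3pc_def by auto
  next
    case (Some c)
    then show ?thesis
      using \<open>k = None\<close> assms(1,2,6) glue_claw_net[OF _ _ glued_perm(3)[OF assms(3)]]
      unfolding has_3pc_def by auto
  qed
next
  case (Some c)
  show ?thesis
  proof (cases k')
    case None
    then show ?thesis
      using \<open>k = Some c\<close> assms(1,2,5) glue_claw_net[OF _ _ assms(3)]
      unfolding has_3pc_def by auto
  next
    case (Some c')
    then show ?thesis
      using \<open>k = Some c\<close> assms(1,2,4) glue_claw_claw[OF _ _ assms(3)]
      unfolding has_3pc_def by auto
  qed
qed


subsection \<open>Finding tripods\<close>

text \<open>Applied with \<open>A\<close> a piece of the base path that ends at the contact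
  \<open>u\<close>, and \<open>p @ [j]\<close> the path coming in from outside. The latter is
  reversed because legs are read from the centre.\<close>

lemma hook:
  assumes "ipath (A @ [u])" "ipath (p @ [j])"
    and "set (A @ [u]) \<inter> set (p @ [j]) = {}"
    and "\<And>a b. a \<in> set (A @ [u]) \<Longrightarrow> b \<in> set (p @ [j]) \<Longrightarrow> E a b \<longleftrightarrow> a = u \<and> b = j"
  shows "ipath (A @ u # j # rev p)"
proof -
  have "ipath (rev (p @ [j]))" using assms(2) by (simp only: ipath_rev)
  then have "ipath ((A @ [u]) @ (j # rev p))"
    using assms by (subst ipath_append) auto
  then show ?thesis by simp
qed

text \<open>
  Go from \<open>x\<close> through \<open>Z\<close> to the first vertex with a neighbour on \<open>P\<close>; the three cases record where
  the centre then lies, and \<open>J\<close> is the part of \<open>Z\<close> that was used.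
\<close>

lemma attach:
  assumes P: "ipath P" "P \<noteq> []"
    and Z: "conn Z" "Z \<inter> set P = {}" "x \<in> Z" "meets Z (set P)"
  obtains k F G H where "tripod k F G H" "last F = hd P" "last G = last P" "last H = x"
    "set F \<union> set G \<union> set H \<subseteq> set P \<union> Z"
    "(\<exists>c J. k = Some c \<and> c \<in> set P \<and> ipath J \<and> J \<noteq> [] \<and> hd J = x \<and> set J \<subseteq> Z \<and>
        (\<forall>b\<in>set J. \<forall>a\<in>set P. E b a \<longleftrightarrow> b = last J \<and> a = c)) \<or>
     (\<exists>c. k = Some c \<and> c \<in> Z \<and> (\<exists>a\<in>set P. \<exists>b\<in>set P. a \<noteq> b \<and> \<not> E a b \<and> E c a \<and> E c b)) \<or>
     (k = None \<and> (\<exists>j\<in>Z. \<exists>a\<in>set P. \<exists>b\<in>set P. hd F = a \<and> hd G = b \<and> hd H = j \<and> E a b \<and>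
        (\<forall>v\<in>set P. E j v \<longleftrightarrow> v = a \<or> v = b)))"
proof -
  obtain z where z: "z \<in> Z" "\<exists>v\<in>set P. E z v" using Z(4) unfolding meets_def by blast
  obtain p j where pj: "ipath (p @ [j])" "hd (p @ [j]) = x" "set (p @ [j]) \<subseteq> Z" "\<exists>v\<in>set P. E j v"
      "\<forall>b\<in>set p. \<not> (\<exists>v\<in>set P. E b v)"
    using conn_path_first[OF Z(1,3) z(1), of "\<lambda>b. \<exists>v\<in>set P. E b v"] z(2) by blast
  have jZ: "j \<in> Z" and disj: "set P \<inter> set (p @ [j]) = {}" using pj(3) Z(2) by auto
  obtain A u B where A: "P = A @ u # B" "E j u" "\<forall>y\<in>set A. \<not> E j y"
    using split_list_first_prop[OF pj(4)] by blast
  have lastx: "last (rev (p @ [j])) = x" using pj(2) by (simp only: last_rev)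
  have eju: "a = u \<Longrightarrow> b = j \<Longrightarrow> E a b" for a b using A(2) E_sym by blast
  have ipA: "ipath (A @ [u])" using P(1) A(1) by (auto simp: ipath_append)
  have hdA: "last (u # rev A) = hd P" using A(1) by (cases A) auto
  have hk1: "ipath (A @ u # j # rev p)"
  proof (rule hook[OF ipA pj(1)])
    show "set (A @ [u]) \<inter> set (p @ [j]) = {}" using disj A(1) by auto
    fix a b assume ab: "a \<in> set (A @ [u])" "b \<in> set (p @ [j])"
    then show "E a b \<longleftrightarrow> a = u \<and> b = j"
      using A pj(5) eju E_sym[of a b] by auto
  qed
  show thesis
  proof (cases "\<exists>v\<in>set B. E j v")
    \<comment> \<open>\<open>j\<close> sees only \<open>u\<close> on \<open>P\<close>, so
      \<open>u\<close> is the centre of a claw.\<close>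
    case False
    have hk2: "ipath (rev B @ u # j # rev p)"
    proof (rule hook[OF _ pj(1)])
      have "ipath (u # B)" using P(1) A(1) ipath_append by blast
      then have "ipath (rev (u # B))" by (simp only: ipath_rev)
      then show "ipath (rev B @ [u])" by simp
      show "set (rev B @ [u]) \<inter> set (p @ [j]) = {}" using disj A(1) by auto
      fix a b assume ab: "a \<in> set (rev B @ [u])" "b \<in> set (p @ [j])"
      then show "E a b \<longleftrightarrow> a = u \<and> b = j"
        using A False pj(5) eju E_sym[of a b] by auto
    qed
    have "claw u (u # rev A) (u # B) (u # j # rev p)"
      unfolding claw_def
    proof (intro conjI armI)
      show "ipath (rev (rev A) @ u # B)" using P(1) A(1) by simp
    qed (use hk1 hk2 in simp_all)
    then have T: "tripod (Some u) (u # rev A) (u # B) (u # j # rev p)" by simp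
    have jp: "j \<notin> set p" using pj(4,5) by blast
    have "\<forall>b\<in>set (p @ [j]). \<forall>a\<in>set P. E b a \<longleftrightarrow> b = last (p @ [j]) \<and> a = u"
      using A False pj(5) jp by auto
    then have out: "\<exists>c J. Some u = Some c \<and> c \<in> set P \<and> ipath J \<and> J \<noteq> [] \<and> hd J = x \<and> set J \<subseteq> Z \<and>
        (\<forall>b\<in>set J. \<forall>a\<in>set P. E b a \<longleftrightarrow> b = last J \<and> a = c)"
      using pj(1-3) A(1) by (intro exI[of _ u] exI[of _ "p @ [j]"]) auto
    have l: "last (u # B) = last P" "last (u # j # rev p) = x" using lastx A(1) by auto
    have "set (u # rev A) \<union> set (u # B) \<union> set (u # j # rev p) \<subseteq> set P \<union> Z" using A(1) pj(3) by auto
    from that[OF T hdA l this disjI1[OF out]] show ?thesis .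
  next
    case True
    obtain B1 v B2 where B: "B = B1 @ v # B2" "E j v" "\<forall>y\<in>set B2. \<not> E j y"
      using split_list_last_prop[OF True] by blast
    have ejv: "a = v \<Longrightarrow> b = j \<Longrightarrow> E a b" for a b using B(2) E_sym by blast
    have hk2: "ipath (rev B2 @ v # j # rev p)"
    proof (rule hook[OF _ pj(1)])
      have "ipath (v # B2)" using P(1) A(1) B(1) by (auto simp: ipath_append)
      then have "ipath (rev (v # B2))" by (simp only: ipath_rev)
      then show "ipath (rev B2 @ [v])" by simp
      show "set (rev B2 @ [v]) \<inter> set (p @ [j]) = {}" using disj A(1) B(1) by auto
      fix a b assume ab: "a \<in> set (rev B2 @ [v])" "b \<in> set (p @ [j])"
      then show "E a b \<longleftrightarrow> a = v \<and> b = j"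
        using A B pj(5) ejv E_sym[of a b] by auto
    qed
    have lastv: "last (v # B2) = last P" using A B by simp
    have uv: "u \<noteq> v" using P(1) A(1) B(1) by (auto simp: ipath_append)
    show ?thesis
    proof (cases "B1 = []")
      case t: True
      \<comment> \<open>The first and last neighbours of \<open>j\<close> are consecutive on
        \<open>P\<close>: they form a triangle with \<open>j\<close>.\<close>
      have "net (u # rev A) (v # B2) (j # rev p)"
        unfolding net_def
      proof (intro conjI cornerI)
        show "ipath (rev (u # rev A) @ v # B2)" using P(1) A(1) B(1) t by simp
      qed (use hk1 hk2 in simp_all)
      moreover have "E u v" using P(1) A(1) B(1) t by (auto simp: ipath_append)
      moreover have "\<forall>y\<in>set P. E j y \<longleftrightarrow> y = u \<or> y = v"
        using A B t by auto
      ultimately show ?thesis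
        using that[of None "u # rev A" "v # B2" "j # rev p"] hdA lastv A(1) B(1) lastx pj jZ by auto
    next
      case f: False
      have nuv: "\<not> E u v" using P(1) A(1) B(1) f by (auto simp: ipath_append)
      \<comment> \<open>The first and last neighbours of \<open>j\<close> are not consecutive. Going
        from \<open>u\<close> to \<open>v\<close> through \<open>j\<close> bypasses
        \<open>B1\<close> and makes \<open>j\<close> the centre of a claw.\<close>
      have "ipath ((A @ [u]) @ j # v # B2)"
      proof (subst ipath_append, intro conjI ballI)
        have sub: "ipath (v # B2)" using P(1) A(1) B(1) by (auto simp: ipath_append)
        show "ipath (j # v # B2)" using sub B disj A(1) by auto
        show "set (A @ [u]) \<inter> set (j # v # B2) = {}"
          using P(1) A(1) B(1) disj by (auto simp: ipath_append)
        fix a b assume ab: "a \<in> set (A @ [u])" "b \<in> set (j # v # B2)"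
        show "E a b \<longleftrightarrow> a = last (A @ [u]) \<and> b = hd (j # v # B2)"
        proof (cases "b = j")
          case True
          then show ?thesis using ab A E_sym[of a j] eju by auto
        next
          case False
          have "ipath ((A @ [u]) @ (B1 @ v # B2))" using P(1) A(1) B(1) by simp
          then have "E a b \<longleftrightarrow> a = u \<and> b = hd B1" and d: "set B1 \<inter> set (v # B2) = {}"
            using ab False f ipath_append[of "A @ [u]" "B1 @ v # B2"] ipath_append[of B1 "v # B2"]
            by (auto simp del: append_assoc)
          moreover have "hd B1 \<in> set B1" using f by simp
          ultimately show ?thesis using ab False by auto
        qed
      qed (use ipA in simp)
      then have "claw j (j # u # rev A) (j # v # B2) (j # rev p)"
        unfolding claw_def using hk1 hk2 by (intro conjI armI) simp_all
      then show ?thesis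
        using that[of "Some j" "j # u # rev A" "j # v # B2" "j # rev p"] hdA lastv A B lastx pj jZ uv nuv
        by auto
    qed
  qed
qed

text \<open>If \<open>z\<close> is on a path from \<open>x\<close> to \<open>y\<close>, it is a
  centre with a trivial leg; otherwise it is attached to the path from outside.\<close>

lemma tripod_exists:
  assumes "conn X" "x \<in> X" "y \<in> X" "z \<in> X" "z \<noteq> x" "z \<noteq> y"
  obtains k F G H where "tripod k F G H" "last F = x" "last G = y" "last H = z"
    "set F \<union> set G \<union> set H \<subseteq> X"
proof -
  obtain P where P: "ipath P" "P \<noteq> []" "hd P = x" "last P = y" "set P \<subseteq> X"
    using conn_path[OF assms(1-3)] .
  show thesis
  proof (cases "z \<in> set P")
    case True
    then obtain A B where AB: "P = A @ z # B" by (meson split_list)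
    have "claw z (z # rev A) (z # B) [z]"
      unfolding claw_def
    proof (intro conjI armI)
      show "ipath (rev (rev A) @ z # B)" using P AB by simp
      show "ipath (rev (rev A) @ z # [])" using P AB by (auto simp: ipath_append)
      have "ipath (z # B)" using P AB by (auto simp: ipath_append)
      then have "ipath (rev (z # B))" by (simp only: ipath_rev)
      then show "ipath (rev B @ z # [])" by simp
    qed
    moreover have "last (z # rev A) = x" using P AB by (cases A) auto
    ultimately show ?thesis using that[of "Some z"] P AB by auto
  next
    case False
    let ?Q = "\<lambda>v. v \<in> set P \<or> (\<exists>u\<in>set P. E v u)"
    have "x \<in> set P" using P by auto
    then obtain q w where q: "ipath (q @ [w])" "hd (q @ [w]) = z" "set (q @ [w]) \<subseteq> X" "?Q w" "\<forall>v\<in>set q. \<not> ?Q v"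
      using conn_path_first[OF assms(1,4,2), of ?Q] by blast
    \<comment> \<open>A vertex of \<open>P\<close> is never where the search stops, because its
      predecessor is already adjacent to \<open>P\<close>.\<close>
    have wP: "w \<notin> set P"
    proof
      assume w: "w \<in> set P"
      then have "q \<noteq> []" using q(2) False by auto
      then have "last q \<in> set q" "E (last q) w" using q(1) by (auto simp: ipath_append)
      then show False using q(5) w by blast
    qed
    have d: "set (q @ [w]) \<inter> set P = {}" using wP q(5) by auto
    have m: "meets (set (q @ [w])) (set P)" using q(4) wP unfolding meets_def by auto
    have c: "conn (set (q @ [w]))" using q(1) by (intro conn_ipath) auto
    have zm: "z \<in> set (q @ [w])" using q(2) by (metis hd_in_set snoc_eq_iff_butlast)
    show ?thesis
    proof (rule attach[OF P(1,2) c d zm m])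
      fix k F G H
      assume "tripod k F G H" "last F = hd P" "last G = last P" "last H = z"
        "set F \<union> set G \<union> set H \<subseteq> set P \<union> set (q @ [w])"
      moreover have "set P \<union> set (q @ [w]) \<subseteq> X" using P(5) q(3) by blast
      ultimately show thesis using that[of k F G H] P(3,4) by (metis order_trans)
    qed
  qed
qed

lemma tripod_extend:
  assumes T: "tripod k P Q R" and W: "ipath W" "W \<noteq> []" "hd W = last P"
    and int: "set W \<inter> (set P \<union> set Q \<union> set R) \<subseteq> {last P}"
    and edge: "\<And>w u. w \<in> set W \<Longrightarrow> u \<in> set P \<union> set Q \<union> set R \<Longrightarrow> E w u \<Longrightarrow> w = last P \<or> u = last P"
  shows "tripod k (P @ tl W) Q R" "last (P @ tl W) = last W" "hd (P @ tl W) = hd P"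
    "set (P @ tl W) = set P \<union> set W"
proof -
  have ne: "P \<noteq> []" using tripod_nonempty[OF T] by blast
  have WW: "rev W \<noteq> []" "last P = last (rev W)" using W by (simp_all add: last_rev)
  note j = join_props[OF ne WW]
  show "last (P @ tl W) = last W" "hd (P @ tl W) = hd P" "set (P @ tl W) = set P \<union> set W"
    using j W by (simp_all add: hd_rev)
  note j' = this
  have ip: "ipath (P @ tl W)" if "ipath P"
  proof -
    have "ipath (P @ tl (rev (rev W)))"
    proof (rule ipath_join[OF that _ ne WW])
      show "ipath (rev W)" using W(1) by simp
      show "set P \<inter> set (rev W) \<subseteq> {last P}" using int by auto
      show "u = last P \<or> v = last P" if "u \<in> set P" "v \<in> set (rev W)" "E u v" for u v
        using edge[of v u] that E_sym by auto
    qed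
    then show ?thesis by simp
  qed
  have arm: "arm c (P @ tl W) Q'" if a: "arm c P Q'" and Q': "set Q' \<subseteq> set Q \<union> set R" for c Q'
  proof -
    have lP: "last P \<in> set P" using ne by simp
    have a1: "x = c" if "x \<in> set P" "x \<in> set Q'" for x using a that unfolding arm_def by auto
    have a2: "c \<in> set P" "c \<in> set Q'" using a unfolding arm_def by auto
    have i: "x = c" if "x \<in> set P \<union> set W" "x \<in> set Q'" for x
    proof (cases "x \<in> set P")
      case False
      then have "x \<in> set W \<inter> (set P \<union> set Q \<union> set R)" using that Q' by blast
      then have "x = last P" using int by blast
      then show ?thesis using False lP by simp
    qed (use a1 that in blast)
    have e: "u = c \<or> v = c" if uv: "u \<in> set P \<union> set W" "v \<in> set Q'" "E u v" for u v
    proof (cases "u \<in> set P")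
      case True
      then show ?thesis using arm_edge[OF a] uv by blast
    next
      case False
      then have "u = last P \<or> v = last P" using edge[of u v] uv Q' by blast
      then have "v = last P" using False lP by auto
      then show ?thesis using a1 lP uv by blast
    qed
    show ?thesis
      using a ip i e a2 ne j' unfolding arm_def by auto
  qed
  have corn: "corner (P @ tl W) Q'" if a: "corner P Q'" and Q': "set Q' \<subseteq> set Q \<union> set R" for Q'
  proof -
    have lP: "last P \<in> set P" using ne by simp
    have a1: "x \<notin> set Q'" if "x \<in> set P" for x using a that unfolding corner_def by auto
    have i: "x \<notin> set Q'" if "x \<in> set P \<union> set W" for x
    proof
      assume "x \<in> set Q'"
      then have "x \<notin> set P" using a1 by blast
      then have "x \<in> set W \<inter> (set P \<union> set Q \<union> set R)" using that Q' \<open>x \<in> set Q'\<close> by blast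
      then have "x = last P" using int by blast
      then show False using \<open>x \<notin> set P\<close> lP by simp
    qed
    have e: "E u v \<longleftrightarrow> u = hd P \<and> v = hd Q'" if uv: "u \<in> set P \<union> set W" "v \<in> set Q'" for u v
    proof (cases "u \<in> set P")
      case True
      then show ?thesis using corner_edge[OF a] uv by blast
    next
      case False
      then have "u \<noteq> hd P" using ne by auto
      moreover have "\<not> E u v"
      proof
        assume "E u v"
        then have "u = last P \<or> v = last P" using edge[of u v] uv False Q' by blast
        then show False using False lP a1 uv by auto
      qed
      ultimately show ?thesis by blast
    qed
    show ?thesis
      using a ip i e ne j' unfolding corner_def by auto
  qed
  show "tripod k (P @ tl W) Q R"
    using T arm corn by (cases k) (auto simp: claw_def net_def)
qed


section \<open>Anticomplete sets (\<open>sep\<close>) and skinny connectors\<close>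

definition sep :: "'a set \<Rightarrow> 'a set \<Rightarrow> bool" where
  "sep X Y \<longleftrightarrow> (\<forall>x\<in>X. \<forall>y\<in>Y. x \<noteq> y \<and> \<not> E x y)"

lemma sepD: "sep X Y \<Longrightarrow> x \<in> X \<Longrightarrow> y \<in> Y \<Longrightarrow> x \<noteq> y \<and> \<not> E x y \<and> \<not> E y x"
  unfolding sep_def using E_sym by blast

lemma sep_sym: "sep X Y \<Longrightarrow> sep Y X"
  unfolding sep_def using E_sym by blast

lemma sep_mono: "sep X Y \<Longrightarrow> X' \<subseteq> X \<Longrightarrow> Y' \<subseteq> Y \<Longrightarrow> sep X' Y'"
  unfolding sep_def by blast

lemma sep_Un: "sep X (Y \<union> Z) \<longleftrightarrow> sep X Y \<and> sep X Z"
  unfolding sep_def by blast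

text \<open>The contrapositive of \<open>glue\<close>: the three outcomes are the ways in which
  centres can be too close. The tripods are enclosed in sets \<open>X\<close> and \<open>Y\<close>,
  so that later proofs check contacts between sets and not between legs.\<close>

lemma glue_sets:
  assumes T: "tripod k P Q R" "last P = p" "last Q = q" "last R = r" "set P \<union> set Q \<union> set R \<subseteq> X"
    and T': "tripod k' P' Q' R'" "last P' = p" "last Q' = q" "last R' = r" "set P' \<union> set Q' \<union> set R' \<subseteq> Y"
    and n: "p \<noteq> q" "p \<noteq> r" "q \<noteq> r" "\<not> E p q" "\<not> E p r" "\<not> E q r"
    and XY: "X \<inter> Y \<subseteq> {p, q, r}"
    and cross: "\<And>u v. u \<in> X \<Longrightarrow> v \<in> Y \<Longrightarrow> E u v \<Longrightarrow> u \<in> {p, q, r} \<or> v \<in> {p, q, r}"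
    and no: "\<not> has_3pc"
  obtains (claws) c c' where "k = Some c" "k' = Some c'" "c = c' \<or> E c c'"
  | (claw_net) c where "k = Some c" "k' = None" "c \<in> {hd P', hd Q', hd R'}"
  | (net_claw) c where "k = None" "k' = Some c" "c \<in> {hd P, hd Q, hd R}"
proof -
  have "glued P Q R P' Q' R'"
    unfolding glued_def
  proof (intro conjI ballI impI)
    show "(set P \<union> set Q \<union> set R) \<inter> (set P' \<union> set Q' \<union> set R') \<subseteq> {last P, last Q, last R}"
      using XY T(2-5) T'(5) by blast
    fix u v assume "u \<in> set P \<union> set Q \<union> set R" "v \<in> set P' \<union> set Q' \<union> set R'" "E u v"
    then show "u \<in> {last P, last Q, last R} \<or> v \<in> {last P, last Q, last R}"
      using cross[of u v] T(2-5) T'(5) by blast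
  qed (use T(2-4) T'(2-4) n in simp_all)
  from glue[OF T(1) T'(1) this] no claws claw_net net_claw show thesis by blast
qed

text \<open>
  A claw centred at \<open>a\<close>, \<open>b\<close> or \<open>c\<close> is excluded: gluing along such an end could bring two centres
  too close to each other.
\<close>

definition skinny :: "'a set \<Rightarrow> 'a set \<Rightarrow> 'a set \<Rightarrow> 'a set \<Rightarrow> bool" where
  "skinny A1 A2 A3 S \<longleftrightarrow> (\<forall>a\<in>A1. \<forall>b\<in>A2. \<forall>c\<in>A3. meets {a} S \<longrightarrow> meets {b} S \<longrightarrow> meets {c} S \<longrightarrow>
    (\<exists>k P Q R. tripod k P Q R \<and> last P = a \<and> last Q = b \<and> last R = c \<and>
      set P \<union> set Q \<union> set R \<subseteq> S \<union> {a, b, c} \<and> (\<forall>x. k = Some x \<longrightarrow> x \<in> S)))"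

lemma skinny_perm:
  assumes "skinny A1 A2 A3 S"
  shows "skinny A2 A1 A3 S" "skinny A1 A3 A2 S"
proof -
  show "skinny A2 A1 A3 S"
    unfolding skinny_def
  proof (intro ballI impI)
    fix a b c assume "a \<in> A2" "b \<in> A1" "c \<in> A3" "meets {a} S" "meets {b} S" "meets {c} S"
    then obtain k P Q R where "tripod k P Q R" "last P = b" "last Q = a" "last R = c"
      "set P \<union> set Q \<union> set R \<subseteq> S \<union> {b, a, c}" "\<forall>x. k = Some x \<longrightarrow> x \<in> S"
      using assms unfolding skinny_def by meson
    then show "\<exists>k P Q R. tripod k P Q R \<and> last P = a \<and> last Q = b \<and> last R = c \<and>
      set P \<union> set Q \<union> set R \<subseteq> S \<union> {a, b, c} \<and> (\<forall>x. k = Some x \<longrightarrow> x \<in> S)"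
      using tripod_perm(1)[of k P Q R]
      by (intro exI[of _ k] exI[of _ Q] exI[of _ P] exI[of _ R]) auto
  qed
  show "skinny A1 A3 A2 S"
    unfolding skinny_def
  proof (intro ballI impI)
    fix a b c assume "a \<in> A1" "b \<in> A3" "c \<in> A2" "meets {a} S" "meets {b} S" "meets {c} S"
    then obtain k P Q R where "tripod k P Q R" "last P = a" "last Q = c" "last R = b"
      "set P \<union> set Q \<union> set R \<subseteq> S \<union> {a, c, b}" "\<forall>x. k = Some x \<longrightarrow> x \<in> S"
      using assms unfolding skinny_def by meson
    then show "\<exists>k P Q R. tripod k P Q R \<and> last P = a \<and> last Q = b \<and> last R = c \<and>
      set P \<union> set Q \<union> set R \<subseteq> S \<union> {a, b, c} \<and> (\<forall>x. k = Some x \<longrightarrow> x \<in> S)"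
      using tripod_perm(2)[of k P Q R]
      by (intro exI[of _ k] exI[of _ P] exI[of _ R] exI[of _ Q]) auto
  qed
qed

text \<open>A version of \<open>tripod_extend\<close> for a tripod that lives in \<open>S\<close>,
  its own end and a set \<open>Y\<close> anticomplete to the new piece. It can be repeated for the
  other two legs, with \<open>Y\<close> collecting what was added.\<close>

lemma leg_extend:
  assumes T: "tripod k P Q R" "set P \<union> set Q \<union> set R \<subseteq> insert (last P) S \<union> Y"
    and W: "ipath W" "W \<noteq> []" "hd W = last P" "set W \<inter> S = {}" "sep (set W) Y"
    and S: "\<And>w. w \<in> set W \<Longrightarrow> meets {w} S \<Longrightarrow> w = hd W"
  shows "tripod k (P @ tl W) Q R \<and> last (P @ tl W) = last W \<and>
    set (P @ tl W) \<union> set Q \<union> set R \<subseteq> S \<union> set W \<union> Y"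
proof -
  have e: "tripod k (P @ tl W) Q R" "last (P @ tl W) = last W" "set (P @ tl W) = set P \<union> set W"
  proof -
    have i: "set W \<inter> (set P \<union> set Q \<union> set R) \<subseteq> {last P}"
    proof
      fix x assume x: "x \<in> set W \<inter> (set P \<union> set Q \<union> set R)"
      then have "x \<in> insert (last P) S \<union> Y" using T(2) by blast
      then show "x \<in> {last P}" using x W(4) sepD[OF W(5), of x x] by blast
    qed
    have ed: "w = last P \<or> u = last P" if "w \<in> set W" "u \<in> set P \<union> set Q \<union> set R" "E w u" for w u
    proof -
      have "u \<in> insert (last P) S \<union> Y" using T(2) that by blast
      then show ?thesis
        using that S[of w] W(3) sepD[OF W(5), of w u] unfolding meets_def by auto
    qed
    show "tripod k (P @ tl W) Q R" "last (P @ tl W) = last W" "set (P @ tl W) = set P \<union> set W"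
      using tripod_extend[OF T(1) W(1-3) i] ed by blast+
  qed
  have "last P \<in> set W" using W(2,3) by (metis hd_in_set)
  then have "set P \<union> set Q \<union> set R \<subseteq> S \<union> set W \<union> Y" using T(2) by blast
  then show ?thesis using e by auto
qed

text \<open>Each \<open>Wi\<close> touches \<open>S\<close> at its first vertex only, so the tripod
  for the three first vertices can be lengthened along the \<open>Wi\<close> one after the other.
  This moves the ends of a skinny tripod to any convenient place in the \<open>Ai\<close>.\<close>

lemma skinny_linked:
  assumes S: "skinny A1 A2 A3 S" and A: "sep A1 A2" "sep A1 A3" "sep A2 A3"
    and dis: "A1 \<inter> S = {}" "A2 \<inter> S = {}" "A3 \<inter> S = {}"
    and W1: "ipath W1" "W1 \<noteq> []" "set W1 \<subseteq> A1" "meets {hd W1} S" "\<forall>w\<in>set W1. meets {w} S \<longrightarrow> w = hd W1"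
    and W2: "ipath W2" "W2 \<noteq> []" "set W2 \<subseteq> A2" "meets {hd W2} S" "\<forall>w\<in>set W2. meets {w} S \<longrightarrow> w = hd W2"
    and W3: "ipath W3" "W3 \<noteq> []" "set W3 \<subseteq> A3" "meets {hd W3} S" "\<forall>w\<in>set W3. meets {w} S \<longrightarrow> w = hd W3"
  obtains k P Q R where "tripod k P Q R" "last P = last W1" "last Q = last W2" "last R = last W3"
    "set P \<union> set Q \<union> set R \<subseteq> S \<union> set W1 \<union> set W2 \<union> set W3" "\<forall>x. k = Some x \<longrightarrow> x \<in> S"
proof -
  have h: "hd W1 \<in> set W1" "hd W2 \<in> set W2" "hd W3 \<in> set W3" using W1(2) W2(2) W3(2) by auto
  then have hA: "hd W1 \<in> A1" "hd W2 \<in> A2" "hd W3 \<in> A3" using W1(3) W2(3) W3(3) by auto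
  obtain k P Q R where T: "tripod k P Q R" "last P = hd W1" "last Q = hd W2" "last R = hd W3"
      "set P \<union> set Q \<union> set R \<subseteq> S \<union> {hd W1, hd W2, hd W3}" "\<forall>x. k = Some x \<longrightarrow> x \<in> S"
    using S hA W1(4) W2(4) W3(4) unfolding skinny_def by meson
  have s: "set W1 \<inter> S = {}" "set W2 \<inter> S = {}" "set W3 \<inter> S = {}"
    using dis W1(3) W2(3) W3(3) by auto
  have "sep (set W1) (set W2)" "sep (set W1) (set W3)" "sep (set W2) (set W3)"
    using sep_mono[OF A(1) W1(3) W2(3)] sep_mono[OF A(2) W1(3) W3(3)] sep_mono[OF A(3) W2(3) W3(3)] by auto
  then have sp: "sep (set W1) (set W2 \<union> set W3)" "sep (set W2) (set W1 \<union> set W3)" "sep (set W3) (set W1 \<union> set W2)"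
    by (simp_all add: sep_Un sep_sym)
  have tl: "set (tl W1) \<subseteq> set W1" "set (tl W2) \<subseteq> set W2"
    by (simp_all add: W1(2) W2(2) list.set_sel(2) subsetI)
  let ?P = "P @ tl W1" and ?Q = "Q @ tl W2" and ?R = "R @ tl W3"
  have 1: "tripod k ?P Q R \<and> last ?P = last W1 \<and>
      set ?P \<union> set Q \<union> set R \<subseteq> S \<union> set W1 \<union> (set W2 \<union> set W3)"
  proof (rule leg_extend[OF T(1) _ W1(1,2) T(2)[symmetric] s(1) sp(1)])
    show "set P \<union> set Q \<union> set R \<subseteq> insert (last P) S \<union> (set W2 \<union> set W3)"
      unfolding T(2) by (rule subset_trans[OF T(5)]) (use h in auto)
  qed (use W1(5) in blast)
  have 2: "tripod k ?Q ?P R \<and> last ?Q = last W2 \<and>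
      set ?Q \<union> set ?P \<union> set R \<subseteq> S \<union> set W2 \<union> (set W1 \<union> set W3)"
  proof (rule leg_extend[OF _ _ W2(1,2) T(3)[symmetric] s(2) sp(2)])
    show "tripod k Q ?P R" using 1 tripod_perm(1) by blast
    show "set Q \<union> set ?P \<union> set R \<subseteq> insert (last Q) S \<union> (set W1 \<union> set W3)"
      unfolding set_append T(3) using T(5) h tl by blast
  qed (use W2(5) in blast)
  have 3: "tripod k ?R ?P ?Q \<and> last ?R = last W3 \<and>
      set ?R \<union> set ?P \<union> set ?Q \<subseteq> S \<union> set W3 \<union> (set W1 \<union> set W2)"
  proof (rule leg_extend[OF _ _ W3(1,2) T(4)[symmetric] s(3) sp(3)])
    show "tripod k R ?P ?Q" using 2 tripod_perm by blast
    show "set R \<union> set ?P \<union> set ?Q \<subseteq> insert (last R) S \<union> (set W1 \<union> set W2)"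
      unfolding set_append T(4) using T(5) h tl by blast
  qed (use W3(5) in blast)
  show thesis
    using that[of k ?P ?Q ?R] 1 2 3 T(6) tripod_perm by blast
qed

text \<open>In each \<open>Ai\<close> choose a path from a neighbour of \<open>S'\<close> to a
  neighbour of \<open>S\<close>, with one contact to each. The tripod of \<open>S'\<close>,
  lengthened along these paths, has the same ends as a tripod of \<open>S\<close>. The claw centres
  lie in \<open>S'\<close> and in \<open>S\<close>, which are anticomplete, so nothing prevents
  gluing.\<close>

lemma skinny_skinny:
  assumes sep: "sep A1 A2" "sep A1 A3" "sep A2 A3" "sep S S'"
    and conn: "conn A1" "conn A2" "conn A3"
    and dis: "A1 \<inter> S = {}" "A2 \<inter> S = {}" "A3 \<inter> S = {}" "A1 \<inter> S' = {}" "A2 \<inter> S' = {}" "A3 \<inter> S' = {}"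
    and meets: "meets A1 S" "meets A2 S" "meets A3 S" "meets A1 S'" "meets A2 S'" "meets A3 S'"
    and sk: "skinny A1 A2 A3 S" "skinny A1 A2 A3 S'"
  shows has_3pc
proof (rule ccontr)
  assume no: "\<not> has_3pc"
  have path: "\<exists>W. ipath W \<and> W \<noteq> [] \<and> set W \<subseteq> A \<and> meets {hd W} S' \<and> meets {last W} S \<and>
      (\<forall>w\<in>set W. meets {w} S' \<longrightarrow> w = hd W) \<and> (\<forall>w\<in>set W. meets {w} S \<longrightarrow> w = last W)"
    if hyp: "conn A" "meets A S" "meets A S'" for A
  proof -
    obtain x y where "x \<in> A" "meets {x} S'" "y \<in> A" "meets {y} S" using hyp(2,3) unfolding meets_def by blast
    then show ?thesis
      using conn_path_between[OF hyp(1), of x "\<lambda>w. meets {w} S'" y "\<lambda>w. meets {w} S"] by metis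
  qed
  obtain W1 where W1: "ipath W1" "W1 \<noteq> []" "set W1 \<subseteq> A1" "meets {hd W1} S'" "meets {last W1} S"
      "\<forall>w\<in>set W1. meets {w} S' \<longrightarrow> w = hd W1" "\<forall>w\<in>set W1. meets {w} S \<longrightarrow> w = last W1"
    using path[OF conn(1) meets(1,4)] by blast
  obtain W2 where W2: "ipath W2" "W2 \<noteq> []" "set W2 \<subseteq> A2" "meets {hd W2} S'" "meets {last W2} S"
      "\<forall>w\<in>set W2. meets {w} S' \<longrightarrow> w = hd W2" "\<forall>w\<in>set W2. meets {w} S \<longrightarrow> w = last W2"
    using path[OF conn(2) meets(2,5)] by blast
  obtain W3 where W3: "ipath W3" "W3 \<noteq> []" "set W3 \<subseteq> A3" "meets {hd W3} S'" "meets {last W3} S"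
      "\<forall>w\<in>set W3. meets {w} S' \<longrightarrow> w = hd W3" "\<forall>w\<in>set W3. meets {w} S \<longrightarrow> w = last W3"
    using path[OF conn(3) meets(3,6)] by blast
  obtain k' P' Q' R' where T': "tripod k' P' Q' R'" "last P' = last W1" "last Q' = last W2" "last R' = last W3"
      "set P' \<union> set Q' \<union> set R' \<subseteq> S' \<union> set W1 \<union> set W2 \<union> set W3" "\<forall>x. k' = Some x \<longrightarrow> x \<in> S'"
    using skinny_linked[OF sk(2) sep(1-3) dis(4-6) W1(1-4,6) W2(1-4,6) W3(1-4,6)] by metis
  let ?a = "last W1" and ?b = "last W2" and ?c = "last W3"
  have l: "?a \<in> set W1" "?b \<in> set W2" "?c \<in> set W3" using W1(2) W2(2) W3(2) by auto
  then have lA: "?a \<in> A1" "?b \<in> A2" "?c \<in> A3" using W1(3) W2(3) W3(3) by auto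
  obtain k P Q R where T: "tripod k P Q R" "last P = ?a" "last Q = ?b" "last R = ?c"
      "set P \<union> set Q \<union> set R \<subseteq> S \<union> {?a, ?b, ?c}" "\<forall>x. k = Some x \<longrightarrow> x \<in> S"
    using sk(1) lA W1(5) W2(5) W3(5) unfolding skinny_def by meson
  have SS': "x \<notin> S'" if "x \<in> S" for x using sepD[OF sep(4) that, of x] by blast
  have SW: "x \<notin> set W1 \<union> set W2 \<union> set W3" if "x \<in> S \<or> x \<in> S'" for x using dis W1(3) W2(3) W3(3) that by auto
  have n: "?a \<noteq> ?b" "?a \<noteq> ?c" "?b \<noteq> ?c" "\<not> E ?a ?b" "\<not> E ?a ?c" "\<not> E ?b ?c"
    using sepD[OF sep(1) lA(1,2)] sepD[OF sep(2) lA(1,3)] sepD[OF sep(3) lA(2,3)] by auto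
  have XY: "(S \<union> {?a, ?b, ?c}) \<inter> (S' \<union> set W1 \<union> set W2 \<union> set W3) \<subseteq> {?a, ?b, ?c}"
  proof
    fix x assume x: "x \<in> (S \<union> {?a, ?b, ?c}) \<inter> (S' \<union> set W1 \<union> set W2 \<union> set W3)"
    then have "x \<notin> S" using SS'[of x] SW[of x] by blast
    then show "x \<in> {?a, ?b, ?c}" using x by blast
  qed
  have cross: "u \<in> {?a, ?b, ?c} \<or> v \<in> {?a, ?b, ?c}"
    if "u \<in> S \<union> {?a, ?b, ?c}" "v \<in> S' \<union> set W1 \<union> set W2 \<union> set W3" "E u v" for u v
  proof (cases "u \<in> S")
    case True
    have "meets {v} S" using True that(3) E_sym unfolding meets_def by blast
    moreover have "v \<notin> S'" using True that(3) sepD[OF sep(4), of u v] by blast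
    ultimately show ?thesis using that(2) W1(7) W2(7) W3(7) by blast
  qed (use that in blast)
  show False
  proof (rule glue_sets[OF T(1-5) T'(1-5) n XY cross no])
    fix c c' assume "k = Some c" "k' = Some c'" "c = c' \<or> E c c'"
    then show False using T(6) T'(6) sepD[OF sep(4), of c c'] by blast
  next
    fix c assume c: "k = Some c" "c \<in> {hd P', hd Q', hd R'}"
    then have "c \<in> set P' \<union> set Q' \<union> set R'" using tripod_nonempty[OF T'(1)] by auto
    then have "c \<in> S' \<union> set W1 \<union> set W2 \<union> set W3" using T'(5) by blast
    then show False using c(1) T(6) SS'[of c] SW[of c] by blast
  next
    fix c assume c: "k' = Some c" "c \<in> {hd P, hd Q, hd R}"
    then have "c \<in> set P \<union> set Q \<union> set R" using tripod_nonempty[OF T(1)] by auto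
    moreover have "c \<in> S'" using c(1) T'(6) by blast
    ultimately have "c \<in> S \<union> {?a, ?b, ?c}" "c \<notin> S" using T(5) SS'[of c] by blast+
    then have "c \<in> set W1 \<union> set W2 \<union> set W3" using l by blast
    then show False using SW[of c] \<open>c \<in> S'\<close> by blast
  qed blast+
qed


text \<open>A tripod spanned by \<open>f\<close> and a path through \<open>Z\<close> is glued to the
  tripod of \<open>S\<close>. Since this must fail, the centre of the first one has a neighbour in
  \<open>S\<close>. Vertices of \<open>f\<close> have none, so the centre is on the path in
  \<open>Z\<close>, and as such it has two nonadjacent neighbours on \<open>f\<close>. Such a vertex
  later becomes a centre of the final theta.\<close>

lemma skinny_attach:
  assumes f: "ipath f" "length f \<ge> 3"
    and sep: "sep A K" "sep A L" "sep K L" "sep S (set f)"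
    and disS: "A \<inter> S = {}" "K \<inter> S = {}" "L \<inter> S = {}"
    and disf: "A \<inter> set f = {}" "K \<inter> set f = {}" "L \<inter> set f = {}"
    and Z: "conn Z" "Z \<subseteq> A" "meets Z S" "meets Z (set f)"
    and K: "conn K" "meets K S" "\<exists>u\<in>K. E u (hd f)" "\<And>u v. u \<in> K \<Longrightarrow> v \<in> set f \<Longrightarrow> E u v \<Longrightarrow> v = hd f"
    and L: "conn L" "meets L S" "\<exists>u\<in>L. E u (last f)" "\<And>u v. u \<in> L \<Longrightarrow> v \<in> set f \<Longrightarrow> E u v \<Longrightarrow> v = last f"
    and sk: "skinny A K L S" and no: "\<not> has_3pc"
  shows "\<exists>q\<in>Z. meets {q} S \<and> (\<exists>a\<in>set f. \<exists>b\<in>set f. a \<noteq> b \<and> \<not> E a b \<and> E q a \<and> E q b)"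
proof (rule ccontr)
  assume none: "\<not> ?thesis"
  have fne: "f \<noteq> []" using f(2) by auto
  then have hlf: "hd f \<in> set f" "last f \<in> set f" by simp_all
  have nhl: "hd f \<noteq> last f" using ipath_nonadj_ends[OF f] by simp
  obtain x y where xy: "x \<in> Z" "meets {x} S" "y \<in> Z" "meets {y} (set f)" using Z(3,4) unfolding meets_def by blast
  obtain p where p: "ipath p" "p \<noteq> []" "set p \<subseteq> Z" "meets {hd p} S" "meets {last p} (set f)"
      "\<forall>u\<in>set p. meets {u} S \<longrightarrow> u = hd p" "\<forall>u\<in>set p. meets {u} (set f) \<longrightarrow> u = last p"
    by (rule conn_path_between[OF Z(1) xy(1), of "\<lambda>u. meets {u} S" y "\<lambda>u. meets {u} (set f)"]) (use xy in auto)
  obtain uK vK where uK: "uK \<in> K" "meets {uK} S" "vK \<in> K" "E vK (hd f)" using K(2,3) unfolding meets_def by blast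
  obtain WK where WK: "ipath WK" "WK \<noteq> []" "set WK \<subseteq> K" "meets {hd WK} S" "E (last WK) (hd f)"
      "\<forall>u\<in>set WK. meets {u} S \<longrightarrow> u = hd WK" "\<forall>u\<in>set WK. E u (hd f) \<longrightarrow> u = last WK"
    by (rule conn_path_between[OF K(1) uK(1), of "\<lambda>u. meets {u} S" vK "\<lambda>u. E u (hd f)"]) (use uK in auto)
  obtain uL vL where uL: "uL \<in> L" "meets {uL} S" "vL \<in> L" "E vL (last f)" using L(2,3) unfolding meets_def by blast
  obtain WL where WL: "ipath WL" "WL \<noteq> []" "set WL \<subseteq> L" "meets {hd WL} S" "E (last WL) (last f)"
      "\<forall>u\<in>set WL. meets {u} S \<longrightarrow> u = hd WL" "\<forall>u\<in>set WL. E u (last f) \<longrightarrow> u = last WL"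
    by (rule conn_path_between[OF L(1) uL(1), of "\<lambda>u. meets {u} S" vL "\<lambda>u. E u (last f)"]) (use uL in auto)
  let ?w = "hd p" and ?k = "last WK" and ?l = "last WL"
  have m: "?w \<in> set p" "?k \<in> set WK" "?l \<in> set WL" using p(2) WK(2) WL(2) by auto
  have wA: "?w \<in> A" and kK: "?k \<in> K" and lL: "?l \<in> L" using m p(3) Z(2) WK(3) WL(3) by auto
  have pA: "set p \<subseteq> A" using p(3) Z(2) by blast
  \<comment> \<open>The base has its ends in \<open>K\<close> and \<open>L\<close> and not on
    \<open>f\<close>, because \<open>WK\<close> and \<open>WL\<close> lead from there to
    \<open>S\<close>.\<close>
  let ?b = "?k # f @ [?l]"
  have knf: "?k \<notin> set f" "?l \<notin> set f" using kK lL disf by auto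
  have klx: "?k \<noteq> ?l" "\<not> E ?k ?l" "\<not> E ?l ?k" using sepD[OF sep(3) kK lL] by auto
  have kf: "E ?k v \<longleftrightarrow> v = hd f" if "v \<in> set f" for v using K(4)[OF kK that] WK(5) by auto
  have lf: "E v ?l \<longleftrightarrow> v = last f" if "v \<in> set f" for v
    using L(4)[OF lL that] WL(5) E_commute[of v ?l] by auto
  have ipb: "ipath ?b"
  proof -
    have "ipath (f @ [?l])" using f(1) knf lf by (subst ipath_append) auto
    moreover have "hd (f @ [?l]) = hd f" using fne by simp
    ultimately show ?thesis using knf klx kf hlf by auto
  qed
  have bp: "set p \<inter> set ?b = {}"
  proof -
    have "x \<notin> set ?b" if "x \<in> set p" for x
    proof -
      have xA: "x \<in> A" using that pA by blast
      show ?thesis using disf(1) xA sepD[OF sep(1) xA kK] sepD[OF sep(2) xA lL] by auto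
    qed
    then show ?thesis by blast
  qed
  have pb: "v \<in> set f" if "u \<in> set p" "v \<in> set ?b" "E u v" for u v
  proof -
    have uA: "u \<in> A" using that(1) pA by blast
    show ?thesis using that(2,3) sepD[OF sep(1) uA kK] sepD[OF sep(2) uA lL] by auto
  qed
  have mpb: "meets (set p) (set ?b)" using p(2,5) last_in_set[OF p(2)] unfolding meets_def by auto
  \<comment> \<open>On the side of \<open>A\<close> the extension is the single vertex
    \<open>?w\<close>, which already has a neighbour in \<open>S\<close>.\<close>
  obtain k' P' Q' R' where T': "tripod k' P' Q' R'" "last P' = ?w" "last Q' = ?k" "last R' = ?l"
      "set P' \<union> set Q' \<union> set R' \<subseteq> S \<union> {?w} \<union> set WK \<union> set WL" "\<forall>x. k' = Some x \<longrightarrow> x \<in> S"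
    by (rule skinny_linked[OF sk sep(1-3) disS, of "[?w]" WK WL]) (use p(4) wA WK WL in auto)
  have T'': "tripod k' Q' R' P'" "set Q' \<union> set R' \<union> set P' \<subseteq> S \<union> {?w} \<union> set WK \<union> set WL"
    using T'(1,5) tripod_perm by blast+
  have kw: "?k \<noteq> ?w" "?l \<noteq> ?w" "\<not> E ?k ?w" "\<not> E ?l ?w"
    using sepD[OF sep(1) wA kK] sepD[OF sep(2) wA lL] by auto
  let ?X = "set ?b \<union> set p" and ?Y = "S \<union> {?w} \<union> set WK \<union> set WL"
  have fY: "x \<notin> ?Y" if "x \<in> set f" for x
  proof -
    have "x \<notin> S" using sepD[OF sep(4) _ that, of x] by blast
    moreover have "x \<notin> A" "x \<notin> K" "x \<notin> L" using that disf by auto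
    ultimately show ?thesis using wA WK(3) WL(3) by blast
  qed
  have pY: "x = ?w" if "x \<in> set p" "x \<in> ?Y" for x
  proof -
    have xA: "x \<in> A" using that(1) pA by blast
    then have "x \<notin> S" "x \<notin> K" "x \<notin> L"
      using disS(1) sepD[OF sep(1) xA, of x] sepD[OF sep(2) xA, of x] by auto
    then show ?thesis using that(2) WK(3) WL(3) by blast
  qed
  have XY: "?X \<inter> ?Y \<subseteq> {?k, ?l, ?w}"
  proof
    fix x assume x: "x \<in> ?X \<inter> ?Y"
    then consider "x \<in> {?k, ?l}" | "x \<in> set f" | "x \<in> set p" by auto
    then show "x \<in> {?k, ?l, ?w}" using fY pY x by cases blast+
  qed
  have cross: "u \<in> {?k, ?l, ?w} \<or> v \<in> {?k, ?l, ?w}" if uv: "u \<in> ?X" "v \<in> ?Y" "E u v" for u v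
  proof -
    consider "u \<in> {?k, ?l}" | "u \<in> set f" | "u \<in> set p" using uv(1) by auto
    then show ?thesis
    proof cases
      case 2
      have vu: "E v u" using uv(3) E_sym by blast
      consider "v \<in> S" | "v = ?w" | "v \<in> set WK" | "v \<in> set WL" using uv(2) by blast
      then show ?thesis
      proof cases
        case 1
        then show ?thesis using sepD[OF sep(4) 1 2] uv by blast
      next
        case 3
        then have "u = hd f" using K(4)[OF _ 2 vu] WK(3) by blast
        then show ?thesis using WK(7) 3 vu by blast
      next
        case 4
        then have "u = last f" using L(4)[OF _ 2 vu] WL(3) by blast
        then show ?thesis using WL(7) 4 vu by blast
      qed blast
    next
      case 3
      then have uA: "u \<in> A" using pA by blast
      consider "v \<in> S" | "v = ?w" | "v \<in> K" | "v \<in> L" using uv(2) WK(3) WL(3) by blast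
      then show ?thesis
      proof cases
        case 1
        then have "meets {u} S" using uv(3) unfolding meets_def by blast
        then show ?thesis using p(6) 3 by blast
      qed (use sepD[OF sep(1) uA] sepD[OF sep(2) uA] uv(3) in blast)+
    qed blast
  qed
  have SX: "x \<notin> ?X" if "x \<in> S" for x
  proof
    assume "x \<in> ?X"
    then have "x = ?k \<or> x = ?l \<or> x \<in> set f \<or> x \<in> set p" by auto
    then show False using that fY[of x] kK lL pA disS by blast
  qed
  have good: "meets {q} S \<longrightarrow> False"
    if "q \<in> set p" "a \<in> set ?b" "b \<in> set ?b" "a \<noteq> b" "\<not> E a b" "E q a" "E q b" for q a b
    using none that pb[OF that(1,2,6)] pb[OF that(1,3,7)] p(3) by blast
  have mw: "meets {?w} S" by (rule p(4))
  show False
  proof (rule attach[OF ipb _ conn_ipath[OF p(1,2)] bp m(1) mpb])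
    show "?b \<noteq> []" by simp
    fix k F G H
    assume T: "tripod k F G H" "last F = hd ?b" "last G = last ?b" "last H = ?w"
      and TX: "set F \<union> set G \<union> set H \<subseteq> set ?b \<union> set p"
      and out: "(\<exists>c J. k = Some c \<and> c \<in> set ?b \<and> ipath J \<and> J \<noteq> [] \<and> hd J = ?w \<and> set J \<subseteq> set p \<and>
          (\<forall>b\<in>set J. \<forall>a\<in>set ?b. E b a \<longleftrightarrow> b = last J \<and> a = c)) \<or>
        (\<exists>c. k = Some c \<and> c \<in> set p \<and> (\<exists>a\<in>set ?b. \<exists>b\<in>set ?b. a \<noteq> b \<and> \<not> E a b \<and> E c a \<and> E c b)) \<or>
        (k = None \<and> (\<exists>j\<in>set p. \<exists>a\<in>set ?b. \<exists>b\<in>set ?b. hd F = a \<and> hd G = b \<and> hd H = j \<and> E a b \<and>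
          (\<forall>v\<in>set ?b. E j v \<longleftrightarrow> v = a \<or> v = b)))"
    have lasts: "last F = ?k" "last G = ?l" using T(2,3) by auto
    \<comment> \<open>A centre on \<open>p\<close> has two nonadjacent neighbours on
      \<open>f\<close>, so by the assumption to be refuted it has no neighbour in
      \<open>S\<close>.\<close>
    have center: "c \<in> set f \<or> (c \<in> set p \<and> \<not> meets {c} S)" if k: "k = Some c" for c
    proof -
      consider J where "c \<in> set ?b" "J \<noteq> []" "set J \<subseteq> set p" "\<forall>b\<in>set J. \<forall>a\<in>set ?b. E b a \<longleftrightarrow> b = last J \<and> a = c"
        | a b where "c \<in> set p" "a \<in> set ?b" "b \<in> set ?b" "a \<noteq> b" "\<not> E a b" "E c a" "E c b"
        using out k by blast
      then show ?thesis
      proof cases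
        case 1
        have "last J \<in> set p" using 1(2,3) last_in_set by blast
        moreover have "E (last J) c" using 1(1,2,4) last_in_set by blast
        ultimately show ?thesis using pb 1(1) by blast
      next
        case 2
        then show ?thesis using good by blast
      qed
    qed
    show False
    proof (rule glue_sets[OF T(1) lasts T(4) TX T''(1) T'(3,4,2) T''(2) klx(1) kw(1,2) klx(2) kw(3,4) XY cross no])
      fix c c' assume c: "k = Some c" "k' = Some c'" "c = c' \<or> E c c'"
      have c'S: "c' \<in> S" using c(2) T'(6) by blast
      have cX: "c \<in> ?X" using center[OF c(1)] by auto
      then have "E c c'" using c(3) SX[OF c'S] by blast
      then have "meets {c} S" using c'S unfolding meets_def by blast
      then have "c \<in> set f" using center[OF c(1)] by blast
      then show False using sepD[OF sep(4) c'S] \<open>E c c'\<close> by blast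
    next
      fix c assume c: "k = Some c" "c \<in> {hd Q', hd R', hd P'}"
      then have "c \<in> set Q' \<union> set R' \<union> set P'" using tripod_nonempty[OF T''(1)] by auto
      then have "c \<in> ?Y" using T''(2) by blast
      then show False using center[OF c(1)] fY[of c] pY[of c] mw by blast
    next
      fix c assume c: "k' = Some c" "c \<in> {hd F, hd G, hd H}"
      then have "c \<in> set F \<union> set G \<union> set H" using tripod_nonempty[OF T(1)] by auto
      then have "c \<in> ?X" using TX by blast
      then show False using T'(6) c(1) SX by blast
    qed
  qed
qed

text \<open>
  The middles of \<open>f\<close> and \<open>g\<close> are attached to \<open>A\<close> and \<open>K\<close>. Glue the tripod formed by \<open>f\<close> and \<open>A\<close>
  to the one formed by \<open>g\<close>, \<open>K\<close> and \<open>L\<close>: their centres are too close only if one of them is an end of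
  \<open>f\<close> or \<open>g\<close>, and the leg leading to that end is the path \<open>J\<close>.
\<close>

lemma fat_pair:
  assumes f: "ipath f" "length f \<ge> 3" and g: "ipath g" "length g \<ge> 3"
    and sep: "sep A K" "sep A L" "sep K L" "sep (set f) (set g)"
    and disf: "A \<inter> set f = {}" "K \<inter> set f = {}" "L \<inter> set f = {}"
    and disg: "A \<inter> set g = {}" "K \<inter> set g = {}" "L \<inter> set g = {}"
    and conn: "conn A" "conn K" "conn L"
    and fK: "\<exists>u\<in>K. E u (hd f)" "\<And>u v. u \<in> K \<Longrightarrow> v \<in> set f \<Longrightarrow> E u v \<Longrightarrow> v = hd f"
    and fL: "\<exists>u\<in>L. E u (last f)" "\<And>u v. u \<in> L \<Longrightarrow> v \<in> set f \<Longrightarrow> E u v \<Longrightarrow> v = last f"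
    and fA: "meets A (set f)"
    and gA: "\<exists>u\<in>A. E u (hd g)" "\<And>u v. u \<in> A \<Longrightarrow> v \<in> set g \<Longrightarrow> E u v \<Longrightarrow> v = hd g"
    and gL: "\<exists>u\<in>L. E u (last g)" "\<And>u v. u \<in> L \<Longrightarrow> v \<in> set g \<Longrightarrow> E u v \<Longrightarrow> v = last g"
    and gK: "meets K (set g)"
    and no: "\<not> has_3pc"
  shows "(\<exists>J. ipath J \<and> J \<noteq> [] \<and> hd J = hd g \<and> set J \<subseteq> insert (hd g) A \<and>
      (\<forall>b\<in>set J. \<forall>a\<in>set f. E b a \<longleftrightarrow> b = last J \<and> a = hd f)) \<or>
    (\<exists>J. ipath J \<and> J \<noteq> [] \<and> hd J = hd f \<and> set J \<subseteq> insert (hd f) K \<and>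
      (\<forall>b\<in>set J. \<forall>a\<in>set g. E b a \<longleftrightarrow> b = last J \<and> a = hd g))"
proof (rule ccontr)
  assume none: "\<not> ?thesis"
  have ne: "f \<noteq> []" "g \<noteq> []" using f(2) g(2) by auto
  then have hl: "hd f \<in> set f" "last f \<in> set f" "hd g \<in> set g" "last g \<in> set g" by simp_all
  note ef = ipath_nonadj_ends[OF f]
  have fg: "x \<noteq> y \<and> \<not> E x y \<and> \<not> E y x" if "x \<in> set f" "y \<in> set g" for x y using sepD[OF sep(4) that] .
  have nf: "x \<notin> A \<and> x \<notin> K \<and> x \<notin> L" if "x \<in> set f" for x using disf that by auto
  have ng: "x \<notin> A \<and> x \<notin> K \<and> x \<notin> L" if "x \<in> set g" for x using disg that by auto
  \<comment> \<open>the base path of the second tripod: \<open>g\<close>, continued through \<open>L\<close> to the end of \<open>f\<close>\<close>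
  have "conn (insert (last g) L)"
    by (rule conn_insert[OF conn(3)]) (use gL(1) E_sym in blast)
  then have "conn (insert (last f) (insert (last g) L))"
    by (rule conn_insert) (use fL(1) E_sym in blast)
  then obtain w where w: "ipath w" "w \<noteq> []" "hd w = last g" "last w = last f" "set w \<subseteq> insert (last f) (insert (last g) L)"
    by (rule conn_path[of _ "last g" "last f"]) auto
  have wr: "rev w \<noteq> []" "last g = last (rev w)" "ipath (rev w)" using w by (simp_all add: last_rev)
  let ?h = "g @ tl w"
  have h_eq: "?h = join g (rev w)" by simp
  note hj = join_props[OF ne(2) wr(1,2)]
  have hset: "set ?h = set g \<union> set w" and hhd: "hd ?h = hd g" and hlast: "last ?h = last f" and hne: "?h \<noteq> []"
    using hj w by (simp_all add: hd_rev)
  have iph: "ipath ?h"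
    unfolding h_eq
  proof (rule ipath_join[OF g(1) wr(3) ne(2) wr(1,2)])
    show "set g \<inter> set (rev w) \<subseteq> {last g}"
      using w(5) fg[OF hl(2)] ng by auto
    fix u v assume uv: "u \<in> set g" "v \<in> set (rev w)" "E u v"
    then have "v = last f \<or> v = last g \<or> v \<in> L" using w(5) by auto
    then show "u = last g \<or> v = last g" using uv fg[OF hl(2) uv(1)] gL(2)[OF _ uv(1)] E_sym by blast
  qed
  have hsub: "x \<in> set g \<or> x \<in> L \<or> x = last f" if "x \<in> set ?h" for x
    using that w(5) hl unfolding hset by blast
  \<comment> \<open>The remaining legs reach \<open>hd g\<close> from \<open>f\<close> through
    \<open>A\<close>, and \<open>hd f\<close> from \<open>?h\<close> through \<open>K\<close>. Both
    tripods then have the ends \<open>hd f\<close>, \<open>last f\<close> and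
    \<open>hd g\<close>.\<close>
  let ?Z = "insert (hd g) A" and ?Z' = "insert (hd f) K"
  have connZ: "conn ?Z" by (rule conn_insert[OF conn(1)]) (use gA(1) E_sym in blast)
  have connZ': "conn ?Z'" by (rule conn_insert[OF conn(2)]) (use fK(1) E_sym in blast)
  have Zf: "?Z \<inter> set f = {}" using disf(1) fg hl(3) by blast
  have Zh: "?Z' \<inter> set ?h = {}"
  proof -
    have "x \<notin> ?Z'" if "x \<in> set ?h" for x
      using hsub[OF that] ng[of x] nf[OF hl(1)] nf[OF hl(2)] fg[OF hl(1), of x] ef(2) sepD[OF sep(3), of x x] by blast
    then show ?thesis by blast
  qed
  have mZ: "meets ?Z (set f)" using fA unfolding meets_def by blast
  have mZ': "meets ?Z' (set ?h)" using gK unfolding meets_def hset by blast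
  have Zadj: "z \<in> A" if "z \<in> ?Z" "a \<in> set f" "E z a" for z a using that fg[OF that(2) hl(3)] by auto
  have Zadj': "z \<in> K \<and> a \<in> set g" if "z \<in> ?Z'" "a \<in> set ?h" "E z a" for z a
  proof -
    have z: "z \<in> K"
    proof (rule ccontr)
      assume "z \<notin> K"
      then have "z = hd f" using that(1) by blast
      then show False
        using hsub[OF that(2)] that(3) fg[OF hl(1), of a] fL(2)[OF _ hl(1), of a] ef E_sym by blast
    qed
    then show ?thesis
      using hsub[OF that(2)] that(3) sepD[OF sep(3) z] fK(2)[OF z hl(2)] ef(2) by metis
  qed
  let ?X = "set f \<union> ?Z" and ?Y = "set ?h \<union> ?Z'"
  let ?a = "hd f" and ?b = "last f" and ?c = "hd g"
  have n: "?a \<noteq> ?b" "?a \<noteq> ?c" "?b \<noteq> ?c" "\<not> E ?a ?b" "\<not> E ?a ?c" "\<not> E ?b ?c"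
    using ef fg[OF hl(1,3)] fg[OF hl(2,3)] by auto
  have XY: "?X \<inter> ?Y \<subseteq> {?a, ?b, ?c}"
  proof
    fix x assume x: "x \<in> ?X \<inter> ?Y"
    then have "x \<in> set f \<or> x \<in> A \<or> x = ?c" "x \<in> set g \<or> x \<in> L \<or> x = ?b \<or> x \<in> K \<or> x = ?a"
      using hsub[of x] by blast+
    then show "x \<in> {?a, ?b, ?c}"
      using nf[of x] ng[of x] fg[of x x] sepD[OF sep(1), of x x] sepD[OF sep(2), of x x] by blast
  qed
  have cross: "u \<in> {?a, ?b, ?c} \<or> v \<in> {?a, ?b, ?c}" if uv: "u \<in> ?X" "v \<in> ?Y" "E u v" for u v
  proof -
    have vu: "E v u" using uv(3) E_sym by blast
    have v: "v \<in> set g \<or> v \<in> L \<or> v = ?b \<or> v \<in> K \<or> v = ?a" using uv(2) hsub[of v] by blast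
    consider "u \<in> set f" | "u \<in> A" | "u = ?c" using uv(1) by blast
    then show ?thesis
    proof cases
      case 1
      then show ?thesis using v uv(3) fg[OF 1, of v] fL(2)[OF _ 1 vu] fK(2)[OF _ 1 vu] by blast
    next
      case 2
      then show ?thesis using v uv(3) gA(2)[OF 2, of v] sepD[OF sep(1) 2, of v] sepD[OF sep(2) 2, of v] by blast
    qed blast
  qed
  have disj: "x \<notin> set g \<union> K" if "x \<in> set f \<union> A" for x
    using that nf[of x] ng[of x] fg[of x x] sepD[OF sep(1), of x x] by blast
  show False
  proof (rule attach[OF f(1) ne(1) connZ Zf _ mZ])
    show "?c \<in> ?Z" by simp
    fix k F G H
    assume T: "tripod k F G H" "last F = ?a" "last G = ?b" "last H = ?c"
      and TX: "set F \<union> set G \<union> set H \<subseteq> ?X"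
      and out: "(\<exists>c J. k = Some c \<and> c \<in> set f \<and> ipath J \<and> J \<noteq> [] \<and> hd J = ?c \<and> set J \<subseteq> ?Z \<and>
          (\<forall>b\<in>set J. \<forall>a\<in>set f. E b a \<longleftrightarrow> b = last J \<and> a = c)) \<or>
        (\<exists>c. k = Some c \<and> c \<in> ?Z \<and> (\<exists>a\<in>set f. \<exists>b\<in>set f. a \<noteq> b \<and> \<not> E a b \<and> E c a \<and> E c b)) \<or>
        (k = None \<and> (\<exists>j\<in>?Z. \<exists>a\<in>set f. \<exists>b\<in>set f. hd F = a \<and> hd G = b \<and> hd H = j \<and> E a b \<and>
          (\<forall>v\<in>set f. E j v \<longleftrightarrow> v = a \<or> v = b)))"
    have cen: "c \<in> A \<or> (c \<in> set f \<and> c \<noteq> ?a)" if k: "k = Some c" for c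
    proof -
      from k out consider J where "c \<in> set f" "ipath J" "J \<noteq> []" "hd J = ?c" "set J \<subseteq> ?Z"
          "\<forall>b\<in>set J. \<forall>a\<in>set f. E b a \<longleftrightarrow> b = last J \<and> a = c"
        | a where "c \<in> ?Z" "a \<in> set f" "E c a" by blast
      then show ?thesis
      proof cases
        case 1
        \<comment> \<open>With centre \<open>hd f\<close>, the leg \<open>J\<close> is the first
          alternative of the claim.\<close>
        have "c \<noteq> ?a"
        proof
          assume "c = ?a"
          then show False using none 1 by blast
        qed
        then show ?thesis using 1(1) by blast
      next
        case 2
        then show ?thesis using Zadj by blast
      qed
    qed
    have tri: "{hd F, hd G, hd H} \<subseteq> set f \<union> A" if k: "k = None"
    proof -
      obtain j a b where j: "j \<in> ?Z" "a \<in> set f" "b \<in> set f" "hd F = a" "hd G = b" "hd H = j"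
          "\<forall>v\<in>set f. E j v \<longleftrightarrow> v = a \<or> v = b" using k out by auto
      then have "j \<in> A" using Zadj[of j a] by blast
      then show ?thesis using j by simp
    qed
    show False
    proof (rule attach[OF iph hne connZ' Zh _ mZ'])
      show "?a \<in> ?Z'" by simp
      fix k' F' G' H'
      assume T': "tripod k' F' G' H'" "last F' = hd ?h" "last G' = last ?h" "last H' = ?a"
        and TY: "set F' \<union> set G' \<union> set H' \<subseteq> ?Y"
        and out': "(\<exists>c J. k' = Some c \<and> c \<in> set ?h \<and> ipath J \<and> J \<noteq> [] \<and> hd J = ?a \<and> set J \<subseteq> ?Z' \<and>
            (\<forall>b\<in>set J. \<forall>a\<in>set ?h. E b a \<longleftrightarrow> b = last J \<and> a = c)) \<or>
          (\<exists>c. k' = Some c \<and> c \<in> ?Z' \<and> (\<exists>a\<in>set ?h. \<exists>b\<in>set ?h. a \<noteq> b \<and> \<not> E a b \<and> E c a \<and> E c b)) \<or>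
          (k' = None \<and> (\<exists>j\<in>?Z'. \<exists>a\<in>set ?h. \<exists>b\<in>set ?h. hd F' = a \<and> hd G' = b \<and> hd H' = j \<and> E a b \<and>
            (\<forall>v\<in>set ?h. E j v \<longleftrightarrow> v = a \<or> v = b)))"
      have cen': "c \<in> K \<or> (c \<in> set g \<and> c \<noteq> ?c)" if k: "k' = Some c" for c
      proof -
        from k out' consider J where "c \<in> set ?h" "ipath J" "J \<noteq> []" "hd J = ?a" "set J \<subseteq> ?Z'"
            "\<forall>b\<in>set J. \<forall>a\<in>set ?h. E b a \<longleftrightarrow> b = last J \<and> a = c"
          | a where "c \<in> ?Z'" "a \<in> set ?h" "E c a" by blast
        then show ?thesis
        proof cases
          case 1
          have "last J \<in> ?Z'" using 1(3,5) last_in_set by blast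
          moreover have "E (last J) c" using 1(1,3,6) last_in_set by blast
          ultimately have "c \<in> set g" using Zadj' 1(1) by blast
          moreover have "c \<noteq> ?c"
          proof
            assume c: "c = ?c"
            have "\<forall>b\<in>set J. \<forall>a\<in>set g. E b a \<longleftrightarrow> b = last J \<and> a = ?c"
              using 1(6) unfolding hset c by blast
            then show False using none 1(2-5) by blast
          qed
          ultimately show ?thesis by blast
        next
          case 2
          then show ?thesis using Zadj' by blast
        qed
      qed
      have tri': "{hd H', hd G', hd F'} \<subseteq> set g \<union> K" if k: "k' = None"
      proof -
        obtain j a b where j: "j \<in> ?Z'" "a \<in> set ?h" "b \<in> set ?h" "hd F' = a" "hd G' = b" "hd H' = j"
            "\<forall>v\<in>set ?h. E j v \<longleftrightarrow> v = a \<or> v = b" using k out' by blast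
        then have "j \<in> K" "a \<in> set g" "b \<in> set g" using Zadj'[of j a] Zadj'[of j b] by blast+
        then show ?thesis using j by simp
      qed
      have T'': "tripod k' H' G' F'" "set H' \<union> set G' \<union> set F' \<subseteq> ?Y"
        using T'(1) TY tripod_perm by blast+
      have lasts: "last F' = ?c" "last G' = ?b" using T'(2,3) hhd hlast by auto
      show False
      proof (rule glue_sets[OF T TX T''(1) T'(4) lasts(2,1) T''(2) n XY cross no])
        fix c c' assume c: "k = Some c" "k' = Some c'" "c = c' \<or> E c c'"
        \<comment> \<open>Neither centre is an end \<open>hd f\<close> or \<open>hd g\<close>, and
          these are the only places where \<open>K\<close> sees \<open>f\<close> or \<open>A\<close>
          sees \<open>g\<close>; so the centres cannot be adjacent.\<close>
        have E: "E c c'" using c(3) cen[OF c(1)] cen'[OF c(2)] disj[of c] by blast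
        have E': "E c' c" using E E_sym by blast
        from cen[OF c(1)] cen'[OF c(2)] show False
          using E E' sepD[OF sep(1), of c c'] fg[of c c'] gA(2)[of c c'] fK(2)[of c' c] by blast
      next
        fix c assume c: "k = Some c" "k' = None" "c \<in> {hd H', hd G', hd F'}"
        then show False using cen[OF c(1)] tri'[OF c(2)] disj[of c] by blast
      next
        fix c assume c: "k = None" "k' = Some c" "c \<in> {hd F, hd G, hd H}"
        then show False using cen'[OF c(2)] tri[OF c(1)] disj[of c] by blast
      qed
    qed
  qed
qed


section \<open>Two fat sets with the same middle\<close>

definition att :: "'a set \<Rightarrow> 'a list \<Rightarrow> 'a \<Rightarrow> bool" where
  "att A f x \<longleftrightarrow> A \<inter> set f = {} \<and> (\<exists>u\<in>A. E u x) \<and> (\<forall>u\<in>A. \<forall>v\<in>set f. E u v \<longrightarrow> v = x)"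

lemma att_disj: "att A f x \<Longrightarrow> v \<in> set f \<Longrightarrow> v \<notin> A"
  unfolding att_def by blast

lemma att_edge: "att A f x \<Longrightarrow> u \<in> A \<Longrightarrow> v \<in> set f \<Longrightarrow> E u v \<or> E v u \<Longrightarrow> v = x"
  unfolding att_def using E_sym by blast

lemma att_ex: "att A f x \<Longrightarrow> \<exists>u\<in>A. E x u"
  unfolding att_def using E_sym by blast

lemma att_rev [simp]: "att A (rev f) x \<longleftrightarrow> att A f x"
  unfolding att_def by simp

text \<open>Three parallel paths from \<open>A\<close> to \<open>C\<close>. In the application
  \<open>f\<close> and \<open>g\<close> are fat sets with a common middle, and \<open>r\<close> runs
  through a third connector, where it may be as short as one vertex.\<close>

definition link3 :: "'a set \<Rightarrow> 'a set \<Rightarrow> 'a list \<Rightarrow> 'a list \<Rightarrow> 'a list \<Rightarrow> bool" where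
  "link3 A C f g r \<longleftrightarrow> ipath f \<and> length f \<ge> 3 \<and> ipath g \<and> length g \<ge> 3 \<and> ipath r \<and> r \<noteq> [] \<and>
    sep (set f) (set g) \<and> sep (set f) (set r) \<and> sep (set g) (set r) \<and>
    conn A \<and> conn C \<and> sep A C \<and>
    att A f (hd f) \<and> att A g (hd g) \<and> att A r (hd r) \<and>
    att C f (last f) \<and> att C g (last g) \<and> att C r (last r)"

lemma link3_rev: "link3 A C f g r \<Longrightarrow> link3 C A (rev f) (rev g) (rev r)"
  unfolding link3_def by (auto simp: hd_rev last_rev sep_sym)

text \<open>A tripod on the side of \<open>A\<close>, lengthened along the three paths, is glued to
  one on the side of \<open>C\<close>. The heads of \<open>f\<close> and \<open>g\<close> are
  neither on the other side nor adjacent to it, as these paths have three vertices. So the two sides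
  come close only along \<open>r\<close>, which bounds \<open>r\<close> and keeps the centre of the
  first tripod in \<open>A\<close> or at \<open>hd r\<close>.\<close>

lemma link3_tripod:
  assumes "link3 A C f g r" and no: "\<not> has_3pc"
  obtains k F G H where "tripod k F G H" "last F = hd f" "last G = hd g" "last H = hd r"
    "set F \<union> set G \<union> set H \<subseteq> A \<union> {hd f, hd g, hd r}" "length r \<le> 2"
    "\<forall>c. k = Some c \<longrightarrow> c \<in> insert (hd r) A" "k = None \<longrightarrow> {hd F, hd G, hd H} \<subseteq> insert (hd r) A"
proof -
  have f: "ipath f" "length f \<ge> 3" and g: "ipath g" "length g \<ge> 3" and r: "ipath r" "r \<noteq> []"
    and sep: "sep (set f) (set g)" "sep (set f) (set r)" "sep (set g) (set r)" "sep A C"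
    and conn: "conn A" "conn C"
    and A: "att A f (hd f)" "att A g (hd g)" "att A r (hd r)"
    and C: "att C f (last f)" "att C g (last g)" "att C r (last r)"
    using assms(1) unfolding link3_def by auto
  have ne: "f \<noteq> []" "g \<noteq> []" using f(2) g(2) by auto
  then have hl: "hd f \<in> set f" "last f \<in> set f" "hd g \<in> set g" "last g \<in> set g" "hd r \<in> set r" "last r \<in> set r"
    using r(2) by simp_all
  note ef = ipath_nonadj_ends[OF f] and eg = ipath_nonadj_ends[OF g]
  note fg = sepD[OF sep(1)] and fr = sepD[OF sep(2)] and gr = sepD[OF sep(3)] and AC = sepD[OF sep(4)]
  let ?X = "insert (hd f) (insert (hd g) (insert (hd r) A))"
  let ?Y = "insert (last f) (insert (last g) (insert (last r) C))"
  have cX: "conn ?X"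
    by (intro conn_insert[OF conn_insert[OF conn_insert[OF conn(1)]]]) (use att_ex[OF A(1)] att_ex[OF A(2)] att_ex[OF A(3)] in blast)+
  have cY: "conn ?Y"
    by (intro conn_insert[OF conn_insert[OF conn_insert[OF conn(2)]]]) (use att_ex[OF C(1)] att_ex[OF C(2)] att_ex[OF C(3)] in blast)+
  have nd: "hd r \<noteq> hd f" "hd r \<noteq> hd g" "last r \<noteq> last f" "last r \<noteq> last g" "last f \<noteq> last g"
    "\<not> E (last f) (last g)" "\<not> E (last f) (last r)" "\<not> E (last g) (last r)"
    using fr[OF hl(1,5)] gr[OF hl(3,5)] fr[OF hl(2,6)] gr[OF hl(4,6)] fg[OF hl(2,4)] by auto
  obtain k F G H where T: "tripod k F G H" "last F = hd f" "last G = hd g" "last H = hd r"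
      "set F \<union> set G \<union> set H \<subseteq> ?X"
    by (rule tripod_exists[OF cX, of "hd f" "hd g" "hd r"]) (use nd in auto)
  obtain k' F' G' H' where T': "tripod k' F' G' H'" "last F' = last f" "last G' = last g" "last H' = last r"
      "set F' \<union> set G' \<union> set H' \<subseteq> ?Y"
    by (rule tripod_exists[OF cY, of "last f" "last g" "last r"]) (use nd in auto)
  note N = tripod_nonempty[OF T(1)] and N' = tripod_nonempty[OF T'(1)]
  let ?F = "F @ tl f" and ?G = "G @ tl g" and ?H = "H @ tl r"
  have 1: "tripod k ?F G H \<and> last ?F = last f \<and> set ?F \<union> set G \<union> set H \<subseteq> A \<union> set f \<union> {hd g, hd r}"
  proof (rule leg_extend[OF T(1) _ f(1) ne(1) T(2)[symmetric]])
    show "set F \<union> set G \<union> set H \<subseteq> insert (last F) A \<union> {hd g, hd r}" unfolding T(2) using T(5) by blast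
    show "set f \<inter> A = {}" using att_disj[OF A(1)] by blast
    show "sep (set f) {hd g, hd r}" using fg[OF _ hl(3)] fr[OF _ hl(5)] unfolding sep_def by blast
    show "w = hd f" if "w \<in> set f" "meets {w} A" for w
      using that att_edge[OF A(1) _ that(1)] unfolding meets_def by blast
  qed
  have 2: "tripod k ?G ?F H \<and> last ?G = last g \<and> set ?G \<union> set ?F \<union> set H \<subseteq> A \<union> set g \<union> (set f \<union> {hd r})"
  proof (rule leg_extend[OF _ _ g(1) ne(2) T(3)[symmetric]])
    show "tripod k G ?F H" using 1 tripod_perm(1) by blast
    show "set G \<union> set ?F \<union> set H \<subseteq> insert (last G) A \<union> (set f \<union> {hd r})" unfolding T(3) using 1 by blast
    show "set g \<inter> A = {}" using att_disj[OF A(2)] by blast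
    show "sep (set g) (set f \<union> {hd r})" using fg gr[OF _ hl(5)] unfolding sep_def by blast
    show "w = hd g" if "w \<in> set g" "meets {w} A" for w
      using that att_edge[OF A(2) _ that(1)] unfolding meets_def by blast
  qed
  have 3: "tripod k ?H ?F ?G \<and> last ?H = last r \<and> set ?H \<union> set ?F \<union> set ?G \<subseteq> A \<union> set r \<union> (set f \<union> set g)"
  proof (rule leg_extend[OF _ _ r(1,2) T(4)[symmetric]])
    show "tripod k H ?F ?G" using 2 tripod_perm by blast
    show "set H \<union> set ?F \<union> set ?G \<subseteq> insert (last H) A \<union> (set f \<union> set g)" unfolding T(4) using 2 by blast
    show "set r \<inter> A = {}" using att_disj[OF A(3)] by blast
    show "sep (set r) (set f \<union> set g)" using fr gr unfolding sep_def by blast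
    show "w = hd r" if "w \<in> set r" "meets {w} A" for w
      using that att_edge[OF A(3) _ that(1)] unfolding meets_def by blast
  qed
  have T2: "tripod k ?F ?G ?H" "last ?F = last f" "last ?G = last g" "last ?H = last r"
    "set ?F \<union> set ?G \<union> set ?H \<subseteq> A \<union> set f \<union> set g \<union> set r"
    using 1 2 3 tripod_perm by blast+
  have hds: "hd ?F = hd F" "hd ?G = hd G" "hd ?H = hd H" using N by simp_all
  have cross: "u \<in> {last f, last g, last r} \<or> v \<in> {last f, last g, last r}"
    if "u \<in> A \<union> set f \<union> set g \<union> set r" "v \<in> ?Y" "E u v" for u v
    using that AC[of u v] att_edge[OF C(1), of v u] att_edge[OF C(2), of v u] att_edge[OF C(3), of v u] by blast
  have XY: "(A \<union> set f \<union> set g \<union> set r) \<inter> ?Y \<subseteq> {last f, last g, last r}"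
    using AC att_disj[OF C(1)] att_disj[OF C(2)] att_disj[OF C(3)] by blast
  have one: "length r \<le> 2" if "hd r = last r \<or> E (hd r) (last r)"
    using that
  proof
    assume "hd r = last r"
    then have "r = [hd r]" by (rule ipath_singleton_ends[OF r])
    then have "length r = length [hd r]" by simp
    then show ?thesis by simp
  next
    assume "E (hd r) (last r)"
    then have "r = [hd r, last r]" by (rule ipath_adj_ends[OF r])
    then have "length r = length [hd r, last r]" by simp
    then show ?thesis by simp
  qed
  have far: "\<not> (x = y \<or> E x y)" if "x \<in> {hd f, hd g}" "y \<in> ?Y" for x y
  proof -
    have "x = hd f \<or> x = hd g" "y = last f \<or> y = last g \<or> y = last r \<or> y \<in> C" using that by auto
    then show ?thesis
      using ef eg fg[OF hl(1,4)] fg[OF hl(2,3)] fr[OF hl(1,6)] gr[OF hl(3,6)]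
        att_edge[OF C(1) _ hl(1)] att_edge[OF C(2) _ hl(3)] att_disj[OF C(1) hl(1)] att_disj[OF C(2) hl(3)]
      by metis
  qed
  \<comment> \<open>A vertex of \<open>A\<close> can be on or next to the other side only at a
    one-vertex \<open>r\<close>; for \<open>hd r\<close> itself, two vertices are possible.\<close>
  have farA: "(x \<in> A \<longrightarrow> hd r = last r)" "hd r = last r \<or> E (hd r) (last r)"
    if x: "x \<in> insert (hd r) A" "y \<in> ?Y" "x = y \<or> E x y" for x y
  proof -
    have y: "y = last f \<or> y = last g \<or> y = last r \<or> y \<in> C" using x(2) by auto
    have a: "hd r = last r" if "x \<in> A"
      using y x(3) that ef(2) eg(2) AC[OF that, of y] att_edge[OF A(1) that hl(2)] att_edge[OF A(2) that hl(4)]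
        att_edge[OF A(3) that hl(6)] att_disj[OF A(1) hl(2)] att_disj[OF A(2) hl(4)] att_disj[OF A(3) hl(6)]
      by metis
    then show "x \<in> A \<longrightarrow> hd r = last r" by blast
    show "hd r = last r \<or> E (hd r) (last r)"
    proof (cases "x \<in> A")
      case False
      then have "x = hd r" using x(1) by blast
      then show ?thesis
        using y x(3) fr[OF hl(2,5)] gr[OF hl(4,5)] att_edge[OF C(3) _ hl(5), of y] att_disj[OF C(3) hl(5)] by metis
    qed (use a in blast)
  qed
  show thesis
  proof (rule glue_sets[OF T2 T' nd(5) nd(3)[symmetric] nd(4)[symmetric] nd(6-8) XY cross no])
    fix c c' assume c: "k = Some c" "k' = Some c'" "c = c' \<or> E c c'"
    have "c \<in> set F" using T(1) c(1) N unfolding c(1) by (auto simp: claw_def arm_def)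
    then have cX: "c \<in> ?X" using T(5) by blast
    have "c' \<in> set F'" using T'(1) N' unfolding c(2) by (auto simp: claw_def arm_def)
    then have cY: "c' \<in> ?Y" using T'(5) by blast
    have cA: "c \<in> insert (hd r) A" using far[of c c'] cX cY c(3) by blast
    show thesis
      by (rule that[OF T(1-4)]) (use T(5) c(1) cA one[OF farA(2)[OF cA cY c(3)]] in auto)
  next
    fix c assume c: "k = Some c" "k' = None" "c \<in> {hd F', hd G', hd H'}"
    have "c \<in> set F" using T(1) c(1) N unfolding c(1) by (auto simp: claw_def arm_def)
    then have cX: "c \<in> ?X" using T(5) by blast
    have "c \<in> set F' \<union> set G' \<union> set H'" using c(3) N' by auto
    then have cY: "c \<in> ?Y" using T'(5) by blast
    have cA: "c \<in> insert (hd r) A" using far[of c c] cX cY by blast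
    show thesis
      by (rule that[OF T(1-4)]) (use T(5) c(1) cA one[OF farA(2)[OF cA cY disjI1[OF refl]]] in auto)
  next
    fix c assume c: "k = None" "k' = Some c" "c \<in> {hd ?F, hd ?G, hd ?H}"
    have c3: "c \<in> {hd F, hd G, hd H}" using c(3) unfolding hds .
    have sub: "{hd F, hd G, hd H} \<subseteq> ?X" using T(5) N hd_in_set by blast
    have "c \<in> set F'" using T'(1) N' unfolding c(2) by (auto simp: claw_def arm_def)
    then have cY: "c \<in> ?Y" using T'(5) by blast
    have cA: "c \<in> insert (hd r) A" using far[of c c] sub c3 cY by blast
    \<comment> \<open>A corner that lies on both sides can only be \<open>hd r\<close>. The other
      two corners are adjacent to it, and therefore differ from \<open>hd f\<close> and
      \<open>hd g\<close>.\<close>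
    have "c = hd r"
      using farA(1)[OF cA cY disjI1[OF refl]] cA cY att_disj[OF A(3) hl(6)] att_disj[OF A(1) hl(2)]
        att_disj[OF A(2) hl(4)] AC[of c c] by auto
    have net: "net F G H" using T(1) c(1) by simp
    have adj: "E (hd F) (hd G)" "E (hd F) (hd H)" "E (hd G) (hd H)"
      using net N unfolding net_def by (meson corner_edge hd_in_set)+
    have near: "x = hd r \<or> E x (hd r)" if "x \<in> {hd F, hd G, hd H}" for x
      using that c3 adj E_sym unfolding \<open>c = hd r\<close> by auto
    have corners: "x \<in> insert (hd r) A" if "x \<in> {hd F, hd G, hd H}" for x
    proof -
      have "x \<in> ?X" using sub that by (rule subsetD)
      moreover have "x \<noteq> hd f \<and> x \<noteq> hd g"
        using near[OF that] fr[OF hl(1,5)] gr[OF hl(3,5)] by auto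
      ultimately show ?thesis by simp
    qed
    have "{hd F, hd G, hd H} \<subseteq> insert (hd r) A" by (rule subsetI) (rule corners)
    then show thesis
      by (intro that[OF T(1-4)]) (use T(5) c(1) one[OF farA(2)[OF cA cY disjI1[OF refl]]] in auto)
  qed
qed

text \<open>Two tripods with ends \<open>hd f\<close>, \<open>last f\<close> and
  \<open>hd g\<close>. The first comes from \<open>link3_tripod\<close>, its third leg continued
  through \<open>r\<close> and \<open>C\<close> to \<open>last f\<close>. The second has base
  \<open>f\<close> and reaches \<open>hd g\<close> through \<open>M\<close> and part of
  \<open>g\<close>. A claw centre of the first lies in \<open>A\<close> or at \<open>hd r\<close>,
  one of the second in \<open>M\<close> or on \<open>f\<close>; they can be close only if the latter
  is \<open>hd f\<close>, and then \<open>J\<close> is its third leg.\<close>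

lemma link3_middle:
  assumes l: "link3 A C f g r" and no: "\<not> has_3pc"
    and M: "conn M" "sep A M" "sep C M" "sep (set r) M" "M \<inter> set f = {}" "M \<inter> set g = {}"
    and Mf: "meets M (set f)" and Mg: "m \<in> M" "v \<in> set g" "v \<noteq> last g" "E m v"
  obtains J where "ipath J" "J \<noteq> []" "hd J = hd g" "set J \<subseteq> M \<union> set g"
    "\<forall>b\<in>set J. \<forall>a\<in>set f. E b a \<longleftrightarrow> b = last J \<and> a = hd f"
proof (rule ccontr)
  assume "\<not> thesis"
  then have none: "False" if "ipath J" "J \<noteq> []" "hd J = hd g" "set J \<subseteq> M \<union> set g"
    "\<forall>b\<in>set J. \<forall>a\<in>set f. E b a \<longleftrightarrow> b = last J \<and> a = hd f" for J
    using that \<open>\<And>J. \<lbrakk>ipath J; J \<noteq> []; hd J = hd g; set J \<subseteq> M \<union> set g;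
      \<forall>b\<in>set J. \<forall>a\<in>set f. E b a \<longleftrightarrow> b = last J \<and> a = hd f\<rbrakk> \<Longrightarrow> thesis\<close> by blast
  have f: "ipath f" "length f \<ge> 3" and g: "ipath g" "length g \<ge> 3" and r: "ipath r" "r \<noteq> []"
    and sep: "sep (set f) (set g)" "sep (set f) (set r)" "sep (set g) (set r)" "sep A C"
    and conn: "conn A" "conn C"
    and A: "att A f (hd f)" "att A g (hd g)" "att A r (hd r)"
    and C: "att C f (last f)" "att C g (last g)" "att C r (last r)"
    using l unfolding link3_def by auto
  have ne: "f \<noteq> []" "g \<noteq> []" using f(2) g(2) by auto
  then have hl: "hd f \<in> set f" "last f \<in> set f" "hd g \<in> set g" "last g \<in> set g" "hd r \<in> set r" "last r \<in> set r"
    using r(2) by simp_all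
  note ef = ipath_nonadj_ends[OF f] and eg = ipath_nonadj_ends[OF g]
  note fg = sepD[OF sep(1)] and fr = sepD[OF sep(2)] and gr = sepD[OF sep(3)] and AC = sepD[OF sep(4)]
  note AM = sepD[OF M(2)] and CM = sepD[OF M(3)] and rM = sepD[OF M(4)]
  obtain k F G H where T: "tripod k F G H" "last F = hd f" "last G = hd g" "last H = hd r"
    "set F \<union> set G \<union> set H \<subseteq> A \<union> {hd f, hd g, hd r}"
    "\<forall>c. k = Some c \<longrightarrow> c \<in> insert (hd r) A" "k = None \<longrightarrow> {hd F, hd G, hd H} \<subseteq> insert (hd r) A"
    using link3_tripod[OF l no] by metis
  note N = tripod_nonempty[OF T(1)]
  have "conn (set r \<union> C)"
    by (rule conn_union[OF conn_ipath[OF r] conn(2)]) (use att_ex[OF C(3)] hl(6) in \<open>auto simp: meets_def\<close>)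
  then have "conn (insert (last f) (set r \<union> C))"
    by (rule conn_insert) (use att_ex[OF C(1)] in blast)
  then obtain W where W: "ipath W" "W \<noteq> []" "hd W = hd r" "last W = last f" "set W \<subseteq> insert (last f) (set r \<union> C)"
    by (rule conn_path[of _ "hd r" "last f"]) (use hl in auto)
  have Wsub: "x = last f \<or> x \<in> set r \<or> x \<in> C" if "x \<in> set W" for x using W(5) that by blast
  let ?H = "H @ tl W"
  have 1: "tripod k ?H F G \<and> last ?H = last W \<and> set ?H \<union> set F \<union> set G \<subseteq> A \<union> set W \<union> {hd f, hd g}"
  proof (rule leg_extend[OF _ _ W(1,2)])
    show "tripod k H F G" using T(1) tripod_perm by blast
    show "set H \<union> set F \<union> set G \<subseteq> insert (last H) A \<union> {hd f, hd g}" unfolding T(4) using T(5) by blast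
    show "hd W = last H" using W(3) T(4) by simp
    have "x \<notin> A" if "x \<in> set W" for x
      using Wsub[OF that] att_disj[OF A(1) hl(2)] att_disj[OF A(3), of x] AC[of x x] by blast
    then show "set W \<inter> A = {}" by blast
    have "x \<noteq> hd f \<and> \<not> E x (hd f) \<and> x \<noteq> hd g \<and> \<not> E x (hd g)" if "x \<in> set W" for x
      using Wsub[OF that]
    proof (elim disjE)
      assume x: "x = last f"
      show ?thesis unfolding x using ef fg[OF hl(2,3)] E_sym by metis
    next
      assume "x \<in> set r"
      then show ?thesis using fr[OF hl(1)] gr[OF hl(3)] by blast
    next
      assume x: "x \<in> C"
      have "hd g \<noteq> last g" "hd f \<noteq> last f" using eg(2) ef(2) by auto
      then show ?thesis
        using att_edge[OF C(1) x hl(1)] att_edge[OF C(2) x hl(3)] att_disj[OF C(1) hl(1)] att_disj[OF C(2) hl(3)] x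
        by blast
    qed
    then show "sep (set W) {hd f, hd g}" unfolding sep_def by blast
    show "w = hd W" if w: "w \<in> set W" "meets {w} A" for w
    proof -
      obtain u where u: "u \<in> A" "E w u" using w(2) unfolding meets_def by blast
      show ?thesis
        using Wsub[OF w(1)] att_edge[OF A(1) u(1) hl(2)] att_edge[OF A(3) u(1), of w] ef(2) u(2) AC[OF u(1), of w] W(3)
        by metis
    qed
  qed
  let ?D = "A \<union> set r \<union> C \<union> {hd f, last f, hd g}"
  have TD: "tripod k F ?H G" "last ?H = last f" "set F \<union> set ?H \<union> set G \<subseteq> ?D"
  proof -
    show "tripod k F ?H G" using 1 tripod_perm by blast
    show "last ?H = last f" using 1 W(4) by simp
    show "set F \<union> set ?H \<union> set G \<subseteq> ?D" using 1 W(5) by blast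
  qed
  have hdH: "hd ?H = hd H" using N by simp
  \<comment> \<open>\<open>last g\<close> is left out because the continued leg runs through
    \<open>C\<close>, which sees it. The contact \<open>v\<close> with \<open>M\<close> survives, as
    it differs from \<open>last g\<close>.\<close>
  obtain g0 where g0: "g = g0 @ [last g]" using ne(2) by (metis append_butlast_last_id)
  have g0': "ipath g0" "g0 \<noteq> []" "hd g0 = hd g" "last g \<notin> set g0" "set g0 \<subseteq> set g"
  proof -
    have "ipath (g0 @ [last g])" using g(1) g0 by simp
    then show "ipath g0" "last g \<notin> set g0" by (auto simp: ipath_append)
    have "length g = length g0 + 1" using g0 by (metis length_append_singleton Suc_eq_plus1)
    then show "g0 \<noteq> []" using g(2) by auto
    then show "hd g0 = hd g" using g0 by (metis hd_append2)
    show "set g0 \<subseteq> set g" using g0 by (metis Un_upper1 set_append)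
  qed
  have vg0: "v \<in> set g0"
  proof -
    have "v \<in> set (g0 @ [last g])" using Mg(2) g0 by simp
    then show ?thesis using Mg(3) by simp
  qed
  let ?Z = "M \<union> set g0"
  have cZ: "conn ?Z"
    by (rule conn_union[OF M(1) conn_ipath[OF g0'(1,2)]]) (use Mg vg0 in \<open>auto simp: meets_def\<close>)
  have xZ: "hd g \<in> ?Z" using g0'(2,3) by (metis UnI2 hd_in_set)
  have Zf: "?Z \<inter> set f = {}" using M(5) fg g0'(5) by blast
  have mZ: "meets ?Z (set f)" using Mf unfolding meets_def by blast
  have ZM: "z \<in> M" if "z \<in> ?Z" "a \<in> set f" "E z a" for z a using that fg[OF that(2), of z] g0'(5) by blast
  let ?Y = "set f \<union> ?Z"
  have n: "hd f \<noteq> last f" "hd f \<noteq> hd g" "last f \<noteq> hd g" "\<not> E (hd f) (last f)" "\<not> E (hd f) (hd g)" "\<not> E (last f) (hd g)"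
    using ef fg[OF hl(1,3)] fg[OF hl(2,3)] by auto
  have AY: "x \<notin> ?Y" if "x \<in> A - {hd g}" for x
    using that AM[of x x] att_disj[OF A(1), of x] att_disj[OF A(2), of x] g0'(5) by blast
  have XY: "?D \<inter> ?Y \<subseteq> {hd f, last f, hd g}"
  proof
    fix x assume x: "x \<in> ?D \<inter> ?Y"
    then have y: "x \<in> set f \<or> x \<in> M \<or> x \<in> set g" using g0'(5) by blast
    have "x \<in> A \<or> x \<in> set r \<or> x \<in> C \<or> x \<in> {hd f, last f, hd g}" using x by blast
    then show "x \<in> {hd f, last f, hd g}"
      using y AM[of x x] CM[of x x] rM[of x x] fr[of x x] gr[of x x] att_disj[OF A(1), of x] att_disj[OF A(2), of x]
        att_disj[OF C(1), of x] att_disj[OF C(2), of x] by blast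
  qed
  have cross: "u \<in> {hd f, last f, hd g} \<or> v \<in> {hd f, last f, hd g}" if uv: "u \<in> ?D" "v \<in> ?Y" "E u v" for u v
  proof -
    have v: "v \<in> set f \<or> v \<in> M \<or> (v \<in> set g \<and> v \<noteq> last g)" using uv(2) g0'(4,5) by blast
    consider "u \<in> {hd f, last f, hd g}" | "u \<in> A" | "u \<in> set r" | "u \<in> C" using uv(1) by blast
    then show ?thesis
    proof cases
      case 2
      then show ?thesis
        using v uv(3) AM[OF 2, of v] att_edge[OF A(1) 2, of v] att_edge[OF A(2) 2, of v] by blast
    next
      case 3
      then show ?thesis using v uv(3) rM[OF 3, of v] fr[of v u] gr[of v u] by blast
    next
      case 4
      then show ?thesis
        using v uv(3) CM[OF 4, of v] att_edge[OF C(1) 4, of v] att_edge[OF C(2) 4, of v] by blast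
    qed blast
  qed
  have far: "c \<notin> set f \<union> M" if "c \<in> insert (hd r) A" for c
    using that AM[of c c] att_disj[OF A(1), of c] fr[OF _ hl(5), of "hd r"] rM[OF hl(5), of "hd r"] by blast
  show False
  proof (rule attach[OF f(1) ne(1) cZ Zf xZ mZ])
    fix k' F' G' H'
    assume T': "tripod k' F' G' H'" "last F' = hd f" "last G' = last f" "last H' = hd g"
      and TY: "set F' \<union> set G' \<union> set H' \<subseteq> ?Y"
      and out: "(\<exists>c J. k' = Some c \<and> c \<in> set f \<and> ipath J \<and> J \<noteq> [] \<and> hd J = hd g \<and> set J \<subseteq> ?Z \<and>
          (\<forall>b\<in>set J. \<forall>a\<in>set f. E b a \<longleftrightarrow> b = last J \<and> a = c)) \<or>
        (\<exists>c. k' = Some c \<and> c \<in> ?Z \<and> (\<exists>a\<in>set f. \<exists>b\<in>set f. a \<noteq> b \<and> \<not> E a b \<and> E c a \<and> E c b)) \<or>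
        (k' = None \<and> (\<exists>j\<in>?Z. \<exists>a\<in>set f. \<exists>b\<in>set f. hd F' = a \<and> hd G' = b \<and> hd H' = j \<and> E a b \<and>
          (\<forall>v\<in>set f. E j v \<longleftrightarrow> v = a \<or> v = b)))"
    have cen: "c \<in> M \<or> (c \<in> set f \<and> c \<noteq> hd f)" if k: "k' = Some c" for c
    proof -
      from k out consider J where "c \<in> set f" "ipath J" "J \<noteq> []" "hd J = hd g" "set J \<subseteq> ?Z"
          "\<forall>b\<in>set J. \<forall>a\<in>set f. E b a \<longleftrightarrow> b = last J \<and> a = c"
        | a where "c \<in> ?Z" "a \<in> set f" "E c a" by blast
      then show ?thesis
      proof cases
        case 1
        have "c \<noteq> hd f"
        proof
          assume c: "c = hd f"
          show False
            by (rule none[OF 1(2-4) _ 1(6)[unfolded c]]) (use 1(5) g0'(5) in blast)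
        qed
        then show ?thesis using 1(1) by blast
      next
        case 2
        then show ?thesis using ZM by blast
      qed
    qed
    have tri: "{hd F', hd G', hd H'} \<subseteq> set f \<union> M" if k: "k' = None"
    proof -
      obtain j a b where j: "j \<in> ?Z" "a \<in> set f" "b \<in> set f" "hd F' = a" "hd G' = b" "hd H' = j"
          "\<forall>v\<in>set f. E j v \<longleftrightarrow> v = a \<or> v = b" using k out by auto
      then have "j \<in> M" using ZM[of j a] by blast
      then show ?thesis using j by simp
    qed
    show False
    proof (rule glue_sets[OF TD(1) T(2) TD(2) T(3) TD(3) T' TY n XY cross no])
      fix c c' assume c: "k = Some c" "k' = Some c'" "c = c' \<or> E c c'"
      have ca: "c \<in> insert (hd r) A" using T(6) c(1) by blast
      have E: "E c c'" using c(3) cen[OF c(2)] far[OF ca] by blast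
      show False
      proof (cases "c \<in> A")
        case True
        then show False using cen[OF c(2)] E AM[OF True, of c'] att_edge[OF A(1) True, of c'] by blast
      next
        case False
        then have "c \<in> set r" using ca hl(5) by blast
        then show False using cen[OF c(2)] E rM[of c c'] fr[of c' c] by blast
      qed
    next
      fix c assume c: "k = Some c" "k' = None" "c \<in> {hd F', hd G', hd H'}"
      then show False using T(6) tri[OF c(2)] far[of c] by blast
    next
      fix c assume c: "k = None" "k' = Some c" "c \<in> {hd F, hd ?H, hd G}"
      then have "c \<in> insert (hd r) A" using T(7) hdH by auto
      then show False using cen[OF c(2)] far[of c] by blast
    qed
  qed
qed

text \<open>The ends of the theta are \<open>hd f\<close> and \<open>hd g\<close>; they are joined
  through \<open>A\<close>, through \<open>M\<close>, and along \<open>f\<close>, \<open>C\<close>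
  and \<open>g\<close>.\<close>

lemma theta_of_connections:
  assumes l: "link3 A C f g r"
    and M: "conn M" "sep A M" "sep C M" "att M f (hd f)" "att M g (hd g)"
  shows has_theta
proof -
  have f: "ipath f" "length f \<ge> 3" and g: "ipath g" "length g \<ge> 3"
    and sep: "sep (set f) (set g)" "sep A C"
    and conn: "conn A" "conn C"
    and A: "att A f (hd f)" "att A g (hd g)"
    and C: "att C f (last f)" "att C g (last g)"
    using l unfolding link3_def by auto
  have ne: "f \<noteq> []" "g \<noteq> []" using f(2) g(2) by auto
  then have hl: "hd f \<in> set f" "last f \<in> set f" "hd g \<in> set g" "last g \<in> set g" by simp_all
  note fg = sepD[OF sep(1)]
  have path: "\<exists>p. ipath p \<and> p \<noteq> [] \<and> hd p = hd f \<and> last p = hd g \<and> set p \<subseteq> insert (hd f) (insert (hd g) X)"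
    if "conn X" "att X f (hd f)" "att X g (hd g)" for X
  proof -
    have "conn (insert (hd f) (insert (hd g) X))"
      by (intro conn_insert[OF conn_insert[OF that(1)]]) (use att_ex[OF that(2)] att_ex[OF that(3)] in blast)+
    then show ?thesis unfolding conn_def by blast
  qed
  obtain p where p: "ipath p" "p \<noteq> []" "hd p = hd f" "last p = hd g" "set p \<subseteq> insert (hd f) (insert (hd g) A)"
    using path[OF conn(1) A] by blast
  obtain q where q: "ipath q" "q \<noteq> []" "hd q = hd f" "last q = hd g" "set q \<subseteq> insert (hd f) (insert (hd g) M)"
    using path[OF M(1,4,5)] by blast
  have "conn (set f \<union> C)"
    by (rule conn_union[OF conn_ipath[OF f(1) ne(1)] conn(2)]) (use att_ex[OF C(1)] hl in \<open>auto simp: meets_def\<close>)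
  then have "conn (set f \<union> C \<union> set g)"
    by (rule conn_union[OF _ conn_ipath[OF g(1) ne(2)]])
      (use att_ex[OF C(2)] hl E_sym in \<open>auto simp: meets_def\<close>)
  then obtain s where s: "ipath s" "s \<noteq> []" "hd s = hd f" "last s = hd g" "set s \<subseteq> set f \<union> C \<union> set g"
    by (rule conn_path[of _ "hd f" "hd g"]) (use hl in auto)
  have th: "theta_pair (hd f) (hd g) x y"
    if x: "ipath x" "x \<noteq> []" "hd x = hd f" "last x = hd g" "set x \<subseteq> insert (hd f) (insert (hd g) X)"
      and y: "ipath y" "y \<noteq> []" "hd y = hd f" "last y = hd g" "set y \<subseteq> Y"
      and XY: "\<And>u v. u \<in> X \<Longrightarrow> v \<in> Y \<Longrightarrow> (u = v \<or> E u v) \<Longrightarrow> v \<in> {hd f, hd g} \<and> u \<noteq> v" for x y X Y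
  proof -
    have m: "hd f \<in> set x" "hd g \<in> set x" "hd f \<in> set y" "hd g \<in> set y"
      using x(2-4) y(2-4) by (metis hd_in_set last_in_set)+
    have "set x \<inter> set y \<subseteq> {hd f, hd g}" using x(5) y(5) XY by blast
    moreover have "u \<in> {hd f, hd g} \<or> v \<in> {hd f, hd g}" if "u \<in> set x" "v \<in> set y" "E u v" for u v
      using that x(5) y(5) XY[of u v] by blast
    ultimately show ?thesis unfolding theta_pair_def using x(1-4) y(1-4) m by blast
  qed
  have 1: "theta_pair (hd f) (hd g) p q"
    by (rule th[OF p q]) (use sepD[OF M(2)] att_disj[OF A(1) hl(1)] att_disj[OF A(2) hl(3)] in blast)
  have 2: "theta_pair (hd f) (hd g) p s"
    by (rule th[OF p s]) (use sepD[OF sep(2)] att_disj[OF A(1)] att_disj[OF A(2)] att_edge[OF A(1)] att_edge[OF A(2)] in blast)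
  have 3: "theta_pair (hd f) (hd g) q s"
    by (rule th[OF q s]) (use sepD[OF M(3)] att_disj[OF M(4)] att_disj[OF M(5)] att_edge[OF M(4)] att_edge[OF M(5)] in blast)
  show ?thesis
    unfolding has_theta_def using 1 2 3 fg[OF hl(1,3)] by blast
qed

text \<open>Follow the path \<open>J\<close> of \<open>link3_middle\<close> backwards from its last
  vertex to the first contact with \<open>g\<close>. This is a connected part \<open>?M\<close> of
  \<open>M\<close> that sees \<open>f\<close> only at \<open>hd f\<close>. If it sees
  \<open>g\<close> only at \<open>hd g\<close>, \<open>theta_of_connections\<close> applies.
  Otherwise \<open>link3_middle\<close> for the reversed paths gives a vertex of \<open>?M\<close>
  adjacent to \<open>last f\<close>, a contradiction.\<close>

lemma same_middle_aux:
  assumes l: "link3 A C f g r" and no: "\<not> has_3pc"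
    and M: "conn M" "sep A M" "sep C M" "sep (set r) M" "M \<inter> set f = {}" "M \<inter> set g = {}"
    and Mf: "meets M (set f)" and Mg: "m \<in> M" "v \<in> set g" "v \<noteq> last g" "E m v"
  shows False
proof -
  have f: "ipath f" "length f \<ge> 3" and g: "ipath g" "length g \<ge> 3" and sep: "sep (set f) (set g)"
    using l unfolding link3_def by auto
  have ne: "f \<noteq> []" "g \<noteq> []" using f(2) g(2) by auto
  then have hl: "hd f \<in> set f" "last f \<in> set f" "hd g \<in> set g" "last g \<in> set g" by simp_all
  note fg = sepD[OF sep]
  obtain J where J: "ipath J" "J \<noteq> []" "hd J = hd g" "set J \<subseteq> M \<union> set g"
    "\<forall>b\<in>set J. \<forall>a\<in>set f. E b a \<longleftrightarrow> b = last J \<and> a = hd f"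
    using link3_middle[OF l no M Mf Mg] by metis
  have lJ: "last J \<in> set J" "E (last J) (hd f)" using J(2,5) hl(1) by simp_all
  have lM: "last J \<in> M" using lJ J(4) fg[OF hl(1), of "last J"] by blast
  have "\<exists>y\<in>set J. meets {y} (set g)"
  proof -
    obtain j2 J' where J2: "J = hd g # j2 # J'"
    proof (cases J)
      case (Cons a J1)
      have "J1 \<noteq> []"
      proof
        assume "J1 = []"
        then have "last J = hd g" using Cons J(3) by simp
        then show False using lM M(6) hl(3) by auto
      qed
      then show ?thesis using that Cons J(3) by (cases J1) auto
    qed (use J(2) in simp)
    have "E (hd g) j2" using J(1) unfolding J2 by simp
    then have "E j2 (hd g)" by (rule E_sym)
    then show ?thesis using hl(3) unfolding J2 meets_def by auto
  qed
  then obtain y where y: "y \<in> set J" "meets {y} (set g)" by blast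
  obtain p z where p: "ipath (p @ [z])" "hd (p @ [z]) = last J" "set (p @ [z]) \<subseteq> set J" "meets {z} (set g)"
      "\<forall>u\<in>set p. \<not> meets {u} (set g)"
    by (rule conn_path_first[OF conn_ipath[OF J(1,2)] lJ(1) y(1), of "\<lambda>u. meets {u} (set g)"]) (use y in auto)
  let ?M = "set (p @ [z])"
  \<comment> \<open>The first vertex is in \<open>M\<close>; before any later vertex on
    \<open>g\<close> the search would have stopped at its predecessor.\<close>
  have pre: "u \<notin> set g" if u: "u \<in> ?M" for u
  proof
    assume ug: "u \<in> set g"
    obtain a b where ab: "p @ [z] = a @ u # b" using u by (meson split_list)
    show False
    proof (cases "a = []")
      case True
      then have "u = last J" using p(2) ab by simp
      then show False using ug lM M(6) by blast
    next
      case False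
      then have "E (last a) u" using p(1) ab by (simp add: ipath_append)
      moreover have "last a \<in> set p" using ab False by (cases b rule: rev_cases) auto
      ultimately show False using p(5) ug unfolding meets_def by blast
    qed
  qed
  have MM: "?M \<subseteq> M" using p(3) J(4) pre by blast
  have cM: "conn ?M" using p(1) by (rule conn_ipath) simp
  have attf: "att ?M f (hd f)"
  proof -
    have "last J \<in> ?M" using p(2) by (metis hd_in_set snoc_eq_iff_butlast)
    moreover have "a = hd f" if "b \<in> ?M" "a \<in> set f" "E b a" for a b using J(5) p(3) that by blast
    ultimately show ?thesis using lJ(2) MM M(5) unfolding att_def by blast
  qed
  have sepM: "sep A ?M" "sep C ?M" "sep (set r) ?M" using M(2-4) MM sep_mono[OF _ order_refl MM] by blast+
  show False
  proof (cases "\<exists>u\<in>?M. \<exists>w\<in>set g. w \<noteq> hd g \<and> E u w")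
    case True
    then obtain u w where uw: "u \<in> ?M" "w \<in> set g" "w \<noteq> hd g" "E u w" by blast
    obtain J2 where J2: "J2 \<noteq> []" "set J2 \<subseteq> ?M \<union> set (rev g)"
      "\<forall>b\<in>set J2. \<forall>a\<in>set (rev f). E b a \<longleftrightarrow> b = last J2 \<and> a = hd (rev f)"
    proof (rule link3_middle[OF link3_rev[OF l] no cM sepM(2,1), of u w])
      show "sep (set (rev r)) ?M" using sepM(3) by simp
      show "?M \<inter> set (rev f) = {}" "?M \<inter> set (rev g) = {}" using MM M(5,6) by auto
      show "meets ?M (set (rev f))" using attf hl(1) unfolding att_def meets_def set_rev by blast
      show "w \<noteq> last (rev g)" using uw(3) by (simp add: last_rev)
    qed (use uw in auto)
    have "E (last J2) (last f)" using J2(1,3) hl(2) by (simp add: hd_rev)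
    moreover have "last J2 \<in> ?M"
    proof -
      have "last J2 \<in> ?M \<union> set (rev g)" by (rule subsetD[OF J2(2) last_in_set[OF J2(1)]])
      moreover have "last J2 \<notin> set (rev g)"
        using \<open>E (last J2) (last f)\<close> fg[OF hl(2), of "last J2"] by auto
      ultimately show ?thesis by blast
    qed
    ultimately have "last f = hd f" using attf hl(2) unfolding att_def by blast
    then show False using ipath_nonadj_ends(2)[OF f] by simp
  next
    case False
    have zg: "\<exists>w\<in>set g. E z w" using p(4) unfolding meets_def by blast
    have zM: "z \<in> ?M" by simp
    have "E z (hd g)" using zg False zM by metis
    then have "\<exists>u\<in>?M. E u (hd g)" using zM by (rule bexI)
    moreover have "?M \<inter> set g = {}" using pre by blast
    moreover have "\<forall>u\<in>?M. \<forall>w\<in>set g. E u w \<longrightarrow> w = hd g" using False by metis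
    ultimately have "att ?M g (hd g)" unfolding att_def by blast
    then show False
      using theta_of_connections[OF l cM sepM(1,2) attf] no unfolding has_3pc_def by blast
  qed
qed

text \<open>If \<open>M\<close> missed \<open>r\<close>, it would be anticomplete to it. A contact
  of \<open>M\<close> with \<open>g\<close> avoids \<open>last g\<close> or \<open>hd g\<close>, and
  \<open>same_middle_aux\<close> applies directly or after reversing the paths.\<close>

lemma same_middle:
  assumes l: "link3 A C f g r" and no: "\<not> has_3pc"
    and M: "conn M" "sep A M" "sep C M" "M \<inter> set r = {}" "M \<inter> set f = {}" "M \<inter> set g = {}"
    and Mfg: "meets M (set f)" "meets M (set g)"
  shows "length r \<le> 2" "meets M (set r)"
proof -
  show "length r \<le> 2" using link3_tripod[OF l no] by metis
  show "meets M (set r)"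
  proof (rule ccontr)
    assume "\<not> meets M (set r)"
    then have rM: "sep (set r) M" using M(4) E_sym unfolding sep_def meets_def by blast
    obtain m v where mv: "m \<in> M" "v \<in> set g" "E m v" using Mfg(2) unfolding meets_def by blast
    have g: "ipath g" "length g \<ge> 3" using l unfolding link3_def by auto
    show False
    proof (cases "v = last g")
      case False
      then show False using same_middle_aux[OF l no M(1-3) rM M(5,6) Mfg(1)] mv by blast
    next
      case True
      then have "v \<noteq> last (rev g)" using ipath_nonadj_ends(2)[OF g] by (simp add: last_rev)
      then show False
        using same_middle_aux[OF link3_rev[OF l] no M(1,3,2), of m v] rM M(5,6) Mfg(1) mv by simp
    qed
  qed
qed


section \<open>Classification of minimal connectors\<close>

lemma edge_tripod:
  assumes e: "E x y" "E a x" "\<not> E a y" "E b y" "\<not> E b x" "E c x \<or> E c y"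
    and d: "a \<noteq> b" "a \<noteq> c" "b \<noteq> c" "\<not> E a b" "\<not> E a c" "\<not> E b c"
    and o: "a \<notin> {x, y}" "b \<notin> {x, y}" "c \<notin> {x, y}"
  shows "\<exists>k P Q R. tripod k P Q R \<and> last P = a \<and> last Q = b \<and> last R = c \<and>
    set P \<union> set Q \<union> set R \<subseteq> {x, y} \<union> {a, b, c} \<and> (\<forall>z. k = Some z \<longrightarrow> z \<in> {x, y})"
proof -
  have s: "E y x" "E x a" "\<not> E y a" "E y b" "\<not> E x b" "\<not> E b a" "\<not> E c a" "\<not> E c b" "x \<noteq> y" "E c x \<longleftrightarrow> E x c" "E c y \<longleftrightarrow> E y c"
    using e d E_sym E_neq by blast+
  \<comment> \<open>The third end decides: if it sees one of \<open>x\<close> and \<open>y\<close>,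
    that vertex is the centre of a claw; if it sees both, they form a triangle with it.\<close>
  consider "E c x" "\<not> E c y" | "E c y" "\<not> E c x" | "E c x" "E c y" using e(6) by blast
  then show ?thesis
  proof cases
    case 1
    have "claw x (x # [a]) (x # [y, b]) (x # [c])"
      unfolding claw_def by (intro conjI armI) (use e d o s 1 in auto)
    then show ?thesis
      by (intro exI[of _ "Some x"] exI[of _ "x # [a]"] exI[of _ "x # [y, b]"] exI[of _ "x # [c]"]) auto
  next
    case 2
    have "claw y (y # [x, a]) (y # [b]) (y # [c])"
      unfolding claw_def by (intro conjI armI) (use e d o s 2 in auto)
    then show ?thesis
      by (intro exI[of _ "Some y"] exI[of _ "y # [x, a]"] exI[of _ "y # [b]"] exI[of _ "y # [c]"]) auto
  next
    case 3
    have "net [x, a] [y, b] [c]"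
      unfolding net_def by (intro conjI cornerI) (use e d o s 3 in auto)
    then show ?thesis
      by (intro exI[of _ None] exI[of _ "[x, a]"] exI[of _ "[y, b]"] exI[of _ "[c]"]) auto
  qed
qed

lemma star_tripod:
  assumes e: "E a x" "E b x" "E c x"
    and d: "a \<noteq> b" "a \<noteq> c" "b \<noteq> c" "\<not> E a b" "\<not> E a c" "\<not> E b c"
    and o: "a \<noteq> x" "b \<noteq> x" "c \<noteq> x"
  shows "\<exists>k P Q R. tripod k P Q R \<and> last P = a \<and> last Q = b \<and> last R = c \<and>
    set P \<union> set Q \<union> set R \<subseteq> {x} \<union> {a, b, c} \<and> (\<forall>z. k = Some z \<longrightarrow> z \<in> {x})"
proof -
  have s: "E x a" "E x b" "E x c" "\<not> E b a" "\<not> E c a" "\<not> E c b" using e d E_sym by blast+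
  have "claw x (x # [a]) (x # [b]) (x # [c])"
    unfolding claw_def by (intro conjI armI) (use e d o s in auto)
  then show ?thesis
    by (intro exI[of _ "Some x"] exI[of _ "x # [a]"] exI[of _ "x # [b]"] exI[of _ "x # [c]"]) auto
qed

lemma tripod_ends_perm:
  assumes "\<exists>k P Q R. tripod k P Q R \<and> last P = a \<and> last Q = b \<and> last R = c \<and>
    set P \<union> set Q \<union> set R \<subseteq> S \<union> {a, b, c} \<and> (\<forall>z. k = Some z \<longrightarrow> z \<in> S)"
  shows "\<exists>k P Q R. tripod k P Q R \<and> last P = b \<and> last Q = a \<and> last R = c \<and>
    set P \<union> set Q \<union> set R \<subseteq> S \<union> {b, a, c} \<and> (\<forall>z. k = Some z \<longrightarrow> z \<in> S)"
   "\<exists>k P Q R. tripod k P Q R \<and> last P = a \<and> last Q = c \<and> last R = b \<and>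
    set P \<union> set Q \<union> set R \<subseteq> S \<union> {a, c, b} \<and> (\<forall>z. k = Some z \<longrightarrow> z \<in> S)"
proof -
  obtain k P Q R where T: "tripod k P Q R" "last P = a" "last Q = b" "last R = c"
    "set P \<union> set Q \<union> set R \<subseteq> S \<union> {a, b, c}" "\<forall>z. k = Some z \<longrightarrow> z \<in> S" using assms by blast
  show "\<exists>k P Q R. tripod k P Q R \<and> last P = b \<and> last Q = a \<and> last R = c \<and>
    set P \<union> set Q \<union> set R \<subseteq> S \<union> {b, a, c} \<and> (\<forall>z. k = Some z \<longrightarrow> z \<in> S)"
    using T tripod_perm(1)[of k P Q R]
    by (intro exI[of _ k] exI[of _ Q] exI[of _ P] exI[of _ R]) auto
  show "\<exists>k P Q R. tripod k P Q R \<and> last P = a \<and> last Q = c \<and> last R = b \<and>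
    set P \<union> set Q \<union> set R \<subseteq> S \<union> {a, c, b} \<and> (\<forall>z. k = Some z \<longrightarrow> z \<in> S)"
    using T tripod_perm(2)[of k P Q R]
    by (intro exI[of _ k] exI[of _ P] exI[of _ R] exI[of _ Q]) auto
qed

text \<open>By minimality neither \<open>x\<close> nor \<open>y\<close> alone sees all three ends.
  Hence one end misses \<open>y\<close> and a different one misses \<open>x\<close>, which is
  \<open>edge_tripod\<close> up to a permutation.\<close>

lemma small_skinny:
  assumes S: "conn S" "S = {x, y}"
    and sep: "sep A1 A2" "sep A1 A3" "sep A2 A3"
    and dis: "A1 \<inter> S = {}" "A2 \<inter> S = {}" "A3 \<inter> S = {}"
    and min: "\<And>S'. S' \<subset> S \<Longrightarrow> conn S' \<Longrightarrow> \<not> (meets A1 S' \<and> meets A2 S' \<and> meets A3 S')"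
  shows "skinny A1 A2 A3 S"
  unfolding skinny_def
proof (intro ballI impI)
  fix a b c
  assume A: "a \<in> A1" "b \<in> A2" "c \<in> A3" and m: "meets {a} S" "meets {b} S" "meets {c} S"
  have d: "a \<noteq> b" "a \<noteq> c" "b \<noteq> c" "\<not> E a b" "\<not> E a c" "\<not> E b c" "\<not> E b a" "\<not> E c a" "\<not> E c b"
    using sepD[OF sep(1) A(1,2)] sepD[OF sep(2) A(1,3)] sepD[OF sep(3) A(2,3)] by auto
  have o: "a \<notin> {x, y}" "b \<notin> {x, y}" "c \<notin> {x, y}" using A dis S(2) by auto
  have t: "E a x \<or> E a y" "E b x \<or> E b y" "E c x \<or> E c y" using m S(2) unfolding meets_def by auto
  let ?G = "\<lambda>a b c. \<exists>k P Q R. tripod k P Q R \<and> last P = a \<and> last Q = b \<and> last R = c \<and>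
      set P \<union> set Q \<union> set R \<subseteq> S \<union> {a, b, c} \<and> (\<forall>z. k = Some z \<longrightarrow> z \<in> S)"
  show "?G a b c"
  proof (cases "x = y")
    case True
    then have Sx: "S = {x}" using S(2) by simp
    show ?thesis unfolding Sx by (rule star_tripod) (use t d o True in auto)
  next
    case False
    have Exy: "E x y"
    proof -
      obtain p where p: "ipath p" "p \<noteq> []" "hd p = x" "last p = y" "set p \<subseteq> S"
        using conn_path[OF S(1), of x y] S(2) by auto
      obtain q where q: "p = x # q" using p by (cases p) auto
      then have "q \<noteq> []" using p(4) False by auto
      then have "hd q \<in> S" "hd q \<noteq> x" "E x (hd q)" using p(1,5) q by auto
      then show ?thesis using S(2) by auto
    qed
    have "\<not> (meets A1 {x} \<and> meets A2 {x} \<and> meets A3 {x})" "\<not> (meets A1 {y} \<and> meets A2 {y} \<and> meets A3 {y})"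
      using min[of "{x}"] min[of "{y}"] S(2) False by auto
    then have nx: "\<not> E a x \<or> \<not> E b x \<or> \<not> E c x" and ny: "\<not> E a y \<or> \<not> E b y \<or> \<not> E c y"
      using A unfolding meets_def by auto
    note et = edge_tripod[OF Exy, folded S(2)]
    consider "\<not> E a y" "\<not> E b x" | "\<not> E a y" "\<not> E c x" | "\<not> E b y" "\<not> E a x" | "\<not> E b y" "\<not> E c x"
      | "\<not> E c y" "\<not> E a x" | "\<not> E c y" "\<not> E b x" using nx ny t by blast
    then show ?thesis
    proof cases
      case 1
      show ?thesis by (rule et) (use 1 t d o S(2) in auto)
    next
      case 2
      have "?G a c b" by (rule et) (use 2 t d o S(2) in auto)
      then show ?thesis by (rule tripod_ends_perm(2))
    next
      case 3
      have "?G b a c" by (rule et) (use 3 t d o S(2) in auto)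
      then show ?thesis by (rule tripod_ends_perm(1))
    next
      case 4
      have "?G b c a" by (rule et) (use 4 t d o S(2) in auto)
      then show ?thesis by (rule tripod_ends_perm(1)[OF tripod_ends_perm(2)])
    next
      case 5
      have "?G c a b" by (rule et) (use 5 t d o S(2) in auto)
      then show ?thesis by (rule tripod_ends_perm(2)[OF tripod_ends_perm(1)])
    next
      case 6
      have "?G c b a" by (rule et) (use 6 t d o S(2) in auto)
      then show ?thesis by (rule tripod_ends_perm(1)[OF tripod_ends_perm(2)[OF tripod_ends_perm(1)]])
    qed
  qed
qed

text \<open>Let \<open>v\<close> be the last neighbour of \<open>last J\<close> on \<open>p\<close>.
  The part of \<open>p\<close> before \<open>v\<close> can be removed without losing
  \<open>J\<close>, \<open>last p\<close> or connectedness, so by minimality there is no such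
  part.\<close>

lemma hanging_path:
  assumes p: "ipath p" "p \<noteq> []" and J: "ipath J" "J \<noteq> []" "set J \<inter> set p = {}"
    and e: "\<And>u v. u \<in> set J \<Longrightarrow> v \<in> set p \<Longrightarrow> E u v \<Longrightarrow> u = last J" "\<exists>v\<in>set p. E (last J) v"
    and min: "\<And>S'. S' \<subseteq> set J \<union> set p \<Longrightarrow> conn S' \<Longrightarrow> last p \<in> S' \<Longrightarrow> set J \<subseteq> S' \<Longrightarrow> S' = set J \<union> set p"
  shows "ipath (J @ p)"
proof -
  obtain A v B where v: "p = A @ v # B" "E (last J) v" "\<forall>y\<in>set B. \<not> E (last J) y"
    using split_list_last_prop[OF e(2)] by blast
  have ipv: "ipath (v # B)" using p(1) v(1) ipath_append by blast
  have "conn (set J \<union> set (v # B))"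
    by (rule conn_union[OF conn_ipath[OF J(1,2)] conn_ipath[OF ipv]]) (use v(2) J(2) in \<open>auto simp: meets_def\<close>)
  then have eq: "set J \<union> set (v # B) = set J \<union> set p" by (rule min[rotated]) (use v(1) in auto)
  have "A = []"
  proof (rule ccontr)
    assume "A \<noteq> []"
    then have h: "hd A \<in> set A" by simp
    then have "hd A \<in> set J \<union> set (v # B)" using v(1) eq by auto
    moreover have "hd A \<notin> set J" using h J(3) v(1) by auto
    moreover have "hd A \<notin> set (v # B)" using h p(1) v(1) ipath_append[of A "v # B"] by blast
    ultimately show False by blast
  qed
  then have pv: "p = v # B" using v(1) by simp
  have "E u w \<longleftrightarrow> u = last J \<and> w = hd p" if "u \<in> set J" "w \<in> set p" for u w
    using e(1)[OF that] v(2,3) that(2) unfolding pv by auto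
  then show ?thesis using p(1) J(1,3) by (subst ipath_append) blast
qed

lemma path_att:
  assumes "A \<inter> set p = {}" "meets A (set p)" "\<not> meets A (set (tl p))" "p \<noteq> []"
  shows "att A p (hd p)"
  using assms unfolding att_def meets_def by (cases p) auto

text \<open>If \<open>S\<close> is a path with at least three vertices, removing an end vertex
  leaves a connected set that has lost some \<open>Ai\<close>, so this \<open>Ai\<close> is attached
  at that vertex only. If \<open>S\<close> is not a path, minimality makes it, for any choice of the
  three ends, the union of a path \<open>p\<close> between two of the contacts and a path
  \<open>J\<close> leading to the third.\<close>

lemma classify:
  assumes S: "conn S" "meets A1 S" "meets A2 S" "meets A3 S"
    and sep: "sep A1 A2" "sep A1 A3" "sep A2 A3"
    and dis: "A1 \<inter> S = {}" "A2 \<inter> S = {}" "A3 \<inter> S = {}"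
    and min: "\<And>S'. S' \<subset> S \<Longrightarrow> conn S' \<Longrightarrow> \<not> (meets A1 S' \<and> meets A2 S' \<and> meets A3 S')"
  obtains "skinny A1 A2 A3 S"
  | p where "set p = S" "ipath p" "length p \<ge> 3" "att A1 p (hd p)" "att A2 p (last p)"
  | p where "set p = S" "ipath p" "length p \<ge> 3" "att A1 p (hd p)" "att A3 p (last p)"
  | p where "set p = S" "ipath p" "length p \<ge> 3" "att A2 p (hd p)" "att A3 p (last p)"
proof (cases "\<exists>p. ipath p \<and> set p = S")
  case True
  then obtain p where p: "ipath p" "set p = S" by blast
  have pne: "p \<noteq> []" using p(2) S(1) unfolding conn_def by auto
  show ?thesis
  proof (cases "length p \<ge> 3")
    case False
    have "S = {hd p, last p}"
    proof -
      obtain x q where x: "p = x # q" using pne by (cases p) auto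
      show ?thesis
      proof (cases q)
        case Nil
        then show ?thesis using x p(2) by auto
      next
        case (Cons y q')
        then have "q' = []" using False x by (cases q') auto
        then show ?thesis using x Cons p(2) by auto
      qed
    qed
    then have "skinny A1 A2 A3 S" using small_skinny[OF S(1) _ sep dis min] by blast
    then show ?thesis using that(1) by blast
  next
    case len: True
    have half: "\<exists>A\<in>{A1, A2, A3}. att A q (hd q)" if q: "ipath q" "set q = S" "length q \<ge> 3" for q
    proof -
      obtain x r where x: "q = x # r" using q(3) by (cases q) auto
      have r: "ipath r" "r \<noteq> []" using q x by auto
      have "set r \<subset> S" using q(1,2) x by auto
      then have "\<not> (meets A1 (set r) \<and> meets A2 (set r) \<and> meets A3 (set r))" using min conn_ipath[OF r] by blast
      then show ?thesis using path_att[of _ q] dis S(2-4) q(2) x by auto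
    qed
    have 1: "\<exists>A\<in>{A1, A2, A3}. att A p (hd p)" using half[OF p len] .
    have 2: "\<exists>A\<in>{A1, A2, A3}. att A p (last p)"
      using half[of "rev p"] p len by (simp add: hd_rev)
    have ne: "\<not> (att A p (hd p) \<and> att A p (last p))" for A
    proof
      assume a: "att A p (hd p) \<and> att A p (last p)"
      then have "hd p = last p" using pne unfolding att_def by (metis hd_in_set)
      then show False using ipath_nonadj_ends(2)[OF p(1) len] by blast
    qed
    have r: "set (rev p) = S" "ipath (rev p)" "length (rev p) \<ge> 3" using p len by simp_all
    have rr: "att A p (last p) \<longleftrightarrow> att A (rev p) (hd (rev p))" "att A p (hd p) \<longleftrightarrow> att A (rev p) (last (rev p))" for A
      by (simp_all add: hd_rev last_rev)
    from 1 2 ne consider "att A1 p (hd p)" "att A2 p (last p)" | "att A1 p (hd p)" "att A3 p (last p)"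
      | "att A2 p (hd p)" "att A3 p (last p)" | "att A2 p (hd p)" "att A1 p (last p)"
      | "att A3 p (hd p)" "att A1 p (last p)" | "att A3 p (hd p)" "att A2 p (last p)" by blast
    then show ?thesis
    proof cases
      case 1 then show ?thesis using that(2)[of p] p len by blast
    next
      case 2 then show ?thesis using that(3)[of p] p len by blast
    next
      case 3 then show ?thesis using that(4)[of p] p len by blast
    next
      case 4 then show ?thesis using that(2)[of "rev p"] r unfolding rr by blast
    next
      case 5 then show ?thesis using that(3)[of "rev p"] r unfolding rr by blast
    next
      case 6 then show ?thesis using that(4)[of "rev p"] r unfolding rr by blast
    qed
  qed
next
  case False
  have "skinny A1 A2 A3 S"
    unfolding skinny_def
  proof (intro ballI impI)
    fix a b c
    assume A: "a \<in> A1" "b \<in> A2" "c \<in> A3" and m: "meets {a} S" "meets {b} S" "meets {c} S"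
    have d: "a \<noteq> b" "a \<noteq> c" "b \<noteq> c" "\<not> E a b" "\<not> E a c" "\<not> E b c" "\<not> E b a" "\<not> E c a" "\<not> E c b"
      using sepD[OF sep(1) A(1,2)] sepD[OF sep(2) A(1,3)] sepD[OF sep(3) A(2,3)] by auto
    have o: "a \<notin> S" "b \<notin> S" "c \<notin> S" using A dis by auto
    have mina: "S' = S" if "S' \<subseteq> S" "conn S'" "\<exists>u\<in>S'. E a u" "\<exists>u\<in>S'. E b u" "\<exists>u\<in>S'. E c u" for S'
    proof -
      have "meets A1 S' \<and> meets A2 S' \<and> meets A3 S'" using that A unfolding meets_def by blast
      then show ?thesis using min[of S'] that(1,2) by blast
    qed
    obtain xa xb xc where x: "xa \<in> S" "E a xa" "xb \<in> S" "E b xb" "xc \<in> S" "E c xc"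
      using m unfolding meets_def by blast
    obtain p where p: "ipath p" "p \<noteq> []" "set p \<subseteq> S" "E a (hd p)" "E b (last p)"
      "\<forall>u\<in>set p. E a u \<longrightarrow> u = hd p" "\<forall>u\<in>set p. E b u \<longrightarrow> u = last p"
      by (rule conn_path_between[OF S(1) x(1), of "E a" xb "E b"]) (use x in auto)
    have hl: "hd p \<in> set p" "last p \<in> set p" using p(2) by auto
    \<comment> \<open>With a neighbour of \<open>c\<close> on it, \<open>p\<close> would touch all
      three sets and be all of \<open>S\<close>, but \<open>S\<close> is not a path.\<close>
    have cp: "\<not> E c u" if "u \<in> set p" for u
      using mina[OF p(3) conn_ipath[OF p(1,2)]] that hl p(1,4,5) False by blast
    let ?Q = "\<lambda>u. u \<in> set p \<or> (\<exists>v\<in>set p. E u v)"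
    obtain J where J: "ipath J" "J \<noteq> []" "set J \<subseteq> S" "E c (hd J)" "?Q (last J)"
      "\<forall>u\<in>set J. E c u \<longrightarrow> u = hd J" "\<forall>u\<in>set J. ?Q u \<longrightarrow> u = last J"
      by (rule conn_path_between[OF S(1) x(5), of "E c" "hd p" ?Q]) (use x hl p(3) in auto)
    have lJ: "last J \<in> set J" "hd J \<in> set J" using J(2) by auto
    have lp: "last J \<notin> set p"
    proof
      assume l: "last J \<in> set p"
      then have "hd J \<noteq> last J" using cp J(4) by auto
      obtain K where K: "J = K @ [last J]" using J(2) by (metis append_butlast_last_id)
      then have "K \<noteq> []" using \<open>hd J \<noteq> last J\<close> by (metis append_Nil list.sel(1))
      have "ipath (K @ [last J])" using J(1) K by simp
      then have "E (last K) (last J)" "last J \<notin> set K" "last K \<in> set K"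
        using \<open>K \<noteq> []\<close> by (auto simp: ipath_append)
      moreover have "last K \<in> set J" using K \<open>last K \<in> set K\<close> by (metis Un_iff set_append)
      ultimately show False using J(7) l by metis
    qed
    have Jp: "set J \<inter> set p = {}" using J(7) lp by blast
    have Je: "u = last J" if "u \<in> set J" "v \<in> set p" "E u v" for u v using J(7) that by blast
    have Jt: "\<exists>v\<in>set p. E (last J) v" using J(5) lp by blast
    have "conn (set J \<union> set p)"
      by (rule conn_union[OF conn_ipath[OF J(1,2)] conn_ipath[OF p(1,2)]]) (use Jt lJ(1) in \<open>auto simp: meets_def\<close>)
    then have SJ: "set J \<union> set p = S" by (rule mina[rotated]) (use J(3,4) p(3-5) lJ hl in blast)+
    \<comment> \<open>With a neighbour of \<open>a\<close> on \<open>J\<close>, the beginning of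
      \<open>p\<close> is dispensable and \<open>hanging_path\<close> turns \<open>S\<close> into a
      path. For \<open>b\<close>, the same holds with \<open>p\<close> reversed.\<close>
    have Ja: "\<not> E a u" if u: "u \<in> set J" for u
    proof
      assume E: "E a u"
      have "ipath (J @ p)"
      proof (rule hanging_path[OF p(1,2) J(1,2) Jp Je Jt])
        fix S' assume "S' \<subseteq> set J \<union> set p" "conn S'" "last p \<in> S'" "set J \<subseteq> S'"
        then show "S' = set J \<union> set p" unfolding SJ by (intro mina) (use E u p(5) J(4) lJ in blast)+
      qed
      then show False using False SJ by (metis set_append)
    qed
    have Jb: "\<not> E b u" if u: "u \<in> set J" for u
    proof
      assume E: "E b u"
      have "ipath (J @ rev p)"
      proof (rule hanging_path)
        fix S' assume "S' \<subseteq> set J \<union> set (rev p)" "conn S'" "last (rev p) \<in> S'" "set J \<subseteq> S'"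
        then show "S' = set J \<union> set (rev p)"
          unfolding set_rev SJ by (intro mina) (use E u p(2,4) J(4) lJ in \<open>auto simp: last_rev\<close>)
      next
        show "ipath (rev p)" "rev p \<noteq> []" "ipath J" "J \<noteq> []" "set J \<inter> set (rev p) = {}"
          using p(1,2) J(1,2) Jp by simp_all
        show "u = last J" if "u \<in> set J" "v \<in> set (rev p)" "E u v" for u v
          using Je that by simp
        show "\<exists>v\<in>set (rev p). E (last J) v" using Jt by simp
      qed
      then show False using False SJ by (metis set_append set_rev)
    qed
    let ?b = "a # p @ [b]" and ?Z = "insert c (set J)"
    have ipb: "ipath ?b"
    proof -
      have bl: "E u b \<longleftrightarrow> u = last p" if "u \<in> set p" for u
        using p(5,7) that E_commute[of u b] by blast
      have al: "E a u \<longleftrightarrow> u = hd p" if "u \<in> set p" for u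
        using p(4,6) that by blast
      have bp: "b \<notin> set p" "a \<notin> set p" using o p(3) by auto
      have "ipath (p @ [b])"
        using p(1) bl bp by (simp add: ipath_append)
      moreover have "hd (p @ [b]) = hd p" using p(2) by simp
      moreover have "b \<noteq> hd p" using bp(1) hl by metis
      ultimately show ?thesis using bp al d by simp
    qed
    have cZ: "conn ?Z" by (rule conn_insert[OF conn_ipath[OF J(1,2)]]) (use J(4) lJ in blast)
    have disj: "?Z \<inter> set ?b = {}" using o p(3) J(3) Jp d by auto
    \<comment> \<open>All edges between the base and the attached part join \<open>J\<close> to
      \<open>p\<close>; this is what puts a claw centre inside \<open>S\<close>.\<close>
    have touch: "z \<in> set J \<and> v \<in> set p" if "z \<in> ?Z" "v \<in> set ?b" "E z v" for z v
    proof -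
      have "v = a \<or> v = b \<or> v \<in> set p" using that(2) by auto
      then show ?thesis using that(1,3) cp[of v] d Ja[of z] Jb[of z] E_sym[of z v] by auto
    qed
    have mZ: "meets ?Z (set ?b)" using Jt lJ unfolding meets_def by auto
    show "\<exists>k P Q R. tripod k P Q R \<and> last P = a \<and> last Q = b \<and> last R = c \<and>
      set P \<union> set Q \<union> set R \<subseteq> S \<union> {a, b, c} \<and> (\<forall>x. k = Some x \<longrightarrow> x \<in> S)"
    proof (rule attach[OF ipb _ cZ disj _ mZ])
      show "?b \<noteq> []" "c \<in> ?Z" by auto
      fix k F G H
      assume T: "tripod k F G H" "last F = hd ?b" "last G = last ?b" "last H = c"
        and TX: "set F \<union> set G \<union> set H \<subseteq> set ?b \<union> ?Z"
        and out: "(\<exists>x J. k = Some x \<and> x \<in> set ?b \<and> ipath J \<and> J \<noteq> [] \<and> hd J = c \<and> set J \<subseteq> ?Z \<and>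
            (\<forall>b'\<in>set J. \<forall>a'\<in>set ?b. E b' a' \<longleftrightarrow> b' = last J \<and> a' = x)) \<or>
          (\<exists>x. k = Some x \<and> x \<in> ?Z \<and> (\<exists>a'\<in>set ?b. \<exists>b'\<in>set ?b. a' \<noteq> b' \<and> \<not> E a' b' \<and> E x a' \<and> E x b')) \<or>
          (k = None \<and> (\<exists>j\<in>?Z. \<exists>a'\<in>set ?b. \<exists>b'\<in>set ?b. hd F = a' \<and> hd G = b' \<and> hd H = j \<and> E a' b' \<and>
            (\<forall>v\<in>set ?b. E j v \<longleftrightarrow> v = a' \<or> v = b')))"
      have "x \<in> S" if k: "k = Some x" for x
      proof -
        from k out consider J' where "x \<in> set ?b" "J' \<noteq> []" "set J' \<subseteq> ?Z"
            "\<forall>b'\<in>set J'. \<forall>a'\<in>set ?b. E b' a' \<longleftrightarrow> b' = last J' \<and> a' = x"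
          | a' where "x \<in> ?Z" "a' \<in> set ?b" "E x a'" by blast
        then show ?thesis
        proof cases
          case 1
          have "last J' \<in> ?Z" by (rule subsetD[OF 1(3) last_in_set[OF 1(2)]])
          moreover have "E (last J') x" using 1(1,2,4) last_in_set by blast
          ultimately have "x \<in> set p" using touch 1(1) by blast
          then show ?thesis using p(3) by blast
        next
          case 2
          then have "x \<in> set J" using touch by blast
          then show ?thesis using J(3) by blast
        qed
      qed
      moreover have "set F \<union> set G \<union> set H \<subseteq> S \<union> {a, b, c}" using TX p(3) J(3) by auto
      ultimately show ?thesis using T by (intro exI[of _ k] exI[of _ F] exI[of _ G] exI[of _ H]) auto
    qed
  qed
  then show ?thesis using that(1) by blast
qed


section \<open>From a hole to a theta\<close>

lemma sep_disj: "sep X Y \<Longrightarrow> X \<inter> Y = {}" "sep X Y \<Longrightarrow> Y \<inter> X = {}"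
  unfolding sep_def by auto

lemma ipath_nonadj_length:
  assumes "ipath p" "a \<in> set p" "b \<in> set p" "a \<noteq> b" "\<not> E a b"
  shows "length p \<ge> 3"
proof (rule ccontr)
  assume n: "\<not> ?thesis"
  obtain x r where x: "p = x # r" using assms(2) by (cases p) auto
  show False
  proof (cases r)
    case Nil
    then show False using x assms by auto
  next
    case (Cons y r')
    then have "r' = []" using n x by (cases r') auto
    then have "p = [x, y]" using x Cons by simp
    then show False using assms E_sym by auto
  qed
qed

lemma ipath_append3:
  assumes "ipath p" "ipath q" "ipath r" "q \<noteq> []"
    and "set p \<inter> set q = {}" "set p \<inter> set r = {}" "set q \<inter> set r = {}"
    and "\<And>u v. u \<in> set p \<Longrightarrow> v \<in> set q \<Longrightarrow> E u v \<longleftrightarrow> u = last p \<and> v = hd q"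
    and "\<And>u v. u \<in> set p \<Longrightarrow> v \<in> set r \<Longrightarrow> \<not> E u v"
    and "\<And>u v. u \<in> set q \<Longrightarrow> v \<in> set r \<Longrightarrow> E u v \<longleftrightarrow> u = last q \<and> v = hd r"
  shows "ipath (p @ q @ r)"
proof -
  have qr: "ipath (q @ r)" using assms(2,3,7,10) by (subst ipath_append) blast
  have "E u v \<longleftrightarrow> u = last p \<and> v = hd (q @ r)" if "u \<in> set p" "v \<in> set (q @ r)" for u v
  proof (cases "v \<in> set q")
    case True
    then show ?thesis using assms(4,8) that by simp
  next
    case False
    then have "v \<in> set r" using that(2) by auto
    moreover have "hd q \<in> set q" using assms(4) by simp
    ultimately show ?thesis using assms(4,9) that(1) False by auto
  qed
  moreover have "set p \<inter> set (q @ r) = {}" using assms(5,6) by auto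
  ultimately show ?thesis using assms(1) qr by (subst ipath_append) blast
qed

text \<open>
  \<open>K\<close> and \<open>M\<close> form a hole that avoids \<open>S\<close>; the vertices \<open>q\<close> and \<open>d\<close>, linked through \<open>S\<close>, become
  the centres of a theta once the part of \<open>K\<close> spanned by the neighbours of \<open>q\<close> is replaced by \<open>q\<close>.
\<close>

lemma ring:
  assumes K: "ipath K" and M: "ipath (M1 @ B @ M2)"
    and KM: "set K \<inter> set (M1 @ B @ M2) = {}"
      "\<And>u v. u \<in> set K \<Longrightarrow> v \<in> set (M1 @ B @ M2) \<Longrightarrow> E u v \<longleftrightarrow>
        u = last K \<and> v = hd (M1 @ B @ M2) \<or> u = hd K \<and> v = last (M1 @ B @ M2)"
    and q: "q \<notin> set K" "q \<notin> set (M1 @ B @ M2)"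
      "a \<in> set K" "b \<in> set K" "a \<noteq> b" "\<not> E a b" "E q a" "E q b" "\<And>v. v \<in> set B \<Longrightarrow> E q v \<Longrightarrow> v = hd B"
    and d: "d \<notin> set K" "d \<notin> set (M1 @ B @ M2)" "d \<noteq> q" "\<not> E q d"
      "a' \<in> set B" "b' \<in> set B" "a' \<noteq> b'" "\<not> E a' b'" "E d a'" "E d b'"
    and S: "conn S" "sep S (set K)" "sep S (set (M1 @ B @ M2))" "q \<notin> S" "d \<notin> S" "meets {q} S" "meets {d} S"
  shows has_3pc
proof -
  let ?M = "M1 @ B @ M2"
  have Bne: "B \<noteq> []" using d(5) by auto
  have "\<exists>v\<in>set K. E q v" using q(3,7) by blast
  from split_list_first_prop[OF this] obtain C s K1 where
    s: "K = C @ s # K1" "E q s" "\<forall>y\<in>set C. \<not> E q y" by blast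
  have ab: "a = s \<or> a \<in> set K1" "b = s \<or> b \<in> set K1" using q(3,4,7,8) s by auto
  then have "\<exists>v\<in>set K1. E q v" using q(5,7,8) by blast
  from split_list_last_prop[OF this] obtain K2 t D where
    t: "K1 = K2 @ t # D" "E q t" "\<forall>y\<in>set D. \<not> E q y" by blast
  \<comment> \<open>\<open>s\<close> and \<open>t\<close> are the first and last neighbours of
    \<open>q\<close> on \<open>K\<close>; as \<open>q\<close> has two nonadjacent neighbours there,
    something lies between them.\<close>
  have K2ne: "K2 \<noteq> []"
  proof
    assume "K2 = []"
    then have "E s t" using K s t by (auto simp: ipath_append)
    moreover have "a = s \<or> a = t" "b = s \<or> b = t" using ab t q(7,8) \<open>K2 = []\<close> by auto
    ultimately show False using q(5,6) E_sym by blast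
  qed
  have Keq: "K = (C @ [s]) @ K2 @ (t # D)" using s t by simp
  have k1: "ipath (C @ [s])" "ipath (t # D)" using K unfolding Keq ipath_append by blast+
  have kd: "set (C @ [s]) \<inter> set (t # D) = {}" using K unfolding Keq by (auto simp: ipath_append)
  have ke: "\<not> E u v" if "u \<in> set (C @ [s])" "v \<in> set (t # D)" for u v
  proof -
    have "ipath ((C @ [s]) @ (K2 @ t # D))" using K unfolding Keq by simp
    then have "E u v \<Longrightarrow> v = hd (K2 @ t # D)" using that unfolding ipath_append[of "C @ [s]"] by auto
    moreover have "v \<noteq> hd (K2 @ t # D)"
    proof -
      have "hd (K2 @ t # D) \<in> set K2" using K2ne by simp
      moreover have "set K2 \<inter> set (t # D) = {}" using K unfolding Keq ipath_append by blast
      ultimately show ?thesis using that(2) by blast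
    qed
    ultimately show ?thesis by blast
  qed
  have hK: "hd K = hd (C @ [s])" "last K = last (t # D)" unfolding Keq by (cases C; simp)+
  have hin: "hd K \<in> set (C @ [s])" "last K \<in> set (t # D)" unfolding hK by (cases C; simp) (rule last_in_set, simp)
  have sub: "set (C @ [s]) \<subseteq> set K" "set (t # D) \<subseteq> set K" unfolding Keq by auto
  \<comment> \<open>The hole without \<open>K2\<close>, read from \<open>t\<close> the long way
    round to \<open>s\<close>.\<close>
  let ?O = "(t # D) @ ?M @ (C @ [s])"
  have Mne: "?M \<noteq> []" using Bne by simp
  have ipO: "ipath ?O"
  proof (rule ipath_append3[OF k1(2) M k1(1) Mne])
    show "set (t # D) \<inter> set ?M = {}" "set ?M \<inter> set (C @ [s]) = {}" using KM(1) sub by blast+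
    show "set (t # D) \<inter> set (C @ [s]) = {}" using kd by blast
    show "\<not> E u v" if "u \<in> set (t # D)" "v \<in> set (C @ [s])" for u v using ke[OF that(2,1)] E_sym by blast
    show "E u v \<longleftrightarrow> u = last (t # D) \<and> v = hd ?M" if uv: "u \<in> set (t # D)" "v \<in> set ?M" for u v
    proof -
      have "u \<noteq> hd K" using uv(1) hin(1) kd by blast
      then show ?thesis using KM(2)[OF subsetD[OF sub(2) uv(1)] uv(2)] hK(2) by simp
    qed
    show "E u v \<longleftrightarrow> u = last ?M \<and> v = hd (C @ [s])" if uv: "u \<in> set ?M" "v \<in> set (C @ [s])" for u v
    proof -
      have "v \<noteq> last K" using uv(2) hin(2) kd by blast
      then show ?thesis using KM(2)[OF subsetD[OF sub(1) uv(2)] uv(1)] hK(1) E_commute[of u v] by auto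
    qed
  qed
  obtain b0 B' where B: "B = b0 # B'" using Bne by (cases B) auto
  \<comment> \<open>\<open>x\<close> is the last neighbour of \<open>q\<close> up to the head of
    \<open>B\<close>, and \<open>y\<close> the first one after \<open>B\<close>; they exist because
    of \<open>t\<close> and \<open>s\<close>. The stretch \<open>?P\<close> between them contains
    \<open>B\<close>, and \<open>q\<close> sees only its two ends.\<close>
  have "\<exists>v\<in>set ((t # D) @ M1 @ [b0]). E q v" using t(2) by auto
  from split_list_last_prop[OF this] obtain \<alpha>1 x \<alpha>2 where
    x: "(t # D) @ M1 @ [b0] = \<alpha>1 @ x # \<alpha>2" "E q x" "\<forall>v\<in>set \<alpha>2. \<not> E q v" by blast
  have "\<exists>v\<in>set (M2 @ C @ [s]). E q v" using s(2) by auto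
  from split_list_first_prop[OF this] obtain \<gamma>1 y \<gamma>2 where
    y: "M2 @ C @ [s] = \<gamma>1 @ y # \<gamma>2" "E q y" "\<forall>v\<in>set \<gamma>1. \<not> E q v" by blast
  let ?P = "x # \<alpha>2 @ B' @ \<gamma>1 @ [y]"
  have Oeq: "?O = \<alpha>1 @ ?P @ \<gamma>2"
  proof -
    have "?O = ((t # D) @ M1 @ [b0]) @ B' @ (M2 @ C @ [s])" using B by simp
    also have "\<dots> = (\<alpha>1 @ x # \<alpha>2) @ B' @ (\<gamma>1 @ y # \<gamma>2)" by (simp only: x(1) y(1))
    finally show ?thesis by simp
  qed
  have ipP: "ipath ?P" using ipO unfolding Oeq by (rule ipath_sub)
  have b0in: "b0 \<in> set (x # \<alpha>2)"
  proof -
    have "last (x # \<alpha>2) = last (\<alpha>1 @ x # \<alpha>2)" by simp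
    also have "\<dots> = b0" unfolding x(1)[symmetric] by simp
    finally show ?thesis using last_in_set[of "x # \<alpha>2"] by simp
  qed
  have BP: "set B \<subseteq> set ?P" using b0in B by auto
  have ipB: "ipath B" using M ipath_sub by blast
  have qP: "v = x \<or> v = y" if "v \<in> set ?P" "E q v" for v
  proof -
    have "v \<notin> set B'"
    proof
      assume v: "v \<in> set B'"
      then have "v = b0" using q(9)[of v] that(2) B by simp
      then show False using v ipB B by simp
    qed
    then show ?thesis using that x(3) y(3) by auto
  qed
  have OKM: "set ?O \<subseteq> set K \<union> set ?M" using sub by auto
  have PKM: "set ?P \<subseteq> set K \<union> set ?M" using OKM unfolding Oeq by auto
  have notP: "q \<notin> set ?P" "d \<notin> set ?P" using PKM q(1,2) d(1,2) by blast+
  have SP: "z \<noteq> v \<and> \<not> E z v \<and> \<not> E v z" if "z \<in> S" "v \<in> set ?P" for z v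
    using sepD[OF S(2) that(1), of v] sepD[OF S(3) that(1), of v] PKM that(2) by blast
  have len: "length ?P \<ge> 3"
    using ipath_nonadj_length[OF ipP] BP d(5-8) by blast
  have xy: "\<not> E x y" "x \<noteq> y" using ipath_nonadj_ends[OF ipP len] by auto
  \<comment> \<open>A path from \<open>q\<close> to \<open>d\<close> through \<open>S\<close>. Its
    interior \<open>w2\<close> is nonempty since \<open>q\<close> and \<open>d\<close> are
    nonadjacent, and its first vertex is the third end of both tripods.\<close>
  have "conn (insert q (insert d S))"
    by (intro conn_insert[OF conn_insert[OF S(1)]]) (use S(6,7) in \<open>auto simp: meets_def\<close>)
  then obtain w where w: "ipath w" "w \<noteq> []" "hd w = q" "last w = d" "set w \<subseteq> insert q (insert d S)"
    by (rule conn_path[of _ q d]) auto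
  obtain w1 where w1: "w = q # w1" using w(2,3) by (cases w) auto
  have w1ne: "w1 \<noteq> []" using w1 w(4) d(3) by auto
  then obtain w2 where w2: "w1 = w2 @ [d]" using w(4) w1 by (metis append_butlast_last_id last_ConsR)
  have w2ne: "w2 \<noteq> []"
  proof
    assume "w2 = []"
    then have "E q d" using w(1) unfolding w1 w2 by simp
    then show False using d(4) by blast
  qed
  have ipw: "ipath (w2 @ [d])" using w(1) unfolding w1 w2 by simp
  have w2S: "set w2 \<subseteq> S"
  proof
    fix u assume u: "u \<in> set w2"
    have "u \<noteq> q" using w(1) u unfolding w1 w2 by auto
    moreover have "u \<noteq> d" using ipw u by (auto simp: ipath_append)
    ultimately show "u \<in> S" using w(5) u unfolding w1 w2 by auto
  qed
  have qw: "E q v \<longleftrightarrow> v = hd w2" if "v \<in> set w2" for v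
    using w(1) that w2ne unfolding w1 w2 by auto
  let ?Z = "set (w2 @ [d])" and ?h = "hd w2"
  have hS: "?h \<in> set w2" "?h \<in> S" using w2ne w2S by auto
  have cZ: "conn ?Z" by (rule conn_ipath[OF ipw]) simp
  have ZP: "?Z \<inter> set ?P = {}"
  proof -
    have "v \<notin> set ?P" if v: "v \<in> ?Z" for v
    proof (cases "v = d")
      case True
      then show ?thesis using notP(2) by blast
    next
      case False
      then have "v \<in> S" using v w2S by auto
      then show ?thesis using SP by blast
    qed
    then show ?thesis by blast
  qed
  have Zd: "z = d" if "z \<in> ?Z" "v \<in> set ?P" "E z v" for z v
    using that SP[of z v] w2S by auto
  have mZ: "meets ?Z (set ?P)" using d(5,9) BP unfolding meets_def by auto
  have hZ: "?h \<in> ?Z" using hS(1) by simp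
  have lastP: "hd ?P = x" "last ?P = y" by simp_all
  have "claw q (q # [x]) (q # [y]) (q # [?h])"
    unfolding claw_def
  proof (intro conjI armI)
    have n: "\<not> E y x" "x \<noteq> ?h" "\<not> E x ?h" "y \<noteq> ?h" "\<not> E y ?h" "q \<noteq> x" "q \<noteq> y" "q \<noteq> ?h" "E x q" "E y q" "E q ?h"
      using xy SP[OF hS(2), of x] SP[OF hS(2), of y] x(2) y(2) E_sym notP(1) hS S(4) qw[OF hS(1)] by auto
    show "ipath (rev [x] @ q # [y])" using n xy y(2) by auto
    show "ipath (rev [x] @ q # [?h])" using n by auto
    show "ipath (rev [y] @ q # [?h])" using n by auto
  qed
  then have Tq: "tripod (Some q) [q, x] [q, y] [q, ?h]" by simp
  show ?thesis
  proof (rule ccontr)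
    assume no: "\<not> has_3pc"
    show False
    proof (rule attach[OF ipP _ cZ ZP hZ mZ])
      show "?P \<noteq> []" by simp
      fix k F G H
      assume T: "tripod k F G H" "last F = hd ?P" "last G = last ?P" "last H = ?h"
        and TX: "set F \<union> set G \<union> set H \<subseteq> set ?P \<union> ?Z"
        and out: "(\<exists>c J. k = Some c \<and> c \<in> set ?P \<and> ipath J \<and> J \<noteq> [] \<and> hd J = ?h \<and> set J \<subseteq> ?Z \<and>
            (\<forall>b\<in>set J. \<forall>a\<in>set ?P. E b a \<longleftrightarrow> b = last J \<and> a = c)) \<or>
          (\<exists>c. k = Some c \<and> c \<in> ?Z \<and> (\<exists>a\<in>set ?P. \<exists>b\<in>set ?P. a \<noteq> b \<and> \<not> E a b \<and> E c a \<and> E c b)) \<or>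
          (k = None \<and> (\<exists>j\<in>?Z. \<exists>a\<in>set ?P. \<exists>b\<in>set ?P. hd F = a \<and> hd G = b \<and> hd H = j \<and> E a b \<and>
            (\<forall>v\<in>set ?P. E j v \<longleftrightarrow> v = a \<or> v = b)))"
      have da: "a' \<in> set ?P" "b' \<in> set ?P" using BP d(5,6) by blast+
      \<comment> \<open>Only \<open>d\<close> touches \<open>?P\<close> from \<open>?Z\<close>, and
        its nonadjacent neighbours \<open>a'\<close> and \<open>b'\<close> rule out the other two
        outcomes of \<open>attach\<close>.\<close>
      have kd: "k = Some d"
        using out
      proof (elim disjE exE conjE)
        fix c J assume c: "c \<in> set ?P" "J \<noteq> []" "set J \<subseteq> ?Z" "\<forall>b\<in>set J. \<forall>a\<in>set ?P. E b a \<longleftrightarrow> b = last J \<and> a = c"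
        have l: "last J \<in> set J" using c(2) by simp
        then have "E (last J) c" using c(1,4) by blast
        then have "last J = d" using Zd[of "last J" c] l c(1,3) by blast
        then have "d \<in> set J" using l by simp
        then have "a' = c" "b' = c" using c(4) da d(9,10) by blast+
        then show ?thesis using d(7) by blast
      next
        fix c assume c: "k = Some c" "c \<in> ?Z" "\<exists>a\<in>set ?P. \<exists>b\<in>set ?P. a \<noteq> b \<and> \<not> E a b \<and> E c a \<and> E c b"
        then have "c = d" using Zd by blast
        then show ?thesis using c(1) by simp
      next
        assume "\<exists>j\<in>?Z. \<exists>a\<in>set ?P. \<exists>b\<in>set ?P. hd F = a \<and> hd G = b \<and> hd H = j \<and> E a b \<and>
            (\<forall>v\<in>set ?P. E j v \<longleftrightarrow> v = a \<or> v = b)"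
        then obtain j a0 b0 where j: "j \<in> ?Z" "a0 \<in> set ?P" "b0 \<in> set ?P" "E a0 b0"
          "\<forall>v\<in>set ?P. E j v \<longleftrightarrow> v = a0 \<or> v = b0" by blast
        then have "j = d" using Zd by blast
        then have "a' = a0 \<or> a' = b0" "b' = a0 \<or> b' = b0" using j(5) da d(9,10) by blast+
        then have "E a' b'" using d(7) j(4) E_sym by blast
        then show ?thesis using d(8) by blast
      qed
      have lasts: "last F = x" "last G = y" using T(2,3) by auto
      let ?X = "{q, x, y, ?h}"
      have hn: "x \<noteq> ?h" "y \<noteq> ?h" "\<not> E x ?h" "\<not> E y ?h"
        using SP[OF hS(2), of x] SP[OF hS(2), of y] by auto
      have sX: "set [q, x] \<union> set [q, y] \<union> set [q, ?h] \<subseteq> ?X" by auto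
      have qZ: "q \<notin> ?Z" using d(3) w2S S(4) by auto
      have XY: "?X \<inter> (set ?P \<union> ?Z) \<subseteq> {x, y, ?h}" using notP(1) qZ by blast
      have cross: "u \<in> {x, y, ?h} \<or> v \<in> {x, y, ?h}" if "u \<in> ?X" "v \<in> set ?P \<union> ?Z" "E u v" for u v
      proof (cases "u = q")
        case True
        have "v \<in> set ?P \<or> v \<in> set w2 \<or> v = d" using that(2) by auto
        then show ?thesis using True that(3) qP qw d(4) by blast
      qed (use that(1) in blast)
      show False
      proof (rule glue_sets[OF Tq _ _ _ sX T(1) lasts T(4) TX xy(2) hn(1,2) xy(1) hn(3,4) XY cross no])
        fix c c' assume "Some q = Some c" "k = Some c'" "c = c' \<or> E c c'"
        then show False using kd d(3,4) by auto
      next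
        fix c assume "k = None"
        then show False using kd by simp
      next
        fix c assume "Some q = None"
        then show False by simp
      qed simp_all
    qed
  qed
qed

end

subsection \<open>Three fat sets with different middles\<close>

text \<open>Everything is stated for an arbitrary order of the three indices, so that symmetric
  copies come from \<open>idx3_perm\<close>.\<close>

definition idx3 :: "nat \<Rightarrow> nat \<Rightarrow> nat \<Rightarrow> bool" where
  "idx3 j k l \<longleftrightarrow> distinct [j, k, l] \<and> j < 3 \<and> k < 3 \<and> l < 3"

lemma idx3_perm: "idx3 j k l \<Longrightarrow> idx3 k j l" "idx3 j k l \<Longrightarrow> idx3 j l k" "idx3 j k l \<Longrightarrow> idx3 k l j"
    "idx3 j k l \<Longrightarrow> idx3 l j k" "idx3 j k l \<Longrightarrow> idx3 l k j"
  unfolding idx3_def by auto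

text \<open>
  \<open>f j k\<close> is the path of the \<open>j\<close>-th fat set, read from its end at \<open>A k\<close>; its middle is attached to \<open>A j\<close>.
  The skinny set is \<open>S\<close>.
\<close>

locale hexagon = sgraph E for E :: "'a \<Rightarrow> 'a \<Rightarrow> bool" +
  fixes A :: "nat \<Rightarrow> 'a set" and f :: "nat \<Rightarrow> nat \<Rightarrow> 'a list" and S :: "'a set"
  assumes connA: "idx3 j k l \<Longrightarrow> conn (A j)"
    and sepA: "idx3 j k l \<Longrightarrow> sep (A j) (A k)"
    and fpath: "idx3 j k l \<Longrightarrow> ipath (f j k)"
    and flen: "idx3 j k l \<Longrightarrow> 3 \<le> length (f j k)"
    and frev: "idx3 j k l \<Longrightarrow> f j l = rev (f j k)"
    and fatt: "idx3 j k l \<Longrightarrow> att (A k) (f j k) (hd (f j k))"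
    and fdis: "idx3 j k l \<Longrightarrow> A j \<inter> set (f j k) = {}"
    and fmid: "idx3 j k l \<Longrightarrow> meets (A j) (set (f j k))"
    and sepf: "idx3 j k l \<Longrightarrow> sep (set (f j k)) (set (f k j))"
    and connS: "conn S"
    and Sdis: "idx3 j k l \<Longrightarrow> A j \<inter> S = {}"
    and Smeets: "idx3 j k l \<Longrightarrow> meets (A j) S"
    and Ssep: "idx3 j k l \<Longrightarrow> sep S (set (f j k))"
    and Sskinny: "idx3 j k l \<Longrightarrow> skinny (A j) (A k) (A l) S"
    and no: "\<not> has_3pc"
begin

abbreviation e :: "nat \<Rightarrow> nat \<Rightarrow> 'a" where
  "e j k \<equiv> hd (f j k)"

lemma fset: "idx3 j k l \<Longrightarrow> set (f j l) = set (f j k)"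
  using frev by simp

lemma fne: "idx3 j k l \<Longrightarrow> f j k \<noteq> []"
  using flen by fastforce

lemma flast: "idx3 j k l \<Longrightarrow> last (f j k) = e j l"
  using frev[of j k l] fne[of j k l] by (simp add: hd_rev)

lemma e_in: "idx3 j k l \<Longrightarrow> e j k \<in> set (f j k)"
  using fne by simp

lemma fatt': "idx3 j k l \<Longrightarrow> att (A l) (f j k) (e j l)"
  using fatt[OF idx3_perm(2), of j k l] fset[of j k l] unfolding att_def by simp

lemma f_adj: "idx3 j k l \<Longrightarrow> x \<in> set (f j k) \<Longrightarrow> y \<in> set (f k j) \<Longrightarrow> x \<noteq> y \<and> \<not> E x y \<and> \<not> E y x"
  using sepD[OF sepf] .

lemma attach_S:
  assumes i: "idx3 j k l" and Z: "conn Z" "Z \<subseteq> A j" "meets Z S" "meets Z (set (f j k))"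
  shows "\<exists>q\<in>Z. meets {q} S \<and> (\<exists>a\<in>set (f j k). \<exists>b\<in>set (f j k). a \<noteq> b \<and> \<not> E a b \<and> E q a \<and> E q b)"
proof (rule skinny_attach[of "f j k" "A j" "A k" "A l" S Z])
  note p = idx3_perm[OF i]
  show "ipath (f j k)" "3 \<le> length (f j k)" using fpath flen i by auto
  show "sep (A j) (A k)" "sep (A j) (A l)" "sep (A k) (A l)" using sepA i p by auto
  show "sep S (set (f j k))" using Ssep i by auto
  show "A j \<inter> S = {}" "A k \<inter> S = {}" "A l \<inter> S = {}" using Sdis i p by blast+
  show "A j \<inter> set (f j k) = {}" using fdis i by blast
  show "A k \<inter> set (f j k) = {}" using fatt[OF i] unfolding att_def by blast
  show "A l \<inter> set (f j k) = {}" using fatt'[OF i] unfolding att_def by blast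
  show "conn (A k)" "conn (A l)" "meets (A k) S" "meets (A l) S" using connA Smeets p by blast+
  show "\<exists>u\<in>A k. E u (hd (f j k))" using fatt[OF i] unfolding att_def by blast
  show "\<exists>u\<in>A l. E u (last (f j k))" using fatt'[OF i] unfolding att_def flast[OF i] by blast
  show "v = hd (f j k)" if "u \<in> A k" "v \<in> set (f j k)" "E u v" for u v
    using att_edge[OF fatt[OF i] that(1,2)] that(3) by blast
  show "v = last (f j k)" if "u \<in> A l" "v \<in> set (f j k)" "E u v" for u v
    using att_edge[OF fatt'[OF i] that(1,2)] that(3) flast[OF i] by simp
  show "skinny (A j) (A k) (A l) S" using Sskinny i .
qed (use Z no in auto)

text \<open>The connections that close the hole: from the end \<open>e j k\<close> of one fat path
  to the end \<open>e k j\<close> of another. The alternative \<open>fat_pair\<close> leaves open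
  whether the connection lies in \<open>A j\<close> or in \<open>A k\<close>.\<close>

definition link :: "nat \<Rightarrow> nat \<Rightarrow> 'a list \<Rightarrow> bool" where
  "link j k J \<longleftrightarrow> J \<noteq> [] \<and> ipath J \<and> (set J \<subseteq> A j \<or> set J \<subseteq> A k) \<and>
    (\<forall>u\<in>set J. \<forall>v\<in>set (f j k). E u v \<longleftrightarrow> u = hd J \<and> v = e j k) \<and>
    (\<forall>u\<in>set J. \<forall>v\<in>set (f k j). E u v \<longleftrightarrow> u = last J \<and> v = e k j) \<and> sep (set J) S"

lemma link_sym: "link j k J \<Longrightarrow> link k j (rev J)"
  unfolding link_def by (auto simp: hd_rev last_rev)

text \<open>The path supplied by \<open>fat_pair\<close> loses its first vertex
  \<open>e k j\<close>, and the rest lies in \<open>A j\<close>. If the rest touched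
  \<open>S\<close>, then by \<open>attach_S\<close> one of its vertices would see two vertices of
  the \<open>j\<close>-th path, but only \<open>e j k\<close> is seen.\<close>

lemma link_half:
  assumes i: "idx3 j k l" and J: "ipath J" "J \<noteq> []" "hd J = e k j" "set J \<subseteq> insert (e k j) (A j)"
    "\<forall>b\<in>set J. \<forall>a\<in>set (f j k). E b a \<longleftrightarrow> b = last J \<and> a = e j k"
  shows "link k j (tl J)"
proof -
  note p = idx3_perm[OF i]
  obtain T where T: "J = e k j # T" using J(2,3) by (cases J) auto
  have lJ: "E (last J) (e j k)" using J(2,5) e_in[OF i] by simp
  have Tne: "T \<noteq> []"
  proof
    assume "T = []"
    then show False using lJ T f_adj[OF i e_in[OF i] e_in[OF p(1)]] by simp
  qed
  have TA: "set T \<subseteq> A j" using J(1,4) T by auto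
  have ipT: "ipath T" using J(1) T by simp
  have 1: "E u v \<longleftrightarrow> u = last T \<and> v = e j k" if "u \<in> set T" "v \<in> set (f j k)" for u v
    using J(5) that T Tne by auto
  have 2: "E u v \<longleftrightarrow> u = hd T \<and> v = e k j" if uv: "u \<in> set T" "v \<in> set (f k j)" for u v
  proof -
    have u: "u \<in> A j" using uv(1) TA by blast
    have "E (e k j) u \<longleftrightarrow> u = hd T" using J(1) T uv(1) by auto
    moreover have "E u v \<Longrightarrow> v = e k j" using att_edge[OF fatt[OF p(1)] u uv(2)] by blast
    ultimately show ?thesis using E_commute by blast
  qed
  have "sep (set T) S"
  proof (rule ccontr)
    assume "\<not> sep (set T) S"
    moreover have "set T \<inter> S = {}" using TA Sdis[OF i] by blast
    ultimately have "meets (set T) S" unfolding sep_def meets_def by blast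
    moreover have "meets (set T) (set (f j k))"
      using 1[of "last T" "e j k"] Tne e_in[OF i] unfolding meets_def by auto
    ultimately obtain q a b where "q \<in> set T" "a \<in> set (f j k)" "b \<in> set (f j k)" "a \<noteq> b" "E q a" "E q b"
      using attach_S[OF i conn_ipath[OF ipT Tne] TA] by blast
    then show False using 1 by blast
  qed
  then show ?thesis
    using T Tne ipT TA 1 2 unfolding link_def by simp
qed

lemma link_exists:
  assumes i: "idx3 j k l"
  shows "\<exists>J. link j k J"
proof -
  note p = idx3_perm[OF i]
  have "(\<exists>J. ipath J \<and> J \<noteq> [] \<and> hd J = hd (f k j) \<and> set J \<subseteq> insert (hd (f k j)) (A j) \<and>
      (\<forall>b\<in>set J. \<forall>a\<in>set (f j k). E b a \<longleftrightarrow> b = last J \<and> a = hd (f j k))) \<or>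
    (\<exists>J. ipath J \<and> J \<noteq> [] \<and> hd J = hd (f j k) \<and> set J \<subseteq> insert (hd (f j k)) (A k) \<and>
      (\<forall>b\<in>set J. \<forall>a\<in>set (f k j). E b a \<longleftrightarrow> b = last J \<and> a = hd (f k j)))"
  proof (rule fat_pair[of "f j k" "f k j" "A j" "A k" "A l"])
    show "ipath (f j k)" "3 \<le> length (f j k)" "ipath (f k j)" "3 \<le> length (f k j)" using fpath flen i p by auto
    show "sep (A j) (A k)" "sep (A j) (A l)" "sep (A k) (A l)" using sepA i p by auto
    show "sep (set (f j k)) (set (f k j))" using sepf i by auto
    show "A j \<inter> set (f j k) = {}" "A k \<inter> set (f k j) = {}" using fdis i p by blast+
    show "A k \<inter> set (f j k) = {}" "A j \<inter> set (f k j) = {}" using fatt[OF i] fatt[OF p(1)] unfolding att_def by blast+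
    show "A l \<inter> set (f j k) = {}" "A l \<inter> set (f k j) = {}" using fatt'[OF i] fatt'[OF p(1)] unfolding att_def by blast+
    show "conn (A j)" "conn (A k)" "conn (A l)" using connA i p by blast+
    show "\<exists>u\<in>A k. E u (hd (f j k))" "\<exists>u\<in>A j. E u (hd (f k j))"
      using fatt[OF i] fatt[OF p(1)] unfolding att_def by blast+
    show "\<exists>u\<in>A l. E u (last (f j k))" "\<exists>u\<in>A l. E u (last (f k j))"
      using fatt'[OF i] fatt'[OF p(1)] unfolding att_def flast[OF i] flast[OF p(1)] by blast+
    show "v = hd (f j k)" if "u \<in> A k" "v \<in> set (f j k)" "E u v" for u v
      using att_edge[OF fatt[OF i] that(1,2)] that(3) by blast
    show "v = last (f j k)" if "u \<in> A l" "v \<in> set (f j k)" "E u v" for u v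
      using att_edge[OF fatt'[OF i] that(1,2)] that(3) flast[OF i] by simp
    show "v = hd (f k j)" if "u \<in> A j" "v \<in> set (f k j)" "E u v" for u v
      using att_edge[OF fatt[OF p(1)] that(1,2)] that(3) by blast
    show "v = last (f k j)" if "u \<in> A l" "v \<in> set (f k j)" "E u v" for u v
      using att_edge[OF fatt'[OF p(1)] that(1,2)] that(3) flast[OF p(1)] by simp
    show "meets (A j) (set (f j k))" "meets (A k) (set (f k j))" using fmid i p by blast+
  qed (rule no)
  then show ?thesis
    using link_half[OF i] link_half[OF p(1)] link_sym by blast
qed

text \<open>Hubs of two different sets are what \<open>ring\<close> uses as the centres of the
  theta.\<close>

lemma hub:
  assumes i: "idx3 j k l"
  obtains q a b where "q \<in> A j" "meets {q} S" "q \<notin> S" "a \<in> set (f j k)" "b \<in> set (f j k)" "a \<noteq> b" "\<not> E a b" "E q a" "E q b"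
  using attach_S[OF i connA[OF i] order_refl Smeets[OF i] fmid[OF i]] Sdis[OF i] that by blast

text \<open>Such a \<open>\<Gamma>\<close> joins the \<open>k\<close>-th and the \<open>l\<close>-th
  fat path at their ends at \<open>A j\<close>; a link joins their other ends. The resulting hole
  avoids the \<open>j\<close>-th path, and the hubs in \<open>A k\<close> and \<open>A l\<close>
  give a theta there.\<close>

lemma no_shortcut:
  assumes i: "idx3 j k l" and G: "conn \<Gamma>" "\<Gamma> \<subseteq> A j" "sep \<Gamma> S" "\<exists>u\<in>\<Gamma>. E u (e k j)" "\<exists>u\<in>\<Gamma>. E u (e l j)"
  shows False
proof -
  note p = idx3_perm[OF i]
  have ek: "e k j \<in> set (f k j)" "e l j \<in> set (f l k)"
    using e_in[OF p(1)] e_in[OF p(4)] fset[OF p(4)] by auto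
  have ekl: "e l j \<noteq> e k j" "\<not> E (e l j) (e k j)"
    using f_adj[OF p(3), of "e k j" "e l j"] ek fset[OF p(1)] by auto
  have "conn (insert (e l j) (insert (e k j) \<Gamma>))"
    by (intro conn_insert[OF conn_insert[OF G(1)]]) (use G(4,5) E_sym in blast)+
  then obtain w where w: "ipath w" "w \<noteq> []" "hd w = e l j" "last w = e k j" "set w \<subseteq> insert (e l j) (insert (e k j) \<Gamma>)"
    by (rule conn_path[of _ "e l j" "e k j"]) auto
  obtain w1 where w1: "w = e l j # w1" using w(2,3) by (cases w) auto
  have "w1 \<noteq> []" using w1 w(4) ekl(1) by auto
  then obtain P where P: "w1 = P @ [e k j]" using w(4) w1 by (metis append_butlast_last_id last_ConsR)
  have Pne: "P \<noteq> []"
  proof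
    assume "P = []"
    then have "E (e l j) (e k j)" using w(1) unfolding w1 P by simp
    then show False using ekl by blast
  qed
  have ipw: "ipath (P @ [e k j])" using w(1) unfolding w1 P by simp
  then have ipP: "ipath P" by (simp add: ipath_append)
  have PG: "set P \<subseteq> \<Gamma>"
  proof
    fix u assume u: "u \<in> set P"
    have "u \<noteq> e l j" using w(1) u unfolding w1 P by auto
    moreover have "u \<noteq> e k j" using ipw u by (auto simp: ipath_append)
    ultimately show "u \<in> \<Gamma>" using w(5) u unfolding w1 P by auto
  qed
  then have PA: "set P \<subseteq> A j" using G(2) by blast
  have Pk: "E u v \<longleftrightarrow> u = last P \<and> v = e k j" if uv: "u \<in> set P" "v \<in> set (f k j)" for u v
  proof -
    have "E u v \<Longrightarrow> v = e k j" using att_edge[OF fatt[OF p(1)] _ uv(2)] uv(1) PA by blast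
    moreover have "E u (e k j) \<longleftrightarrow> u = last P" using ipw uv(1) by (auto simp: ipath_append)
    ultimately show ?thesis by blast
  qed
  have Pl: "E v u \<longleftrightarrow> v = e l j \<and> u = hd P" if uv: "u \<in> set P" "v \<in> set (f l k)" for u v
  proof -
    have "v \<in> set (f l j)" using uv(2) fset[OF p(4)] by simp
    then have "E v u \<Longrightarrow> v = e l j" using att_edge[OF fatt[OF p(4)], of u v] uv(1) PA by blast
    moreover have "E (e l j) u \<longleftrightarrow> u = hd P" using w(1) uv(1) Pne unfolding w1 P by auto
    ultimately show ?thesis by blast
  qed
  obtain J where J: "link k l J" using link_exists[OF p(3)] by blast
  have J': "J \<noteq> []" "ipath J" "set J \<subseteq> A k \<or> set J \<subseteq> A l"
     "\<And>u v. u \<in> set J \<Longrightarrow> v \<in> set (f k l) \<Longrightarrow> E u v \<longleftrightarrow> u = hd J \<and> v = e k l"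
     "\<And>u v. u \<in> set J \<Longrightarrow> v \<in> set (f l k) \<Longrightarrow> E u v \<longleftrightarrow> u = last J \<and> v = e l k" "sep (set J) S"
    using J unfolding link_def by blast+
  have Jk: "set J \<inter> set (f k j) = {}" "set J \<inter> set (f l k) = {}"
  proof -
    have "A k \<inter> set (f k j) = {}" "A l \<inter> set (f k j) = {}" "A k \<inter> set (f l k) = {}" "A l \<inter> set (f l k) = {}"
      using fdis[OF p(1)] fatt'[OF p(1)] fatt[OF p(5)] fdis[OF p(5)] unfolding att_def by blast+
    then show "set J \<inter> set (f k j) = {}" "set J \<inter> set (f l k) = {}" using J'(3) by blast+
  qed
  have Pd: "set P \<inter> set (f k j) = {}" "set P \<inter> set (f l k) = {}"
    using PA fatt[OF p(1)] fatt'[OF p(5)] unfolding att_def by blast+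
  have JP: "u \<noteq> v \<and> \<not> E u v" if "u \<in> set J" "v \<in> set P" for u v
    using J'(3) that PA sepD[OF sepA[OF p(1)], of u v] sepD[OF sepA[OF p(4)], of u v] by blast
  have ll: "last (f l k) = e l j" using flast[OF p(5)] .
  have lk: "last (f k j) = e k l" using flast[OF p(1)] .
  have kl: "set (f k l) = set (f k j)" using fset[OF p(1)] .
  let ?M = "J @ f l k @ P"
  have ipM: "ipath ?M"
  proof (rule ipath_append3[OF J'(2) fpath[OF p(5)] ipP fne[OF p(5)]])
    show "set J \<inter> set (f l k) = {}" "set J \<inter> set P = {}" "set (f l k) \<inter> set P = {}" using Jk(2) JP Pd(2) by blast+
    show "E u v \<longleftrightarrow> u = last (f l k) \<and> v = hd P" if "u \<in> set (f l k)" "v \<in> set P" for u v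
      using Pl[OF that(2,1)] ll by simp
  qed (use J'(5) JP in blast)+
  have hM: "hd ?M = hd J" "last ?M = last P" using J'(1) Pne by simp_all
  obtain q a b where q: "q \<in> A k" "meets {q} S" "q \<notin> S" "a \<in> set (f k j)" "b \<in> set (f k j)" "a \<noteq> b" "\<not> E a b" "E q a" "E q b"
    by (rule hub[OF p(1)])
  obtain d a' b' where d: "d \<in> A l" "meets {d} S" "d \<notin> S" "a' \<in> set (f l k)" "b' \<in> set (f l k)" "a' \<noteq> b'" "\<not> E a' b'" "E d a'" "E d b'"
    by (rule hub[OF p(5)])
  have out: "x \<notin> set J \<and> x \<notin> set P" if "meets {x} S" for x
    using that J'(6) G(3) PG unfolding meets_def sep_def by blast
  have qd: "d \<noteq> q" "\<not> E q d" using sepD[OF sepA[OF p(3)] q(1) d(1)] by auto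
  have qK: "q \<notin> set (f k j)" "q \<notin> set (f l k)" using q(1) fdis[OF p(1)] fatt[OF p(5)] unfolding att_def by blast+
  have dK: "d \<notin> set (f k j)" "d \<notin> set (f l k)" using d(1) fatt'[OF p(1)] fdis[OF p(5)] unfolding att_def by blast+
  have has_3pc
  \<comment> \<open>The orientation \<open>f l k\<close> puts the only vertex that
    \<open>A k\<close>, and hence \<open>q\<close>, can see on this path at its head, as
    \<open>ring\<close> demands.\<close>
  proof (rule ring[of "f k j" J "f l k" P q a b d a' b' S])
    show "ipath (f k j)" using fpath p by blast
    show "ipath ?M" by (rule ipM)
    show "set (f k j) \<inter> set ?M = {}" using Jk(1) Pd(1) sep_disj(1)[OF sepf[OF p(3)]] kl
      by (simp add: Int_Un_distrib Int_commute)
    show "E u v \<longleftrightarrow> u = last (f k j) \<and> v = hd ?M \<or> u = hd (f k j) \<and> v = last ?M"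
      if uv: "u \<in> set (f k j)" "v \<in> set ?M" for u v
    proof -
      have uk: "u \<in> set (f k l)" using uv(1) kl by simp
      have hJ: "hd J \<in> set J" "last P \<in> set P" using J'(1) Pne by auto
      consider "v \<in> set J" | "v \<in> set (f l k)" | "v \<in> set P" using uv(2) by auto
      then show ?thesis
        unfolding hM lk
      proof cases
        case 1
        have "v \<noteq> last P" using JP[OF 1 hJ(2)] by blast
        then show "E u v \<longleftrightarrow> u = e k l \<and> v = hd J \<or> u = e k j \<and> v = last P"
          using J'(4)[OF 1 uk] E_commute[of u v] by blast
      next
        case 2
        have "v \<noteq> hd J" "v \<noteq> last P" using 2 Jk(2) Pd(2) hJ by blast+
        then show "E u v \<longleftrightarrow> u = e k l \<and> v = hd J \<or> u = e k j \<and> v = last P"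
          using f_adj[OF p(3) uk 2] by blast
      next
        case 3
        have "v \<noteq> hd J" using JP[OF hJ(1) 3] by blast
        then show "E u v \<longleftrightarrow> u = e k l \<and> v = hd J \<or> u = e k j \<and> v = last P"
          using Pk[OF 3 uv(1)] E_commute[of u v] by blast
      qed
    qed
    show "q \<notin> set ?M" "d \<notin> set ?M" using out[OF q(2)] out[OF d(2)] qK dK by auto
    show "v = hd (f l k)" if "v \<in> set (f l k)" "E q v" for v
      using att_edge[OF fatt[OF p(5)] q(1) that(1)] that(2) by blast
    show "sep S (set (f k j))" using Ssep p by blast
    show "sep S (set ?M)"
      using sep_sym[OF J'(6)] Ssep[OF p(5)] sep_sym[OF sep_mono[OF G(3) PG order_refl]] by (simp add: sep_Un)
  qed (use q d qd qK dK connS in auto)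
  then show False using no by blast
qed

text \<open>Links in different sets are as far apart as the sets; two links in \<open>A j\<close>
  that touch would together be a shortcut.\<close>

lemma links_sep:
  assumes i: "idx3 j k l" and J: "link j k J" "link j l J'"
  shows "sep (set J) (set J')"
proof (rule ccontr)
  assume n: "\<not> ?thesis"
  note p = idx3_perm[OF i]
  have J1: "J \<noteq> []" "ipath J" "set J \<subseteq> A j \<or> set J \<subseteq> A k" "sep (set J) S" "E (last J) (e k j)"
    and J2: "J' \<noteq> []" "ipath J'" "set J' \<subseteq> A j \<or> set J' \<subseteq> A l" "sep (set J') S" "E (last J') (e l j)"
    using J e_in[OF p(1)] e_in[OF p(4)] unfolding link_def by (auto simp: last_in_set)
  have in_j: "set J \<subseteq> A j \<and> set J' \<subseteq> A j"
  proof (rule ccontr)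
    assume "\<not> ?thesis"
    then consider "set J \<subseteq> A k" "set J' \<subseteq> A j" | "set J \<subseteq> A k" "set J' \<subseteq> A l" | "set J \<subseteq> A j" "set J' \<subseteq> A l"
      using J1(3) J2(3) by blast
    then have "sep (set J) (set J')"
    proof cases
      case 1 then show ?thesis by (rule sep_mono[OF sepA[OF p(1)]])
    next
      case 2 then show ?thesis by (rule sep_mono[OF sepA[OF p(3)]])
    next
      case 3 then show ?thesis by (rule sep_mono[OF sepA[OF p(2)]])
    qed
    then show False using n by blast
  qed
  show False
  proof (rule no_shortcut[OF i, of "set J \<union> set J'"])
    show "conn (set J \<union> set J')"
      by (rule conn_union[OF conn_ipath[OF J1(2,1)] conn_ipath[OF J2(2,1)]])
        (use n in \<open>auto simp: sep_def meets_def\<close>)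
    show "sep (set J \<union> set J') S" using J1(4) J2(4) unfolding sep_def by blast
    have "last J \<in> set J" "last J' \<in> set J'" using J1(1) J2(1) by auto
    then show "\<exists>u\<in>set J \<union> set J'. E u (e k j)" "\<exists>u\<in>set J \<union> set J'. E u (e l j)"
      using J1(5) J2(5) by blast+
  qed (use in_j in blast)
qed

text \<open>The set containing the link sees the \<open>l\<close>-th path at one end only, so a
  contact there would make the link itself a shortcut.\<close>

lemma link_opposite:
  assumes i: "idx3 j k l" and J: "link j k J"
  shows "sep (set J) (set (f l j))"
proof (rule ccontr)
  assume n: "\<not> ?thesis"
  note p = idx3_perm[OF i]
  have J1: "J \<noteq> []" "ipath J" "set J \<subseteq> A j \<or> set J \<subseteq> A k" "sep (set J) S" "E (last J) (e k j)" "E (hd J) (e j k)"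
    using J e_in[OF p(1)] e_in[OF i] unfolding link_def by (auto simp: last_in_set)
  have hl: "hd J \<in> set J" "last J \<in> set J" using J1(1) by auto
  have "set J \<inter> set (f l j) = {}"
    using J1(3) fatt[OF p(4)] fatt'[OF p(4)] unfolding att_def by blast
  then obtain u v where uv: "u \<in> set J" "v \<in> set (f l j)" "E u v" using n unfolding sep_def by blast
  show False
  proof (cases "set J \<subseteq> A j")
    case True
    have "v = e l j" using att_edge[OF fatt[OF p(4)] _ uv(2), of u] uv True by blast
    then show False
      using no_shortcut[OF i conn_ipath[OF J1(2,1)] True J1(4)] J1(5) hl uv by blast
  next
    case False
    then have K: "set J \<subseteq> A k" using J1(3) by blast
    have "v = e l k" using att_edge[OF fatt'[OF p(4)] _ uv(2), of u] uv K by blast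
    then show False
      using no_shortcut[OF p(1) conn_ipath[OF J1(2,1)] K J1(4)] J1(6) hl uv by blast
  qed
qed

text \<open>With all contacts excluded, the three fat paths and the links \<open>X\<close>,
  \<open>Y\<close>, \<open>Z\<close> form a hole in the cyclic order \<open>f 0 1\<close>,
  \<open>X\<close>, \<open>f 2 0\<close>, \<open>Y\<close>, \<open>f 1 2\<close>, \<open>Z\<close>.
  The hubs of \<open>A 0\<close> and \<open>A 2\<close> then satisfy \<open>ring\<close>.\<close>

theorem absurd: False
proof -
  have i: "idx3 0 1 2" unfolding idx3_def by simp
  note p = idx3_perm[OF i]
  obtain X where X: "link 0 2 X" using link_exists[OF p(2)] by blast
  obtain Y where Y: "link 2 1 Y" using link_exists[OF p(5)] by blast
  obtain Z where Z: "link 1 0 Z" using link_exists[OF p(1)] by blast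
  have x: "X \<noteq> []" "ipath X" "sep (set X) S"
     "\<And>u v. u \<in> set X \<Longrightarrow> v \<in> set (f 0 2) \<Longrightarrow> E u v \<longleftrightarrow> u = hd X \<and> v = e 0 2"
     "\<And>u v. u \<in> set X \<Longrightarrow> v \<in> set (f 2 0) \<Longrightarrow> E u v \<longleftrightarrow> u = last X \<and> v = e 2 0" "set X \<subseteq> A 0 \<or> set X \<subseteq> A 2"
    using X unfolding link_def by blast+
  have y: "Y \<noteq> []" "ipath Y" "sep (set Y) S"
     "\<And>u v. u \<in> set Y \<Longrightarrow> v \<in> set (f 2 1) \<Longrightarrow> E u v \<longleftrightarrow> u = hd Y \<and> v = e 2 1"
     "\<And>u v. u \<in> set Y \<Longrightarrow> v \<in> set (f 1 2) \<Longrightarrow> E u v \<longleftrightarrow> u = last Y \<and> v = e 1 2" "set Y \<subseteq> A 2 \<or> set Y \<subseteq> A 1"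
    using Y unfolding link_def by blast+
  have z: "Z \<noteq> []" "ipath Z" "sep (set Z) S"
     "\<And>u v. u \<in> set Z \<Longrightarrow> v \<in> set (f 1 0) \<Longrightarrow> E u v \<longleftrightarrow> u = hd Z \<and> v = e 1 0"
     "\<And>u v. u \<in> set Z \<Longrightarrow> v \<in> set (f 0 1) \<Longrightarrow> E u v \<longleftrightarrow> u = last Z \<and> v = e 0 1" "set Z \<subseteq> A 1 \<or> set Z \<subseteq> A 0"
    using Z unfolding link_def by blast+
  have sf: "set (f 0 2) = set (f 0 1)" "set (f 2 1) = set (f 2 0)" "set (f 1 0) = set (f 1 2)"
    using fset[OF i] fset[OF p(4)] fset[OF p(3)] by auto
  have XY: "sep (set X) (set Y)" using links_sep[OF p(4) link_sym[OF X] Y] by simp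
  have YZ: "sep (set Y) (set Z)"
    using links_sep[OF p(3) link_sym[OF Y] Z] by simp
  have ZX: "sep (set Z) (set X)" using links_sep[OF i link_sym[OF Z] X] by simp
  have X1: "sep (set X) (set (f 1 2))" using link_opposite[OF p(2) X] sf by simp
  have Y0: "sep (set Y) (set (f 0 1))" using link_opposite[OF p(5) Y] sf by simp
  have Z2: "sep (set Z) (set (f 2 0))" using link_opposite[OF p(1) Z] sf by simp
  have dX: "set X \<inter> set (f 0 1) = {}" "set X \<inter> set (f 2 0) = {}"
    using x(6) fdis[OF i] fatt'[OF i] fatt[OF p(4)] fdis[OF p(4)] unfolding att_def by blast+
  have dY: "set Y \<inter> set (f 1 2) = {}" "set Y \<inter> set (f 2 0) = {}"
    using y(6) fdis[OF p(3)] fatt[OF p(3)] fatt'[OF p(4)] fdis[OF p(4)] unfolding att_def by blast+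
  have dZ: "set Z \<inter> set (f 0 1) = {}" "set Z \<inter> set (f 1 2) = {}"
    using z(6) fdis[OF i] fatt[OF i] fatt'[OF p(3)] fdis[OF p(3)] unfolding att_def by blast+
  have f01: "sep (set (f 0 1)) (set (f 1 2))" "sep (set (f 2 0)) (set (f 0 1))" "sep (set (f 2 0)) (set (f 1 2))"
    using sepf[OF i] sepf[OF p(4)] sep_sym[OF sepf[OF p(3)]] sf by auto
  have last: "last (f 2 0) = e 2 1" "last (f 1 2) = e 1 0" "last (f 0 1) = e 0 2"
    using flast[OF p(4)] flast[OF p(3)] flast[OF i] by auto
  have f12Z: "E u v \<longleftrightarrow> u = last (f 1 2) \<and> v = hd Z" if "u \<in> set (f 1 2)" "v \<in> set Z" for u v
    using z(4)[of v u] that sf(3) E_commute[of u v] unfolding last by auto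
  have ip1: "ipath (Y @ f 1 2 @ Z)"
    by (rule ipath_append3[OF y(2) fpath[OF p(3)] z(2) fne[OF p(3)]])
      (use y(5) f12Z dY dZ sepD[OF YZ] in blast)+
  have f20Y: "E u v \<longleftrightarrow> u = last (f 2 0) \<and> v = hd Y" if "u \<in> set (f 2 0)" "v \<in> set Y" for u v
    using y(4)[of v u] that sf(2) E_commute[of u v] unfolding last by auto
  \<comment> \<open>The part of the hole outside the 0-th path, from the neighbour of
    \<open>e 0 2\<close> round to that of \<open>e 0 1\<close>.\<close>
  have ipM: "ipath (X @ f 2 0 @ (Y @ f 1 2 @ Z))"
  proof (rule ipath_append3[OF x(2) fpath[OF p(4)] ip1 fne[OF p(4)]])
    show "set X \<inter> set (f 2 0) = {}" by (rule dX(2))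
    show "set X \<inter> set (Y @ f 1 2 @ Z) = {}"
      using sep_disj(1)[OF XY] sep_disj(1)[OF X1] sep_disj(2)[OF ZX] by (simp add: Int_Un_distrib)
    show "set (f 2 0) \<inter> set (Y @ f 1 2 @ Z) = {}"
      using dY(2) sep_disj(1)[OF f01(3)] sep_disj(2)[OF Z2] by (simp add: Int_Un_distrib Int_commute)
    show "\<not> E u v" if "u \<in> set X" "v \<in> set (Y @ f 1 2 @ Z)" for u v
      using that sepD[OF XY] sepD[OF X1] sepD[OF ZX] by auto
    show "E u v \<longleftrightarrow> u = last (f 2 0) \<and> v = hd (Y @ f 1 2 @ Z)" if uv: "u \<in> set (f 2 0)" "v \<in> set (Y @ f 1 2 @ Z)" for u v
    proof -
      have hY: "hd Y \<in> set Y" using y(1) by simp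
      have h: "hd (Y @ f 1 2 @ Z) = hd Y" using y(1) by simp
      consider "v \<in> set Y" | "v \<in> set (f 1 2)" | "v \<in> set Z" using uv(2) by auto
      then show ?thesis
        unfolding h
      proof cases
        case 1
        then show "E u v \<longleftrightarrow> u = last (f 2 0) \<and> v = hd Y" using f20Y uv(1) by blast
      next
        case 2
        then have "v \<noteq> hd Y" using dY(1) hY by blast
        then show "E u v \<longleftrightarrow> u = last (f 2 0) \<and> v = hd Y" using sepD[OF f01(3) uv(1) 2] by blast
      next
        case 3
        then have "v \<noteq> hd Y" using sepD[OF YZ hY 3] by blast
        then show "E u v \<longleftrightarrow> u = last (f 2 0) \<and> v = hd Y" using sepD[OF Z2 3 uv(1)] by blast
      qed
    qed
  qed (use x(5) in blast)
  obtain q a b where q: "q \<in> A 0" "meets {q} S" "q \<notin> S" "a \<in> set (f 0 1)" "b \<in> set (f 0 1)" "a \<noteq> b" "\<not> E a b" "E q a" "E q b"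
    by (rule hub[OF i])
  obtain d a' b' where d: "d \<in> A 2" "meets {d} S" "d \<notin> S" "a' \<in> set (f 2 0)" "b' \<in> set (f 2 0)" "a' \<noteq> b'" "\<not> E a' b'" "E d a'" "E d b'"
    by (rule hub[OF p(4)])
  have out: "u \<notin> set X \<and> u \<notin> set Y \<and> u \<notin> set Z" if "meets {u} S" for u
    using that x(3) y(3) z(3) unfolding meets_def sep_def by blast
  have qd: "d \<noteq> q" "\<not> E q d" using sepD[OF sepA[OF p(4)] d(1) q(1)] by auto
  have qK: "q \<notin> set (f 0 1)" "q \<notin> set (f 1 2)" "q \<notin> set (f 2 0)"
    using q(1) fdis[OF i] fatt'[OF p(3)] fatt[OF p(4)] unfolding att_def by blast+
  have dK: "d \<notin> set (f 0 1)" "d \<notin> set (f 1 2)" "d \<notin> set (f 2 0)"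
    using d(1) fatt'[OF i] fatt[OF p(3)] fdis[OF p(4)] unfolding att_def by blast+
  let ?M = "X @ f 2 0 @ (Y @ f 1 2 @ Z)"
  have hM: "hd ?M = hd X" "last ?M = last Z" using x(1) z(1) by simp_all
  have has_3pc
  proof (rule ring[of "f 0 1" X "f 2 0" "Y @ f 1 2 @ Z" q a b d a' b' S])
    show "ipath (f 0 1)" using fpath i by blast
    show "ipath ?M" by (rule ipM)
    show "set (f 0 1) \<inter> set ?M = {}"
      using dX(1) dZ(1) sep_disj(1)[OF f01(1)] sep_disj(2)[OF f01(2)] sep_disj(2)[OF Y0]
      by (simp add: Int_Un_distrib Int_commute)
    show "E u v \<longleftrightarrow> u = last (f 0 1) \<and> v = hd ?M \<or> u = hd (f 0 1) \<and> v = last ?M"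
      if uv: "u \<in> set (f 0 1)" "v \<in> set ?M" for u v
    proof -
      have u2: "u \<in> set (f 0 2)" using uv(1) sf by simp
      have hX: "hd X \<in> set X" "last Z \<in> set Z" using x(1) z(1) by auto
      consider "v \<in> set X" | "v \<in> set (f 2 0)" | "v \<in> set Y" | "v \<in> set (f 1 2)" | "v \<in> set Z" using uv(2) by auto
      then show ?thesis
        unfolding hM last
      proof cases
        case 1
        have "v \<noteq> last Z" using sepD[OF ZX hX(2) 1] by blast
        then show "E u v \<longleftrightarrow> u = e 0 2 \<and> v = hd X \<or> u = e 0 1 \<and> v = last Z"
          using x(4)[OF 1 u2] E_commute[of u v] by blast
      next
        case 2
        have "v \<noteq> hd X" "v \<noteq> last Z" using 2 dX(2) hX sepD[OF Z2 hX(2) 2] by blast+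
        then show "E u v \<longleftrightarrow> u = e 0 2 \<and> v = hd X \<or> u = e 0 1 \<and> v = last Z"
          using sepD[OF f01(2) 2 uv(1)] by blast
      next
        case 3
        have "v \<noteq> hd X" "v \<noteq> last Z" using sepD[OF XY hX(1) 3] sepD[OF YZ 3 hX(2)] by blast+
        then show "E u v \<longleftrightarrow> u = e 0 2 \<and> v = hd X \<or> u = e 0 1 \<and> v = last Z"
          using sepD[OF Y0 3 uv(1)] by blast
      next
        case 4
        have "v \<noteq> hd X" "v \<noteq> last Z" using 4 dZ(2) hX sepD[OF X1 hX(1) 4] by blast+
        then show "E u v \<longleftrightarrow> u = e 0 2 \<and> v = hd X \<or> u = e 0 1 \<and> v = last Z"
          using sepD[OF f01(1) uv(1) 4] by blast
      next
        case 5
        have "v \<noteq> hd X" using sepD[OF ZX 5 hX(1)] by blast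
        then show "E u v \<longleftrightarrow> u = e 0 2 \<and> v = hd X \<or> u = e 0 1 \<and> v = last Z"
          using z(5)[OF 5 uv(1)] E_commute[of u v] by blast
      qed
    qed
    show "q \<notin> set ?M" "d \<notin> set ?M" using out[OF q(2)] out[OF d(2)] qK dK by auto
    show "v = hd (f 2 0)" if "v \<in> set (f 2 0)" "E q v" for v
      using att_edge[OF fatt[OF p(4)] q(1) that(1)] that(2) by blast
    show "sep S (set (f 0 1))" using Ssep i by blast
    show "sep S (set ?M)"
      using sep_sym[OF x(3)] sep_sym[OF y(3)] sep_sym[OF z(3)] Ssep[OF p(4)] Ssep[OF p(3)] by (simp add: sep_Un)
  qed (use q d qd qK dK connS in auto)
  then show False using no by blast
qed

end

section \<open>Distribution of the four connectors\<close>

lemma idx3_next: "m < 3 \<Longrightarrow> idx3 m ((m + 1) mod 3) ((m + 2) mod 3)"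
  unfolding idx3_def by (cases m; cases "m - 1"; cases "m - 2") auto

context sgraph
begin

lemma minimal_connector:
  assumes "finite B" "conn B" "meets A1 B" "meets A2 B" "meets A3 B"
  obtains S where "S \<subseteq> B" "conn S" "meets A1 S" "meets A2 S" "meets A3 S"
    "\<And>S'. S' \<subset> S \<Longrightarrow> conn S' \<Longrightarrow> \<not> (meets A1 S' \<and> meets A2 S' \<and> meets A3 S')"
proof -
  let ?P = "\<lambda>S. S \<subseteq> B \<and> conn S \<and> meets A1 S \<and> meets A2 S \<and> meets A3 S"
  have "?P B" using assms by blast
  from ex_has_least_nat[of ?P B card, OF this] obtain S where
    S: "?P S" "\<And>T. ?P T \<Longrightarrow> card S \<le> card T" by blast
  have fin: "finite S" using S(1) assms(1) finite_subset by blast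
  have "\<not> (meets A1 S' \<and> meets A2 S' \<and> meets A3 S')" if "S' \<subset> S" "conn S'" for S'
  proof
    assume "meets A1 S' \<and> meets A2 S' \<and> meets A3 S'"
    then have "card S \<le> card S'" using S that by blast
    moreover have "card S' < card S" using psubset_card_mono[OF fin that(1)] .
    ultimately show False by simp
  qed
  then show thesis using that[of S] S(1) by blast
qed

text \<open>Only the two end sets are recorded; the middle is the remaining one of the
  three.\<close>

definition fat :: "'a set \<Rightarrow> 'a set \<Rightarrow> 'a set \<Rightarrow> 'a list \<Rightarrow> bool" where
  "fat K L S p \<longleftrightarrow> set p = S \<and> ipath p \<and> length p \<ge> 3 \<and> att K p (hd p) \<and> att L p (last p)"

lemma fat_rev: "fat K L S p \<Longrightarrow> fat L K S (rev p)"
  unfolding fat_def by (auto simp: hd_rev last_rev)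

text \<open>A path \<open>r\<close> in \<open>S\<close> from \<open>K\<close> to \<open>L\<close>,
  with contacts at its ends only, forms a \<open>link3\<close> with \<open>p\<close> and
  \<open>q\<close>. So \<open>same_middle\<close> bounds its length and makes it touch
  \<open>M\<close>, and \<open>r\<close> is a connector by itself.\<close>

lemma connector_of_same_middle:
  assumes fat: "fat K L P p" "fat K L Q q"
    and sep: "sep K L" "sep K M" "sep L M" "sep P Q" "sep P S" "sep Q S"
    and conn: "conn K" "conn L" "conn M" "conn S"
    and dis: "M \<inter> P = {}" "M \<inter> Q = {}" "K \<inter> S = {}" "L \<inter> S = {}" "M \<inter> S = {}"
    and meets: "meets M P" "meets M Q" "meets K S" "meets L S"
    and no: "\<not> has_3pc"
  obtains x y where "{x, y} \<subseteq> S" "conn {x, y}" "meets K {x, y}" "meets L {x, y}" "meets M {x, y}"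
proof -
  obtain a b where ab: "a \<in> S" "\<exists>u\<in>K. E u a" "b \<in> S" "\<exists>u\<in>L. E u b" using meets(3,4) unfolding meets_def by blast
  obtain r where r: "ipath r" "r \<noteq> []" "set r \<subseteq> S" "\<exists>u\<in>K. E u (hd r)" "\<exists>u\<in>L. E u (last r)"
    "\<forall>v\<in>set r. (\<exists>u\<in>K. E u v) \<longrightarrow> v = hd r" "\<forall>v\<in>set r. (\<exists>u\<in>L. E u v) \<longrightarrow> v = last r"
    by (rule conn_path_between[OF conn(4) ab(1), of "\<lambda>v. \<exists>u\<in>K. E u v" b "\<lambda>v. \<exists>u\<in>L. E u v"]) (use ab in auto)
  have attr: "att K r (hd r)" "att L r (last r)"
    using r dis(3,4) unfolding att_def by blast+
  have l: "link3 K L p q r"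
    using fat attr r(1,2) conn(1,2) sep(1,4) sep_mono[OF sep(5) order_refl r(3)] sep_mono[OF sep(6) order_refl r(3)]
    unfolding fat_def link3_def by blast
  have pq: "set p = P" "set q = Q" using fat unfolding fat_def by auto
  have Mr: "M \<inter> set r = {}" using dis(5) r(3) by blast
  have m: "length r \<le> 2" "meets M (set r)"
    using same_middle[OF l no conn(3) sep(2,3) Mr] dis(1,2) meets(1,2) pq by auto
  have rset: "set r = {hd r, last r}"
  proof -
    obtain x r' where x: "r = x # r'" using r(2) by (cases r) auto
    show ?thesis using m(1) x by (cases r') auto
  qed
  have "conn (set r)" by (rule conn_ipath[OF r(1,2)])
  moreover have "hd r \<in> set r" "last r \<in> set r" using r(2) by auto
  then have "meets K (set r)" "meets L (set r)" using r(4,5) unfolding meets_def by blast+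
  ultimately show thesis using that[of "hd r" "last r"] r(3) m(2) unfolding rset by blast
qed

theorem bipartite_model_3pc:
  fixes A B :: "nat \<Rightarrow> 'a set"
  assumes conn: "\<And>i. i < 3 \<Longrightarrow> conn (A i)" "\<And>j. j < 4 \<Longrightarrow> conn (B j)"
    and fin: "\<And>j. j < 4 \<Longrightarrow> finite (B j)"
    and sepA: "\<And>i j. i < 3 \<Longrightarrow> j < 3 \<Longrightarrow> i \<noteq> j \<Longrightarrow> sep (A i) (A j)"
    and sepB: "\<And>i j. i < 4 \<Longrightarrow> j < 4 \<Longrightarrow> i \<noteq> j \<Longrightarrow> sep (B i) (B j)"
    and AB: "\<And>i j. i < 3 \<Longrightarrow> j < 4 \<Longrightarrow> A i \<inter> B j = {}" "\<And>i j. i < 3 \<Longrightarrow> j < 4 \<Longrightarrow> meets (A i) (B j)"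
  shows has_3pc
proof (rule ccontr)
  assume no: "\<not> has_3pc"
  define minc where "minc j T \<longleftrightarrow> T \<subseteq> B j \<and> conn T \<and> meets (A 0) T \<and> meets (A 1) T \<and> meets (A 2) T \<and>
      (\<forall>S'. S' \<subset> T \<longrightarrow> conn S' \<longrightarrow> \<not> (meets (A 0) S' \<and> meets (A 1) S' \<and> meets (A 2) S'))" for j T
  have "\<exists>T. j < 4 \<longrightarrow> minc j T" for j
  proof (cases "j < 4")
    case j: True
    obtain T where "T \<subseteq> B j" "conn T" "meets (A 0) T" "meets (A 1) T" "meets (A 2) T"
      "\<And>S'. S' \<subset> T \<Longrightarrow> conn S' \<Longrightarrow> \<not> (meets (A 0) S' \<and> meets (A 1) S' \<and> meets (A 2) S')"
      by (rule minimal_connector[OF fin[OF j] conn(2)[OF j], of "A 0" "A 1" "A 2"]) (use AB(2) j in auto)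
    then have "minc j T" unfolding minc_def by blast
    then show ?thesis by blast
  qed simp
  then obtain S where minc: "\<And>j. j < 4 \<Longrightarrow> minc j (S j)" by metis
  have S: "S j \<subseteq> B j" "conn (S j)" "meets (A 0) (S j) \<and> meets (A 1) (S j) \<and> meets (A 2) (S j)"
      "\<And>S'. S' \<subset> S j \<Longrightarrow> conn S' \<Longrightarrow> \<not> (meets (A 0) S' \<and> meets (A 1) S' \<and> meets (A 2) S')"
    if "j < 4" for j using minc[OF that] unfolding minc_def by blast+
  have sA: "sep (A 0) (A 1)" "sep (A 0) (A 2)" "sep (A 1) (A 2)" using sepA by auto
  have less3: "i = 0 \<or> i = 1 \<or> i = 2" if "i < 3" for i :: nat using that by auto
  have mA: "meets (A i) (S j)" if "i < 3" "j < 4" for i j using less3[OF that(1)] S(3)[OF that(2)] by auto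
  have dA: "A i \<inter> S j = {}" if "i < 3" "j < 4" for i j using AB(1)[OF that] S(1)[OF that(2)] by blast
  have sepS: "sep (S i) (S j)" if "i < 4" "j < 4" "i \<noteq> j" for i j
    by (rule sep_mono[OF sepB[OF that] S(1)[OF that(1)] S(1)[OF that(2)]])
  let ?sk = "\<lambda>j. skinny (A 0) (A 1) (A 2) (S j)"
  \<comment> \<open>Both orders of the two end sets are included, so that the middle
    \<open>m\<close> alone describes the kind.\<close>
  let ?fat = "\<lambda>m j. \<forall>k l. idx3 m k l \<longrightarrow> (\<exists>p. fat (A k) (A l) (S j) p)"
  have two_skinny: False if "?sk i" "?sk j" "i < 4" "j < 4" "i \<noteq> j" for i j
  proof -
    have has_3pc
      by (rule skinny_skinny[OF sA sepS[OF that(3-5)] conn(1) conn(1) conn(1) dA dA dA dA dA dA mA mA mA mA mA mA that(1,2)])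
        (simp_all add: that(3,4))
    then show False using no by blast
  qed
  have fatI: "?fat m j" if "idx3 m a b" "fat (A a) (A b) (S j) p" for m a b j p
  proof (intro allI impI)
    fix k l assume "idx3 m k l"
    then have "(k = a \<and> l = b) \<or> (k = b \<and> l = a)" using that(1) unfolding idx3_def by auto
    then show "\<exists>p. fat (A k) (A l) (S j) p" using that(2) fat_rev by blast
  qed
  have kind: "?sk j \<or> (\<exists>m<3. ?fat m j)" if j: "j < 4" for j
  proof (rule classify[OF S(2)[OF j], of "A 0" "A 1" "A 2"])
    show "meets (A 0) (S j)" "meets (A 1) (S j)" "meets (A 2) (S j)" using mA j by auto
    show "A 0 \<inter> S j = {}" "A 1 \<inter> S j = {}" "A 2 \<inter> S j = {}" using dA j by auto
    show "\<not> (meets (A 0) S' \<and> meets (A 1) S' \<and> meets (A 2) S')" if "S' \<subset> S j" "conn S'" for S'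
      by (rule S(4)[OF j that])
  next
    fix p assume "set p = S j" "ipath p" "3 \<le> length p" "att (A 0) p (hd p)" "att (A 1) p (last p)"
    then have "?fat 2 j" by (intro fatI[of 2 0 1]) (auto simp: fat_def idx3_def)
    then show ?thesis by (intro disjI2 exI[of _ 2]) simp
  next
    fix p assume "set p = S j" "ipath p" "3 \<le> length p" "att (A 0) p (hd p)" "att (A 2) p (last p)"
    then have "?fat 1 j" by (intro fatI[of 1 0 2]) (auto simp: fat_def idx3_def)
    then show ?thesis by (intro disjI2 exI[of _ 1]) simp
  next
    fix p assume "set p = S j" "ipath p" "3 \<le> length p" "att (A 1) p (hd p)" "att (A 2) p (last p)"
    then have "?fat 0 j" by (intro fatI[of 0 1 2]) (auto simp: fat_def idx3_def)
    then show ?thesis by (intro disjI2 exI[of _ 0]) simp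
  qed (use sA in auto)
  \<comment> \<open>The connector with at most two vertices is all of \<open>S i\<close> by
    minimality, and \<open>small_skinny\<close> applies.\<close>
  have other_skinny: "?sk i" if h: "?fat m j" "?fat m j'" "m < 3" "i < 4" "j < 4" "j' < 4" "j \<noteq> j'" "i \<noteq> j" "i \<noteq> j'"
    for i j j' m
  proof -
    obtain k l where i3: "idx3 m k l" using idx3_next[OF h(3)] by blast
    then have kl: "k < 3" "l < 3" "k \<noteq> l" "k \<noteq> m" "l \<noteq> m" unfolding idx3_def by auto
    obtain p q where pq: "fat (A k) (A l) (S j) p" "fat (A k) (A l) (S j') q" using h(1,2) i3 by blast
    obtain x y where xy: "{x, y} \<subseteq> S i" "conn {x, y}" "meets (A k) {x, y}" "meets (A l) {x, y}" "meets (A m) {x, y}"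
    proof (rule connector_of_same_middle[OF pq, of "A m" "S i"])
      show "sep (A k) (A l)" "sep (A k) (A m)" "sep (A l) (A m)" using sepA kl h(3) by auto
      show "sep (S j) (S j')" "sep (S j) (S i)" "sep (S j') (S i)" using sepS h by auto
      show "conn (A k)" "conn (A l)" "conn (A m)" "conn (S i)" using conn(1) S(2) kl h by auto
      show "A m \<inter> S j = {}" "A m \<inter> S j' = {}" "A k \<inter> S i = {}" "A l \<inter> S i = {}" "A m \<inter> S i = {}"
        using dA kl h by auto
      show "meets (A m) (S j)" "meets (A m) (S j')" "meets (A k) (S i)" "meets (A l) (S i)" using mA kl h by auto
    qed (use no in auto)
    have "a < 3 \<Longrightarrow> a = k \<or> a = l \<or> a = m" for a using i3 unfolding idx3_def by auto
    then have "meets (A a) {x, y}" if "a < 3" for a using xy(3-5) that by blast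
    then have "\<not> {x, y} \<subset> S i" using S(4)[OF h(4) _ xy(2)] by auto
    then have "S i = {x, y}" using xy(1) by blast
    then show ?thesis
      by (intro small_skinny[OF S(2)[OF h(4)] _ sA dA dA dA]) (use S(4)[OF h(4)] h(4) in simp_all)
  qed
  \<comment> \<open>Among four indices two remain besides \<open>j\<close> and \<open>j'\<close>;
    both would be skinny.\<close>
  have same: False if f: "?fat m j" "?fat m j'" "m < 3" "j < 4" "j' < 4" "j \<noteq> j'" for j j' m
  proof -
    have "\<exists>i i'. i < 4 \<and> i' < 4 \<and> i \<noteq> i' \<and> i \<notin> {j, j'} \<and> i' \<notin> {j, j'}"
    proof -
      have "card ({..<4} - {j, j'}) = 2" using that(4-6) by (subst card_Diff_subset) auto
      then obtain i i' where "{..<4} - {j, j'} = {i, i'}" "i \<noteq> i'" unfolding card_2_iff by blast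
      then show ?thesis by blast
    qed
    then obtain i i' where i: "i < 4" "i' < 4" "i \<noteq> i'" "i \<notin> {j, j'}" "i' \<notin> {j, j'}" by blast
    have "?sk i" by (rule other_skinny[OF f(1-3) i(1) f(4-6)]) (use i(4) in auto)
    moreover have "?sk i'" by (rule other_skinny[OF f(1-3) i(2) f(4-6)]) (use i(5) in auto)
    ultimately show False using two_skinny i(1-3) by blast
  qed
  \<comment> \<open>four sets, at most one skinny and at most one with each middle: every kind occurs\<close>
  define N where "N = {j. j < 4 \<and> \<not> ?sk j}"
  have "\<forall>j\<in>N. \<exists>m<3. ?fat m j" using kind unfolding N_def by blast
  then obtain mid where mid: "\<And>j. j \<in> N \<Longrightarrow> mid j < 3 \<and> ?fat (mid j) j" by metis
  have inj: "inj_on mid N"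
  proof (rule inj_onI, rule ccontr)
    fix i j assume ij: "i \<in> N" "j \<in> N" "mid i = mid j" "i \<noteq> j"
    show False
      by (rule same[of "mid i" i j]) (use mid[OF ij(1)] mid[OF ij(2)] ij N_def in auto)
  qed
  have img: "mid ` N \<subseteq> {..<3}" using mid by auto
  have finN: "finite N" unfolding N_def by simp
  have N3: "card N \<le> 3" using card_inj_on_le[OF inj img] by simp
  have "\<exists>s<4. ?sk s"
  proof (rule ccontr)
    assume "\<not> ?thesis"
    then have "N = {..<4}" unfolding N_def by auto
    then show False using N3 by simp
  qed
  then obtain s where s: "s < 4" "?sk s" by blast
  have "N = {..<4} - {s}" using two_skinny s unfolding N_def by auto
  then have "card N = 3" using s(1) by simp
  then have surj: "mid ` N = {..<3}"
    using card_subset_eq[OF _ img] card_image[OF inj] by simp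
  have "\<exists>j. j \<in> N \<and> mid j = m" if "m < 3" for m
  proof -
    have "m \<in> mid ` N" using surj that by simp
    then show ?thesis by blast
  qed
  then obtain g where gN: "\<And>m. m < 3 \<Longrightarrow> g m \<in> N \<and> mid (g m) = m" by metis
  have g: "g m < 4 \<and> g m \<noteq> s \<and> ?fat m (g m)" if "m < 3" for m
    using gN[OF that] mid[of "g m"] s(2) unfolding N_def by auto
  have ginj: "g m \<noteq> g m'" if "m < 3" "m' < 3" "m \<noteq> m'" for m m'
    using gN[OF that(1)] gN[OF that(2)] that(3) by metis
  have "\<exists>p. fat (A ((m + 1) mod 3)) (A ((m + 2) mod 3)) (S (g m)) p" if "m < 3" for m
  proof -
    show ?thesis using g[OF that] idx3_next[OF that] by blast
  qed
  then obtain p where p: "\<And>m. m < 3 \<Longrightarrow> fat (A ((m + 1) mod 3)) (A ((m + 2) mod 3)) (S (g m)) (p m)" by metis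
  \<comment> \<open>\<open>p j\<close> runs from \<open>A ((j + 1) mod 3)\<close> to
    \<open>A ((j + 2) mod 3)\<close>; \<open>f j k\<close> is the orientation that starts at
    \<open>A k\<close>.\<close>
  define f where "f j k = (if k = (j + 1) mod 3 then p j else rev (p j))" for j k
  have f: "fat (A k) (A l) (S (g j)) (f j k) \<and> f j l = rev (f j k)" if i: "idx3 j k l" for j k l
  proof -
    have j: "j < 3" using i unfolding idx3_def by simp
    consider "k = (j + 1) mod 3" "l = (j + 2) mod 3" "l \<noteq> k" | "k = (j + 2) mod 3" "l = (j + 1) mod 3" "k \<noteq> l"
      using i less3[of j] less3[of k] less3[of l] unfolding idx3_def by auto
    then show ?thesis
    proof cases
      case 1
      then show ?thesis using p[OF j] unfolding f_def by simp
    next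
      case 2
      then show ?thesis using fat_rev[OF p[OF j]] unfolding f_def by simp
    qed
  qed
  have fS: "set (f j k) = S (g j)" if "idx3 j k l" for j k l using f[OF that] unfolding fat_def by blast
  have skin: "skinny (A j) (A k) (A l) (S s)" if i: "idx3 j k l" for j k l
  proof -
    have 1: "skinny (A 0) (A 1) (A 2) (S s)" using s by simp
    note 2 = skinny_perm(1)[OF 1] and 3 = skinny_perm(2)[OF 1]
    note 4 = skinny_perm(2)[OF 2] and 5 = skinny_perm(1)[OF 3]
    note 6 = skinny_perm(1)[OF 4]
    have "(j, k, l) \<in> {(0, 1, 2), (1, 0, 2), (0, 2, 1), (1, 2, 0), (2, 0, 1), (2, 1, 0)}"
      using i less3[of j] less3[of k] less3[of l] unfolding idx3_def by auto
    then show ?thesis using 1 2 3 4 5 6 by auto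
  qed
  have "hexagon E A f (S s)"
  proof (intro hexagon.intro hexagon_axioms.intro sgraph_axioms)
    fix j k l assume i: "idx3 j k l"
    then have l: "j < 3" "k < 3" "l < 3" "j \<noteq> k" unfolding idx3_def by auto
    show "conn (A j)" using conn(1) l by blast
    show "sep (A j) (A k)" using sepA l by blast
    show "ipath (f j k)" "3 \<le> length (f j k)" "f j l = rev (f j k)" "att (A k) (f j k) (hd (f j k))"
      using f[OF i] unfolding fat_def by auto
    show "A j \<inter> set (f j k) = {}" "meets (A j) (set (f j k))"
      unfolding fS[OF i] using dA mA g l by auto
    show "sep (set (f j k)) (set (f k j))"
      unfolding fS[OF i] fS[OF idx3_perm(1)[OF i]] using sepS ginj g l by auto
    show "A j \<inter> S s = {}" "meets (A j) (S s)" using dA mA s l by auto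
    show "sep (S s) (set (f j k))"
      unfolding fS[OF i] using sepS[OF s(1)] g[OF l(1)] by metis
    show "skinny (A j) (A k) (A l) (S s)" by (rule skin[OF i])
  qed (use S(2) s no in auto)
  then show False by (rule hexagon.absurd)
qed

end

section \<open>Transfer to \<open>pair_graph\<close>\<close>

definition adj :: "'a pair_pre_digraph \<Rightarrow> 'a \<Rightarrow> 'a \<Rightarrow> bool" where
  "adj G u v \<longleftrightarrow> (u, v) \<in> parcs G"

lemma sgraph_adj: "pair_graph G \<Longrightarrow> sgraph (adj G)"
proof -
  assume "pair_graph G"
  then interpret pair_graph G .
  show "sgraph (adj G)"
  proof
    show "adj G u v \<Longrightarrow> adj G v u" for u v
      using pair_sym_arcs unfolding adj_def symmetric_def by (simp add: symD)
    show "\<not> adj G u u" for u using pair_no_loops[of "(u, u)"] unfolding adj_def by auto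
  qed
qed

definition induced :: "'a pair_pre_digraph \<Rightarrow> 'a set \<Rightarrow> 'a pair_pre_digraph" where
  "induced G V = \<lparr>pverts = V, parcs = parcs G \<inter> V \<times> V\<rparr>"

lemma induced_simps [simp]: "pverts (induced G V) = V" "parcs (induced G V) = parcs G \<inter> V \<times> V"
  unfolding induced_def by simp_all

lemma pair_graph_induced:
  assumes "pair_graph G" "V \<subseteq> pverts G"
  shows "pair_graph (induced G V)"
proof -
  interpret pair_graph G by (rule assms(1))
  have "finite V" using assms(2) pair_finite_verts finite_subset by blast
  moreover have "sym (parcs G \<inter> V \<times> V)"
    using pair_sym_arcs unfolding symmetric_def sym_def by auto
  moreover have "finite (parcs G \<inter> V \<times> V)" using pair_finite_arcs by simp
  moreover have "fst e \<noteq> snd e" if "e \<in> parcs G" for e using pair_no_loops that .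
  ultimately show ?thesis
    by unfold_locales (auto simp: symmetric_def)
qed

lemma induced_subgraph_induced:
  assumes "pair_graph G" "V \<subseteq> pverts G"
  shows "induced_subgraph (with_proj (induced G V)) (with_proj G)"
proof -
  interpret G: pair_graph G by (rule assms(1))
  interpret H: pair_graph "induced G V" by (rule pair_graph_induced[OF assms])
  show ?thesis
    unfolding induced_subgraph_def subgraph_def compatible_def
    using assms(2) G.wf_digraph_axioms H.wf_digraph_axioms by auto
qed

lemma path_edges_Cons: "p \<noteq> [] \<Longrightarrow> path_edges (x # p) = {(x, hd p), (hd p, x)} \<union> path_edges p"
  unfolding path_edges_def by auto

locale pgraph = sgraph "adj G" for G :: "'a pair_pre_digraph" +
  assumes pg: "pair_graph G"
begin

lemma adj_verts: "adj G u v \<Longrightarrow> u \<in> pverts G \<and> v \<in> pverts G"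
proof -
  interpret pair_graph G by (rule pg)
  show "adj G u v \<Longrightarrow> ?thesis" unfolding adj_def by (blast dest: in_arcsD1 in_arcsD2)
qed

lemma ipath_edges: "ipath p \<Longrightarrow> parcs G \<inter> set p \<times> set p = path_edges p"
proof (induction p)
  case Nil
  then show ?case by (simp add: path_edges_def)
next
  case (Cons x p)
  have nx: "(x, x) \<notin> parcs G" using E_irrefl[of x] unfolding adj_def by simp
  show ?case
  proof (cases "p = []")
    case True
    then show ?thesis using nx by (auto simp: path_edges_def)
  next
    case False
    then have h: "hd p \<in> set p" by simp
    have e: "(x, y) \<in> parcs G \<longleftrightarrow> y = hd p" "(y, x) \<in> parcs G \<longleftrightarrow> y = hd p" if "y \<in> set p" for y
    proof -
      have "adj G x y \<longleftrightarrow> y = hd p" using Cons.prems that by simp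
      moreover from this have "adj G y x \<longleftrightarrow> y = hd p" using E_commute[of x y] by simp
      ultimately show "(x, y) \<in> parcs G \<longleftrightarrow> y = hd p" "(y, x) \<in> parcs G \<longleftrightarrow> y = hd p"
        by (simp_all add: adj_def)
    qed
    have IH: "parcs G \<inter> set p \<times> set p = path_edges p" using Cons by simp
    show ?thesis
    proof (rule set_eqI)
      fix w :: "'a \<times> 'a"
      obtain u v where w: "w = (u, v)" by force
      have "(u, v) \<in> path_edges p \<longleftrightarrow> (u, v) \<in> parcs G \<and> u \<in> set p \<and> v \<in> set p" using IH by blast
      then show "w \<in> parcs G \<inter> set (x # p) \<times> set (x # p) \<longleftrightarrow> w \<in> path_edges (x # p)"
        unfolding w path_edges_Cons[OF False] using e h nx by auto
    qed
  qed
qed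

lemma path_edges_parcs:
  assumes "ipath p" "set p \<subseteq> V"
  shows "path_edges p \<subseteq> parcs G \<inter> V \<times> V"
  unfolding ipath_edges[OF assms(1), symmetric] using assms(2) by blast

lemma chordless_ipath:
  assumes "ipath p" "p \<noteq> []" "set p \<subseteq> V"
  shows "chordless_path (induced G V) (hd p) p (last p)"
proof -
  have e: "path_edges p = parcs G \<inter> set p \<times> set p" using ipath_edges[OF assms(1)] by simp
  have "set (vwalk_arcs p) \<subseteq> path_edges p" unfolding path_edges_def by blast
  then have "set (vwalk_arcs p) \<subseteq> parcs G \<inter> V \<times> V"
    using path_edges_parcs[OF assms(1,3)] by (rule subset_trans)
  then have "vpath p (with_proj (induced G V))"
    using assms ipath_distinct[OF assms(1)] unfolding vpath_def vwalk_def by simp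
  moreover have "parcs (induced G V) \<inter> set p \<times> set p = path_edges p"
    using e assms(3) by auto
  ultimately show ?thesis unfolding chordless_path_def by simp
qed

text \<open>The relation \<open>adj\<close> knows no vertex set, so membership in
  \<open>pverts G\<close> has to come from an arc; every vertex of a path with at least two vertices
  is on one.\<close>

lemma ipath_verts: "ipath p \<Longrightarrow> length p \<ge> 2 \<Longrightarrow> set p \<subseteq> pverts G"
proof (induction p)
  case (Cons x p)
  then have p: "p \<noteq> []" by auto
  then have p2: "adj G x (hd p)" using Cons.prems(1) by simp
  show ?case
  proof (cases "length p \<ge> 2")
    case True
    then show ?thesis using Cons adj_verts[OF p2] by auto
  next
    case False
    then have "p = [hd p]" using p by (cases p; cases "tl p") auto
    then have "set (x # p) = {x, hd p}" by (metis list.set(1) list.set(2))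
    then show ?thesis using adj_verts[OF p2] by simp
  qed
qed simp

text \<open>Since \<open>X\<close> is symmetric, only one direction between each two of the paths
  has to be checked; edges inside a path are path edges.\<close>

lemma edges_in_union:
  assumes "ipath P" "ipath Q" "ipath R"
    and "\<And>u v. u \<in> set P \<Longrightarrow> v \<in> set Q \<Longrightarrow> adj G u v \<Longrightarrow> (u, v) \<in> X"
    and "\<And>u v. u \<in> set P \<Longrightarrow> v \<in> set R \<Longrightarrow> adj G u v \<Longrightarrow> (u, v) \<in> X"
    and "\<And>u v. u \<in> set Q \<Longrightarrow> v \<in> set R \<Longrightarrow> adj G u v \<Longrightarrow> (u, v) \<in> X"
    and X: "sym X" "path_edges P \<union> path_edges Q \<union> path_edges R \<subseteq> X"
      "X \<subseteq> parcs G \<inter> (set P \<union> set Q \<union> set R) \<times> (set P \<union> set Q \<union> set R)"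
  shows "parcs G \<inter> (set P \<union> set Q \<union> set R) \<times> (set P \<union> set Q \<union> set R) = X"
proof
  show "parcs G \<inter> (set P \<union> set Q \<union> set R) \<times> (set P \<union> set Q \<union> set R) \<subseteq> X"
  proof
    fix w assume w: "w \<in> parcs G \<inter> (set P \<union> set Q \<union> set R) \<times> (set P \<union> set Q \<union> set R)"
    obtain u v where uv: "w = (u, v)" by force
    have a: "adj G u v" "adj G v u" using w uv E_sym unfolding adj_def by auto
    have s: "(v, u) \<in> X \<Longrightarrow> (u, v) \<in> X" using X(1) by (rule symD)
    have in_path: "(u, v) \<in> X" if "ipath p" "u \<in> set p" "v \<in> set p" "path_edges p \<subseteq> X" for p
      using ipath_edges[OF that(1)] that a(1) unfolding adj_def by blast
    have "u \<in> set P \<or> u \<in> set Q \<or> u \<in> set R" "v \<in> set P \<or> v \<in> set Q \<or> v \<in> set R" using w uv by auto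
    then show "w \<in> X"
      unfolding uv using in_path[of P] in_path[of Q] in_path[of R] assms(1-6) a s X(2) by blast
  qed
qed (rule X(3))

lemma sym_path_edges: "sym (path_edges p)"
  unfolding path_edges_def by (auto simp: sym_def)

lemma theta_of_pairs:
  assumes t: "theta_pair c c' P Q" "theta_pair c c' P R" "theta_pair c c' Q R" and c: "c \<noteq> c'" "\<not> adj G c c'"
  shows "\<exists>V. V \<subseteq> pverts G \<and> theta (induced G V)"
proof -
  note a = t[unfolded theta_pair_def]
  let ?V = "set P \<union> set Q \<union> set R"
  have len: "length p \<ge> 3" if "ipath p" "p \<noteq> []" "hd p = c" "last p = c'" for p
  proof (rule ipath_nonadj_length[OF that(1), of c c'])
    show "c \<in> set p" "c' \<in> set p" using that by auto
  qed (use c in auto)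
  have l: "length P \<ge> 3" "length Q \<ge> 3" "length R \<ge> 3" using a len by auto
  have V: "?V \<subseteq> pverts G" using ipath_verts a l by auto
  let ?X = "path_edges P \<union> path_edges Q \<union> path_edges R"
  have cc: "c \<in> set P" "c' \<in> set P" "c \<in> set Q" "c' \<in> set Q" "c \<in> set R" "c' \<in> set R"
    using a hd_in_set last_in_set by (metis, metis, metis, metis, metis, metis)
  have ip: "ipath P" "ipath Q" "ipath R" using a by auto
  have mem: "(u, v) \<in> ?X" if "p \<in> {P, Q, R}" "u \<in> set p" "v \<in> set p" "adj G u v" for p u v
  proof -
    have "(u, v) \<in> path_edges p" using ipath_edges[of p] ip that unfolding adj_def by blast
    then show ?thesis using that(1) by blast
  qed
  have "parcs G \<inter> ?V \<times> ?V = ?X"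
  proof (rule edges_in_union[OF ip])
    show "sym ?X" using sym_path_edges by (intro sym_Un)
    show "?X \<subseteq> parcs G \<inter> ?V \<times> ?V" using path_edges_parcs[OF ip(1), of ?V] path_edges_parcs[OF ip(2), of ?V] path_edges_parcs[OF ip(3), of ?V] by blast
    fix u v
    show "(u, v) \<in> ?X" if uv: "u \<in> set P" "v \<in> set Q" "adj G u v"
    proof -
      have "u \<in> {c, c'} \<or> v \<in> {c, c'}" using t(1) uv unfolding theta_pair_def by blast
      \<comment> \<open>The common ends lie on every path, so an edge at one of them runs inside a
        single path.\<close>
      then have "u \<in> set Q \<or> v \<in> set P" using cc by blast
      then show ?thesis using mem[of P u v] mem[of Q u v] uv by blast
    qed
    show "(u, v) \<in> ?X" if uv: "u \<in> set P" "v \<in> set R" "adj G u v"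
    proof -
      have "u \<in> {c, c'} \<or> v \<in> {c, c'}" using t(2) uv unfolding theta_pair_def by blast
      then have "u \<in> set R \<or> v \<in> set P" using cc by blast
      then show ?thesis using mem[of P u v] mem[of R u v] uv by blast
    qed
    show "(u, v) \<in> ?X" if uv: "u \<in> set Q" "v \<in> set R" "adj G u v"
    proof -
      have "u \<in> {c, c'} \<or> v \<in> {c, c'}" using t(3) uv unfolding theta_pair_def by blast
      then have "u \<in> set R \<or> v \<in> set Q" using cc by blast
      then show ?thesis using mem[of Q u v] mem[of R u v] uv by blast
    qed
  qed simp
  moreover have "chordless_path (induced G ?V) c P c'" "chordless_path (induced G ?V) c Q c'"
    "chordless_path (induced G ?V) c R c'"
    using chordless_ipath[of P ?V] chordless_ipath[of Q ?V] chordless_ipath[of R ?V] a by auto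
  moreover have "set P \<inter> set Q = {c, c'}" "set P \<inter> set R = {c, c'}" "set Q \<inter> set R = {c, c'}" using a by auto
  ultimately have "theta (induced G ?V)"
    unfolding theta_def using pair_graph_induced[OF pg V] l
    by (intro conjI exI[of _ c] exI[of _ c'] exI[of _ P] exI[of _ Q] exI[of _ R]) simp_all
  then show ?thesis using V by blast
qed

lemma triangle_edges_sym: "sym (triangle_edges x y z)"
  unfolding triangle_edges_def sym_def by auto

lemma triangle_edges_parcs:
  assumes "adj G x y" "adj G x z" "adj G y z" "{x, y, z} \<subseteq> V"
  shows "triangle_edges x y z \<subseteq> parcs G \<inter> V \<times> V"
  using assms E_sym[of x y] E_sym[of x z] E_sym[of y z] unfolding triangle_edges_def adj_def by auto

lemma pyramid_of_pairs:
  assumes t: "pyramid_pair c P Q" "pyramid_pair c P R" "pyramid_pair c Q R"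
    and l: "length P \<ge> 2" "length Q \<ge> 2" "length R \<ge> 2"
    and l': "length P \<ge> 3 \<and> length Q \<ge> 3 \<or> length P \<ge> 3 \<and> length R \<ge> 3 \<or> length Q \<ge> 3 \<and> length R \<ge> 3"
  shows "\<exists>V. V \<subseteq> pverts G \<and> pyramid (induced G V)"
proof -
  note a = t[unfolded pyramid_pair_def]
  let ?V = "set P \<union> set Q \<union> set R"
  have ip: "ipath P" "ipath Q" "ipath R" using a by auto
  have V: "?V \<subseteq> pverts G" using ipath_verts[OF ip(1) l(1)] ipath_verts[OF ip(2) l(2)] ipath_verts[OF ip(3) l(3)] by blast
  have ne: "P \<noteq> []" "Q \<noteq> []" "R \<noteq> []" using l by auto
  have h: "hd P = c" "hd Q = c" "hd R = c" using a by auto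
  have cc: "c \<in> set P" "c \<in> set Q" "c \<in> set R" using h ne hd_in_set by metis+
  have lc: "last p \<in> set p" "last p \<noteq> c" if "ipath p" "hd p = c" "length p \<ge> 2" for p
  proof -
    have "p \<noteq> []" using that(3) by auto
    then show "last p \<in> set p" by simp
    show "last p \<noteq> c"
    proof
      assume "last p = c"
      then have "p = [hd p]" using ipath_singleton_ends[OF that(1) \<open>p \<noteq> []\<close>] that(2) by simp
      then have "length p = 1" by (metis length_Cons list.size(3) One_nat_def)
      then show False using that(3) by simp
    qed
  qed
  note lP = lc[OF ip(1) h(1) l(1)] and lQ = lc[OF ip(2) h(2) l(2)] and lR = lc[OF ip(3) h(3) l(3)]
  let ?b1 = "last P" and ?b2 = "last Q" and ?b3 = "last R"
  let ?T = "triangle_edges ?b1 ?b2 ?b3"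
  let ?X = "path_edges P \<union> path_edges Q \<union> path_edges R \<union> ?T"
  have e: "adj G ?b1 ?b2" "adj G ?b1 ?b3" "adj G ?b2 ?b3"
    using t lP lQ lR by (simp_all add: pyramid_pair_def)
  have d: "?b1 \<noteq> ?b2" "?b1 \<noteq> ?b3" "?b2 \<noteq> ?b3" using e E_neq by blast+
  have mem: "(u, v) \<in> ?X" if "p \<in> {P, Q, R}" "u \<in> set p" "v \<in> set p" "adj G u v" for p u v
  proof -
    have "(u, v) \<in> path_edges p" using ipath_edges[of p] ip that unfolding adj_def by blast
    then show ?thesis using that(1) by blast
  qed
  have tr: "(?b1, ?b2) \<in> ?T" "(?b1, ?b3) \<in> ?T" "(?b2, ?b3) \<in> ?T" using d unfolding triangle_edges_def by auto
  have pairX: "(u, v) \<in> ?X"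
    if pq: "p \<in> {P, Q, R}" "q \<in> {P, Q, R}" "pyramid_pair c p q" "(last p, last q) \<in> ?T"
      and uv: "u \<in> set p" "v \<in> set q" "adj G u v" for p q u v
  proof (cases "u = c \<or> v = c")
    case True
    have "c \<in> set p" "c \<in> set q" using pq(1,2) cc by auto
    then have "u \<in> set q \<or> v \<in> set p" using True by blast
    then show ?thesis using mem[OF pq(1), of u v] mem[OF pq(2), of u v] uv by blast
  next
    case False
    then have "u = last p \<and> v = last q" using pq(3) uv unfolding pyramid_pair_def by blast
    then show ?thesis using pq(4) by blast
  qed
  have "parcs G \<inter> ?V \<times> ?V = ?X"
  proof (rule edges_in_union[OF ip])
    show "sym ?X" using sym_path_edges triangle_edges_sym by (intro sym_Un)
    show "?X \<subseteq> parcs G \<inter> ?V \<times> ?V"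
    proof -
      have "{?b1, ?b2, ?b3} \<subseteq> ?V" using lP(1) lQ(1) lR(1) by simp
      then show ?thesis
        by (intro Un_least path_edges_parcs ip triangle_edges_parcs[OF e]) auto
    qed
    show "(u, v) \<in> ?X" if "u \<in> set P" "v \<in> set Q" "adj G u v" for u v
      by (rule pairX[of P Q, OF _ _ t(1) tr(1) that]) simp_all
    show "(u, v) \<in> ?X" if "u \<in> set P" "v \<in> set R" "adj G u v" for u v
      by (rule pairX[of P R, OF _ _ t(2) tr(2) that]) simp_all
    show "(u, v) \<in> ?X" if "u \<in> set Q" "v \<in> set R" "adj G u v" for u v
      by (rule pairX[of Q R, OF _ _ t(3) tr(3) that]) simp_all
  qed blast
  moreover have "chordless_path (induced G ?V) c P ?b1" "chordless_path (induced G ?V) c Q ?b2"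
    "chordless_path (induced G ?V) c R ?b3"
    using chordless_ipath[OF ip(1) ne(1), of ?V] chordless_ipath[OF ip(2) ne(2), of ?V]
      chordless_ipath[OF ip(3) ne(3), of ?V] h by auto
  moreover have "set P \<inter> set Q = {c}" "set P \<inter> set R = {c}" "set Q \<inter> set R = {c}" using a by auto
  moreover have "vwalk_length P \<ge> 1" "vwalk_length Q \<ge> 1" "vwalk_length R \<ge> 1" using l by simp_all
  moreover have "vwalk_length P \<ge> 2 \<and> vwalk_length Q \<ge> 2 \<or> vwalk_length P \<ge> 2 \<and> vwalk_length R \<ge> 2 \<or>
      vwalk_length Q \<ge> 2 \<and> vwalk_length R \<ge> 2" using l' by auto
  moreover have "parcs (induced G ?V) = ?X" "pverts (induced G ?V) = ?V" using calculation(1) by simp_all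
  ultimately have "pyramid (induced G ?V)"
    unfolding pyramid_def using pair_graph_induced[OF pg V] by blast
  then show ?thesis using V by blast
qed

lemma prism_of_pairs:
  assumes t: "prism_pair P Q" "prism_pair P R" "prism_pair Q R"
    and l: "length P \<ge> 2 \<and> length Q \<ge> 2 \<and> length R \<ge> 2 \<or>
     length P = 1 \<and> length Q \<ge> 3 \<and> length R \<ge> 3 \<or>
     length Q = 1 \<and> length P \<ge> 3 \<and> length R \<ge> 3 \<or>
     length R = 1 \<and> length P \<ge> 3 \<and> length Q \<ge> 3"
  shows "\<exists>V. V \<subseteq> pverts G \<and> prism (induced G V)"
proof -
  note a = t[unfolded prism_pair_def]
  let ?V = "set P \<union> set Q \<union> set R"
  have ip: "ipath P" "ipath Q" "ipath R" and ne: "P \<noteq> []" "Q \<noteq> []" "R \<noteq> []" using a by auto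
  let ?a1 = "hd P" and ?a2 = "hd Q" and ?a3 = "hd R" and ?b1 = "last P" and ?b2 = "last Q" and ?b3 = "last R"
  have hl: "?a1 \<in> set P" "?b1 \<in> set P" "?a2 \<in> set Q" "?b2 \<in> set Q" "?a3 \<in> set R" "?b3 \<in> set R" using ne by auto
  have e: "adj G ?a1 ?a2" "adj G ?a1 ?a3" "adj G ?a2 ?a3" "adj G ?b1 ?b2" "adj G ?b1 ?b3" "adj G ?b2 ?b3"
    using t hl unfolding prism_pair_def by blast+
  have d: "?a1 \<noteq> ?a2" "?a1 \<noteq> ?a3" "?a2 \<noteq> ?a3" "?b1 \<noteq> ?b2" "?b1 \<noteq> ?b3" "?b2 \<noteq> ?b3" using e E_neq by blast+
  \<comment> \<open>A path of a prism may be a single vertex; then an edge of the triangle shows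
    that it belongs to the graph.\<close>
  have pv: "set p \<subseteq> pverts G" if p: "p \<noteq> []" "ipath p" "adj G (hd p) x \<or> adj G x (hd p)" for p x
  proof (cases "length p \<ge> 2")
    case True
    then show ?thesis using ipath_verts p(2) by blast
  next
    case False
    then have "p = [hd p]" using p(1) by (cases p; cases "tl p") auto
    then have "set p = {hd p}" by (metis list.set(1) list.set(2))
    then show ?thesis using adj_verts p(3) by auto
  qed
  have V: "?V \<subseteq> pverts G"
    using pv[OF ne(1) ip(1), of ?a2] pv[OF ne(2) ip(2), of ?a1] pv[OF ne(3) ip(3), of ?a1] e by blast
  let ?T = "triangle_edges ?a1 ?a2 ?a3" and ?T' = "triangle_edges ?b1 ?b2 ?b3"
  let ?X = "path_edges P \<union> path_edges Q \<union> path_edges R \<union> ?T \<union> ?T'"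
  have tr: "(?a1, ?a2) \<in> ?T" "(?a1, ?a3) \<in> ?T" "(?a2, ?a3) \<in> ?T"
     "(?b1, ?b2) \<in> ?T'" "(?b1, ?b3) \<in> ?T'" "(?b2, ?b3) \<in> ?T'" using d unfolding triangle_edges_def by auto
  have pairX: "(u, v) = (hd p, hd q) \<or> (u, v) = (last p, last q)"
    if "prism_pair p q" "u \<in> set p" "v \<in> set q" "adj G u v" for p q u v
    using that by (simp add: prism_pair_def)
  have "parcs G \<inter> ?V \<times> ?V = ?X"
  proof (rule edges_in_union[OF ip])
    show "sym ?X" using sym_path_edges triangle_edges_sym by (intro sym_Un)
    have hV: "{?a1, ?a2, ?a3} \<subseteq> ?V" "{?b1, ?b2, ?b3} \<subseteq> ?V" using hl by simp_all
    show "?X \<subseteq> parcs G \<inter> ?V \<times> ?V"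
      by (intro Un_least path_edges_parcs ip triangle_edges_parcs[OF e(1-3) hV(1)]
          triangle_edges_parcs[OF e(4-6) hV(2)]) auto
    show "(u, v) \<in> ?X" if "u \<in> set P" "v \<in> set Q" "adj G u v" for u v
      using pairX[OF t(1) that] tr(1,4) by auto
    show "(u, v) \<in> ?X" if "u \<in> set P" "v \<in> set R" "adj G u v" for u v
      using pairX[OF t(2) that] tr(2,5) by auto
    show "(u, v) \<in> ?X" if "u \<in> set Q" "v \<in> set R" "adj G u v" for u v
      using pairX[OF t(3) that] tr(3,6) by auto
  qed blast
  moreover have "chordless_path (induced G ?V) ?a1 P ?b1" "chordless_path (induced G ?V) ?a2 Q ?b2"
    "chordless_path (induced G ?V) ?a3 R ?b3"
    using chordless_ipath[OF ip(1) ne(1), of ?V] chordless_ipath[OF ip(2) ne(2), of ?V]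
      chordless_ipath[OF ip(3) ne(3), of ?V] by auto
  moreover have "set P \<inter> set Q = {}" "set P \<inter> set R = {}" "set Q \<inter> set R = {}" using a by auto
  moreover have "vwalk_length P \<ge> 1 \<and> vwalk_length Q \<ge> 1 \<and> vwalk_length R \<ge> 1 \<or>
       vwalk_length P = 0 \<and> vwalk_length Q \<ge> 2 \<and> vwalk_length R \<ge> 2 \<or>
       vwalk_length Q = 0 \<and> vwalk_length P \<ge> 2 \<and> vwalk_length R \<ge> 2 \<or>
       vwalk_length R = 0 \<and> vwalk_length P \<ge> 2 \<and> vwalk_length Q \<ge> 2"
  proof -
    \<comment> \<open>From vertex counts to \<open>vwalk_length\<close>, which counts edges.\<close>
    have len: "vwalk_length p \<ge> n - 1" if "length p \<ge> n" for p :: "'a list" and n using that by simp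
    have len1: "vwalk_length p = 0" if "length p = 1" for p :: "'a list" using that by simp
    show ?thesis
      using l len[of 2 P] len[of 2 Q] len[of 2 R] len[of 3 P] len[of 3 Q] len[of 3 R] len1[of P] len1[of Q] len1[of R]
      by (elim disjE conjE) (simp_all del: vwalk_length_simp)
  qed
  moreover have "parcs (induced G ?V) = ?X" "pverts (induced G ?V) = ?V" using calculation(1) by simp_all
  ultimately have "prism (induced G ?V)"
    unfolding prism_def using pair_graph_induced[OF pg V] by blast
  then show ?thesis using V by blast
qed

lemma has_3pc_induced:
  assumes has_3pc
  shows "\<exists>H. induced_subgraph (with_proj H) (with_proj G) \<and> three_path_configuration H"
proof -
  have "\<exists>V. V \<subseteq> pverts G \<and> three_path_configuration (induced G V)"
    using assms unfolding has_3pc_def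
  proof (elim disjE)
    assume has_theta
    then show ?thesis unfolding has_theta_def three_path_configuration_def using theta_of_pairs by meson
  next
    assume has_pyramid
    then show ?thesis unfolding has_pyramid_def three_path_configuration_def using pyramid_of_pairs by meson
  next
    assume has_prism
    then show ?thesis unfolding has_prism_def three_path_configuration_def using prism_of_pairs by meson
  qed
  then show ?thesis using induced_subgraph_induced[OF pg] by blast
qed

subsection \<open>Models of induced minors\<close>

text \<open>The branch sets of an induced minor. The equivalence is what distinguishes it from an
  ordinary minor, where branch sets of nonadjacent vertices may touch.\<close>

definition minor_model :: "'a pair_pre_digraph \<Rightarrow> ('a \<Rightarrow> 'a set) \<Rightarrow> bool" where
  "minor_model G' \<phi> \<longleftrightarrow> parcs G' \<subseteq> pverts G' \<times> pverts G' \<and>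
    (\<forall>x\<in>pverts G'. conn (\<phi> x) \<and> \<phi> x \<subseteq> pverts G) \<and>
    (\<forall>x\<in>pverts G'. \<forall>y\<in>pverts G'. x \<noteq> y \<longrightarrow> \<phi> x \<inter> \<phi> y = {} \<and> ((x, y) \<in> parcs G' \<longleftrightarrow> meets (\<phi> x) (\<phi> y)))"

lemma meets_Un: "meets (X \<union> Y) Z \<longleftrightarrow> meets X Z \<or> meets Y Z" "meets Z (X \<union> Y) \<longleftrightarrow> meets Z X \<or> meets Z Y"
  unfolding meets_def by blast+

lemma minor_model_step:
  assumes m: "minor_model G' \<phi>" and s: "induced_minor_step G' G''"
  shows "\<exists>\<psi>. minor_model G'' \<psi>"
  using s
proof cases
  case (delete v)
  then have v: "pverts G'' = pverts G' - {v}"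
    "parcs G'' = {a \<in> parcs G'. fst a \<noteq> v \<and> snd a \<noteq> v}"
    by (auto simp: pre_digraph.del_vert_def with_proj_def)
  have "minor_model G'' \<phi>"
    using m unfolding minor_model_def v by auto
  then show ?thesis by blast
next
  case (contract u v)
  have uv: "u \<in> pverts G'" "v \<in> pverts G'" using m contract(2) unfolding minor_model_def by auto
  note m1 = m[unfolded minor_model_def, THEN conjunct1]
    and m2 = m[unfolded minor_model_def, THEN conjunct2, THEN conjunct1, rule_format]
    and m3 = m[unfolded minor_model_def, THEN conjunct2, THEN conjunct2, rule_format]
  let ?f = "\<lambda>x. if x = v then u else x"
  have c: "pverts G'' = ?f ` pverts G'" "parcs G'' = {(?f x, ?f y) | x y. (x, y) \<in> parcs G' \<and> ?f x \<noteq> ?f y}"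
    using contract(1) unfolding contract_edge_def Let_def by simp_all
  \<comment> \<open>Contraction unites the two branch sets, and the contracted arc makes the union
    connected. Since \<open>minor_model\<close> does not speak about loops, \<open>u = v\<close> is
    treated too.\<close>
  define \<psi> where "\<psi> x = (if x = u then \<phi> u \<union> \<phi> v else \<phi> x)" for x
  have cu: "conn (\<phi> u \<union> \<phi> v)"
  proof (cases "u = v")
    case False
    then have "meets (\<phi> u) (\<phi> v)" using m3[OF uv False] contract(2) by blast
    then show ?thesis using conn_union m2[OF uv(1)] m2[OF uv(2)] by blast
  qed (use m2 uv in simp)
  have pv: "pverts G'' = pverts G' - (if u = v then {} else {v})" using uv unfolding c(1) by auto
  have sub: "x \<in> pverts G'" "x = v \<Longrightarrow> u = v" if "x \<in> pverts G''" for x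
    using that unfolding pv by (auto split: if_splits)
  have arcs: "(x, y) \<in> parcs G'' \<longleftrightarrow> meets (\<psi> x) (\<psi> y)" and disj: "\<psi> x \<inter> \<psi> y = {}"
    if x: "x \<in> pverts G''" and y: "y \<in> pverts G''" and xy: "x \<noteq> y" for x y
  proof -
    have x': "x \<in> pverts G'" "x = v \<Longrightarrow> u = v" and y': "y \<in> pverts G'" "y = v \<Longrightarrow> u = v"
      using sub x y by auto
    have arc: "(x, y) \<in> parcs G'' \<longleftrightarrow> (x, y) \<in> parcs G' \<or> (x = u \<and> (v, y) \<in> parcs G') \<or> (y = u \<and> (x, v) \<in> parcs G')"
    proof
      assume "(x, y) \<in> parcs G''"
      then show "(x, y) \<in> parcs G' \<or> (x = u \<and> (v, y) \<in> parcs G') \<or> (y = u \<and> (x, v) \<in> parcs G')"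
        unfolding c(2) by (auto split: if_splits)
    next
      assume r: "(x, y) \<in> parcs G' \<or> (x = u \<and> (v, y) \<in> parcs G') \<or> (y = u \<and> (x, v) \<in> parcs G')"
      have fxy: "?f x = x" "?f y = y" using x'(2) y'(2) by auto
      have "\<exists>a b. (x, y) = (?f a, ?f b) \<and> (a, b) \<in> parcs G' \<and> ?f a \<noteq> ?f b"
        using r
      proof (elim disjE conjE)
        assume "(x, y) \<in> parcs G'"
        then show ?thesis using fxy xy by (intro exI[of _ x] exI[of _ y]) simp
      next
        assume "x = u" "(v, y) \<in> parcs G'"
        then show ?thesis using fxy xy by (intro exI[of _ v] exI[of _ y]) simp
      next
        assume "y = u" "(x, v) \<in> parcs G'"
        then show ?thesis using fxy xy by (intro exI[of _ x] exI[of _ v]) simp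
      qed
      then show "(x, y) \<in> parcs G''" unfolding c(2) by blast
    qed
    consider "x = u" "y \<noteq> u" | "x \<noteq> u" "y = u" | "x \<noteq> u" "y \<noteq> u" using xy by blast
    then show "(x, y) \<in> parcs G'' \<longleftrightarrow> meets (\<psi> x) (\<psi> y)"
    proof cases
      case 1
      have "y \<noteq> v" using 1 y'(2) by blast
      then show ?thesis
        using arc m3[OF uv(1) y'(1)] m3[OF uv(2) y'(1)] 1 unfolding \<psi>_def by (auto simp: meets_Un)
    next
      case 2
      have "x \<noteq> v" using 2 x'(2) by blast
      then show ?thesis
        using arc m3[OF x'(1) uv(1)] m3[OF x'(1) uv(2)] 2 unfolding \<psi>_def by (auto simp: meets_Un)
    next
      case 3
      then show ?thesis using arc m3[OF x'(1) y'(1) xy] unfolding \<psi>_def by auto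
    qed
    have d: "\<phi> a \<inter> \<phi> b = {}" if "a \<in> pverts G'" "b \<in> pverts G'" "a \<noteq> b" for a b
      using m3[OF that] by (rule conjunct1)
    consider "x = u" "y \<noteq> u" | "x \<noteq> u" "y = u" | "x \<noteq> u" "y \<noteq> u" using xy by blast
    then show "\<psi> x \<inter> \<psi> y = {}"
    proof cases
      case 1
      have "y \<noteq> v" using 1 y'(2) by blast
      then have "\<phi> u \<inter> \<phi> y = {}" "\<phi> v \<inter> \<phi> y = {}" using d uv y'(1) 1 by metis+
      then show ?thesis using 1 by (simp add: \<psi>_def Int_Un_distrib2)
    next
      case 2
      have "x \<noteq> v" using 2 x'(2) by blast
      then have "\<phi> x \<inter> \<phi> u = {}" "\<phi> x \<inter> \<phi> v = {}" using d uv x'(1) 2 by metis+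
      then show ?thesis using 2 by (simp add: \<psi>_def Int_Un_distrib)
    next
      case 3
      then show ?thesis using d[OF x'(1) y'(1) xy] by (simp add: \<psi>_def)
    qed
  qed
  have "parcs G'' \<subseteq> pverts G'' \<times> pverts G''"
    using m1 unfolding c by auto
  moreover have "conn (\<psi> x) \<and> \<psi> x \<subseteq> pverts G" if "x \<in> pverts G''" for x
    using cu m2[OF sub(1)[OF that]] m2[OF uv(1)] m2[OF uv(2)] unfolding \<psi>_def by auto
  ultimately have "minor_model G'' \<psi>"
    unfolding minor_model_def using arcs disj by blast
  then show ?thesis by blast
qed

lemma minor_model_exists:
  assumes "induced_minor_step\<^sup>*\<^sup>* G G'"
  shows "\<exists>\<phi>. minor_model G' \<phi>"
  using assms
proof induction
  case base
  have "parcs G \<subseteq> pverts G \<times> pverts G" using adj_verts unfolding adj_def by auto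
  moreover have "(x, y) \<in> parcs G \<longleftrightarrow> meets {x} {y}" for x y by (simp add: meets_def adj_def)
  ultimately have "minor_model G (\<lambda>x. {x})" unfolding minor_model_def by simp
  then show ?case by blast
next
  case (step G1 G2)
  then show ?case using minor_model_step by blast
qed

end

text \<open>A digraph isomorphism also carries an arc map and its own tail and head functions.
  Between \<open>with_proj\<close> graphs these functions are \<open>fst\<close> and
  \<open>snd\<close>, so the arc map is determined by the vertex map, whose inverse is
  \<open>h\<close>.\<close>

lemma iso_transfer:
  assumes "digraph_iso (with_proj G) (with_proj H)"
  obtains h where "bij_betw h (pverts H) (pverts G)"
    "\<And>x y. x \<in> pverts H \<Longrightarrow> y \<in> pverts H \<Longrightarrow> (h x, h y) \<in> parcs G \<longleftrightarrow> (x, y) \<in> parcs H"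
proof -
  obtain i where i: "pre_digraph.digraph_isomorphism (with_proj G) i" "with_proj H = app_iso i (with_proj G)"
    using assms unfolding digraph_iso_def by blast
  have wf: "wf_digraph (with_proj G)" and inj: "inj_on (iso_verts i) (pverts G)"
    and arc: "\<And>a. a \<in> parcs G \<Longrightarrow> iso_verts i (fst a) = iso_tail i (iso_arcs i a) \<and>
      iso_verts i (snd a) = iso_head i (iso_arcs i a)"
    using i(1) unfolding pre_digraph.digraph_isomorphism_def by auto
  have "verts (with_proj H) = verts (app_iso i (with_proj G))" "arcs (with_proj H) = arcs (app_iso i (with_proj G))"
     "tail (with_proj H) = tail (app_iso i (with_proj G))" "head (with_proj H) = head (app_iso i (with_proj G))"
    using i(2) by simp_all
  then have H: "pverts H = iso_verts i ` pverts G" "parcs H = iso_arcs i ` parcs G" "iso_tail i = fst" "iso_head i = snd"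
    by auto
  have pa: "iso_arcs i (x, y) = (iso_verts i x, iso_verts i y)" if "(x, y) \<in> parcs G" for x y
    using arc[OF that] H(3,4) by (metis fst_conv prod.collapse snd_conv)
  have wf': "x \<in> pverts G \<and> y \<in> pverts G" if "(x, y) \<in> parcs G" for x y
    using wf_digraph.wellformed[OF wf, of "(x, y)"] that by auto
  have e: "(iso_verts i x, iso_verts i y) \<in> parcs H \<longleftrightarrow> (x, y) \<in> parcs G" if "x \<in> pverts G" "y \<in> pverts G" for x y
  proof
    assume "(iso_verts i x, iso_verts i y) \<in> parcs H"
    then obtain x' y' where xy: "(x', y') \<in> parcs G" "iso_arcs i (x', y') = (iso_verts i x, iso_verts i y)"
      unfolding H(2) by auto
    then have "iso_verts i x' = iso_verts i x" "iso_verts i y' = iso_verts i y" using pa by auto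
    then have "x' = x" "y' = y" using wf'[OF xy(1)] that inj unfolding inj_on_def by auto
    then show "(x, y) \<in> parcs G" using xy(1) by simp
  next
    assume "(x, y) \<in> parcs G"
    then show "(iso_verts i x, iso_verts i y) \<in> parcs H" using pa[of x y] unfolding H(2) by (metis image_eqI)
  qed
  have b: "bij_betw (iso_verts i) (pverts G) (pverts H)" using inj H(1) unfolding bij_betw_def by simp
  let ?h = "inv_into (pverts G) (iso_verts i)"
  show thesis
  proof (rule that)
    show b': "bij_betw ?h (pverts H) (pverts G)" using b by (rule bij_betw_inv_into)
    fix x y assume "x \<in> pverts H" "y \<in> pverts H"
    then show "(?h x, ?h y) \<in> parcs G \<longleftrightarrow> (x, y) \<in> parcs H"
      using e[of "?h x" "?h y"] bij_betwE[OF b'] bij_betw_inv_into_right[OF b] by metis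
  qed
qed

theorem theorem1p4:
  fixes G :: "'a pair_pre_digraph" and K :: "'b pair_pre_digraph"
  assumes "pair_graph G"
    and "K\<^bsub>3,4\<^esub> (with_proj K)"
    and "induced_minor K G"
  shows "\<exists>H. induced_subgraph (with_proj H) (with_proj G) \<and> three_path_configuration H"
proof -
  interpret pgraph G
    by (intro pgraph.intro pgraph_axioms.intro sgraph_adj assms(1))
  obtain G' where G': "induced_minor_step\<^sup>*\<^sup>* G G'" "digraph_iso (with_proj G') (with_proj K)"
    using assms(3) unfolding induced_minor_def by blast
  obtain \<phi> where \<phi>: "minor_model G' \<phi>" using minor_model_exists[OF G'(1)] by blast
  obtain h where h: "bij_betw h (pverts K) (pverts G')"
    "\<And>x y. x \<in> pverts K \<Longrightarrow> y \<in> pverts K \<Longrightarrow> (h x, h y) \<in> parcs G' \<longleftrightarrow> (x, y) \<in> parcs K"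
    using iso_transfer[OF G'(2)] by blast
  obtain U V where UV: "pverts K = U \<union> V" "U \<inter> V = {}" "card U = 3" "card V = 4" "parcs K = U \<times> V \<union> V \<times> U"
    using assms(2) unfolding complete_bipartite_digraph_pair_def by blast
  have fin: "finite U" "finite V" using UV(3,4) card.infinite by fastforce+
  obtain f where f: "bij_betw f {0..<3::nat} U" using ex_bij_betw_nat_finite[OF fin(1)] UV(3) by auto
  obtain g where g: "bij_betw g {0..<4::nat} V" using ex_bij_betw_nat_finite[OF fin(2)] UV(4) by auto
  have fU: "f i \<in> U" if "i < 3" for i using bij_betwE[OF f] that by auto
  have gV: "g j \<in> V" if "j < 4" for j using bij_betwE[OF g] that by auto
  have finj: "f i \<noteq> f j" if "i < 3" "j < 3" "i \<noteq> j" for i j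
    using bij_betw_imp_inj_on[OF f] that unfolding inj_on_def by auto
  have ginj: "g i \<noteq> g j" if "i < 4" "j < 4" "i \<noteq> j" for i j
    using bij_betw_imp_inj_on[OF g] that unfolding inj_on_def by auto
  define \<psi> where "\<psi> x = \<phi> (h x)" for x
  have hin: "h x \<in> pverts G'" if "x \<in> U \<union> V" for x using bij_betwE[OF h(1)] UV(1) that by blast
  have hinj: "h x \<noteq> h y" if "x \<in> U \<union> V" "y \<in> U \<union> V" "x \<noteq> y" for x y
    using bij_betw_imp_inj_on[OF h(1)] UV(1) that unfolding inj_on_def by blast
  have c: "conn (\<psi> x)" "finite (\<psi> x)" if "x \<in> U \<union> V" for x
  proof -
    interpret pair_graph G by (rule assms(1))
    have "conn (\<psi> x)" "\<psi> x \<subseteq> pverts G"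
      using \<phi> hin[OF that] unfolding minor_model_def \<psi>_def by blast+
    then show "conn (\<psi> x)" "finite (\<psi> x)" using pair_finite_verts finite_subset by blast+
  qed
  have m: "\<psi> x \<inter> \<psi> y = {}" "meets (\<psi> x) (\<psi> y) \<longleftrightarrow> (x, y) \<in> parcs K"
    if "x \<in> U \<union> V" "y \<in> U \<union> V" "x \<noteq> y" for x y
    using \<phi> hin[OF that(1)] hin[OF that(2)] hinj[OF that] h(2)[of x y] that(1,2) UV(1)
    unfolding minor_model_def \<psi>_def by blast+
  have sepI: "sep (\<psi> x) (\<psi> y)" if "x \<in> U \<union> V" "y \<in> U \<union> V" "x \<noteq> y" "(x, y) \<notin> parcs K" for x y
    using m[OF that(1-3)] that(4) unfolding sep_def meets_def by blast
  have dUV: "x \<notin> V" if "x \<in> U" for x using UV(2) that by auto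
  have nE: "(x, y) \<notin> parcs K" if "x \<in> U \<and> y \<in> U \<or> x \<in> V \<and> y \<in> V" for x y
    unfolding UV(5) using that dUV by blast
  have has_3pc
  proof (rule bipartite_model_3pc[of "\<lambda>i. \<psi> (f i)" "\<lambda>j. \<psi> (g j)"])
    show "conn (\<psi> (f i))" if "i < 3" for i using c fU[OF that] by blast
    show "conn (\<psi> (g j))" "finite (\<psi> (g j))" if "j < 4" for j using c gV[OF that] by blast+
    show "sep (\<psi> (f i)) (\<psi> (f j))" if "i < 3" "j < 3" "i \<noteq> j" for i j
      using fU[OF that(1)] fU[OF that(2)] finj[OF that] nE by (intro sepI) auto
    show "sep (\<psi> (g i)) (\<psi> (g j))" if "i < 4" "j < 4" "i \<noteq> j" for i j
      using gV[OF that(1)] gV[OF that(2)] ginj[OF that] nE by (intro sepI) auto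
    fix i j :: nat assume ij: "i < 3" "j < 4"
    have ne: "f i \<noteq> g j" using dUV[OF fU[OF ij(1)]] gV[OF ij(2)] by metis
    show "\<psi> (f i) \<inter> \<psi> (g j) = {}" using m(1)[OF _ _ ne] fU[OF ij(1)] gV[OF ij(2)] by blast
    have "(f i, g j) \<in> parcs K" unfolding UV(5) using fU[OF ij(1)] gV[OF ij(2)] by blast
    then show "meets (\<psi> (f i)) (\<psi> (g j))" using m(2)[OF _ _ ne] fU[OF ij(1)] gV[OF ij(2)] by blast
  qed
  then show ?thesis by (rule has_3pc_induced)
qed

end
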